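(* Let $X=\{1,\dots,k\}^{\mathbb N}$ with the shift $T$, let $\mu$ be the Gibbs state of a Hölder normalized potential $\log p$, and let $H>0$ be Hölder. Then for every $\beta\in\mathbb R$ there exists a KMS state for $H$ at inverse temperature $\beta$ on $\mathcal U(\mu)$, it is unique, and it is the state $\psi_\beta$ given by $$\psi_\beta(M_fe_nM_g)=\int\frac{f\,g}{\lambda^{[n]}}\,d\nu_\beta\qquad(f,g\in C(X),\ n\ge 0),$$ where $\nu_\beta$ is the eigenprobability of $\mathcal L_{-\beta\log H}^*$.
   Context: $X=\{1,\dots,k\}^{\mathbb N}$, $T$ the left shift, $C(X)$ the complex continuous functions. $p>0$ Hölder with $\sum_{T(z)=x}p(z)=1$; $\mathcal L_pf(x)=\sum_{T(z)=x}p(z)f(z)$ and $\mu$ is the probability with $\int\mathcal L_pf\,d\mu=\int f\,d\mu$. For real continuous $A$, $\mathcal L_Af(x)=\sum_{T(z)=x}e^{A(z)}f(z)$, with dual $\int f\,d(\mathcal L_A^*\nu)=\int \mathcal L_Af\,d\nu$; $\nu_\beta$ is the unique probability with $\mathcal L_{-\beta\log H}^*\nu_\beta=\lambda_\beta\nu_\beta$, $\lambda_\beta$ the largest eigenvalue of $\mathcal L_{-\beta\log H}$. $\lambda^{[n]}(x)=\prod_{j=0}^{n-1}p(T^jx)^{-1}$. On $L^2(\mu)$: $S\eta=\eta\circ T$, $S^*=\mathcal L_p$ its adjoint, $M_f\eta=f\eta$, $e_n=S^n(S^* )^n$. $\mathcal U(\mu)$ is the C*-algebra of bounded operators on $L^2(\mu)$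 generated by the $M_fS^n(S^* )^nM_g$ ($n\ge0$, $f,g\in C(X)$). The automorphism group $\sigma_t$ is determined by $\sigma_t(M_f)=M_f$, $\sigma_t(S)=M_{H^{it}}S$; $a$ is analytic if $t\mapsto\sigma_t(a)$ extends to an entire function. A state $\psi$ (positive linear functional with $\psi(1)=1$) is KMS for $H$ at $\beta$ if $\psi(ab)=\psi(b\,\sigma_{i\beta}(a))$ for all $b\in\mathcal U$ and analytic $a\in\mathcal U$. *)

theory Defs
  imports "HOL-Probability.Probability"
begin

type_synonym pt = "nat \<Rightarrow> nat"
type_synonym vec = "pt \<Rightarrow> complex"
type_synonym op = "vec \<Rightarrow> vec"

text \<open>X = {1..k}^N, carrying the product topology (instance for the function type).\<close>
definition shift_space :: "nat \<Rightarrow> pt set" where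
  "shift_space k = {x. \<forall>i. x i \<in> {1..k}}"

definition shiftT :: "pt \<Rightarrow> pt" where
  "shiftT x = (\<lambda>i. x (Suc i))"

definition preim :: "nat \<Rightarrow> pt \<Rightarrow> pt set" where
  "preim k x = {z \<in> shift_space k. shiftT z = x}"

definition shift_dist :: "pt \<Rightarrow> pt \<Rightarrow> real" where
  "shift_dist x y = (if x = y then 0 else (1/2) ^ (LEAST i. x i \<noteq> y i))"

definition holder :: "nat \<Rightarrow> (pt \<Rightarrow> real) \<Rightarrow> bool" where
  "holder k f \<longleftrightarrow> (\<exists>C \<alpha>. 0 < \<alpha> \<and>
     (\<forall>x\<in>shift_space k. \<forall>y\<in>shift_space k. \<bar>f x - f y\<bar> \<le> C * shift_dist x y powr \<alpha>))"

definition ruelle :: "nat \<Rightarrow> (pt \<Rightarrow> real) \<Rightarrow> (pt \<Rightarrow> real) \<Rightarrow> pt \<Rightarrow> real" where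
  "ruelle k A f x = (\<Sum>z\<in>preim k x. exp (A z) * f z)"

definition largest_eigenvalue :: "nat \<Rightarrow> (pt \<Rightarrow> real) \<Rightarrow> real" where
  "largest_eigenvalue k A = (GREATEST c. \<exists>f. continuous_on (shift_space k) f \<and>
       (\<exists>x\<in>shift_space k. f x \<noteq> 0) \<and>
       (\<forall>x\<in>shift_space k. ruelle k A f x = c * f x))"

definition Lp :: "nat \<Rightarrow> (pt \<Rightarrow> real) \<Rightarrow> op" where
  "Lp k p \<eta> x = (\<Sum>z\<in>preim k x. complex_of_real (p z) * \<eta> z)"

definition lambda_n :: "(pt \<Rightarrow> real) \<Rightarrow> nat \<Rightarrow> pt \<Rightarrow> real" where
  "lambda_n p n x = (\<Prod>j<n. 1 / p ((shiftT ^^ j) x))"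

definition L2 :: "pt measure \<Rightarrow> vec set" where
  "L2 \<mu> = {\<eta>. \<eta> \<in> borel_measurable \<mu> \<and> integrable \<mu> (\<lambda>x. (cmod (\<eta> x))\<^sup>2)}"

definition l2inner :: "pt measure \<Rightarrow> vec \<Rightarrow> vec \<Rightarrow> complex" where
  "l2inner \<mu> \<eta> \<zeta> = (\<integral>x. \<eta> x * cnj (\<zeta> x) \<partial>\<mu>)"

definition l2norm :: "pt measure \<Rightarrow> vec \<Rightarrow> real" where
  "l2norm \<mu> \<eta> = sqrt (\<integral>x. (cmod (\<eta> x))\<^sup>2 \<partial>\<mu>)"

text \<open>A (representative of a) bounded linear operator on L^2(mu).\<close>
definition is_bop :: "pt measure \<Rightarrow> op \<Rightarrow> bool" where
  "is_bop \<mu> A \<longleftrightarrow>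
     (\<forall>\<eta>\<in>L2 \<mu>. A \<eta> \<in> L2 \<mu>) \<and>
     (\<forall>\<eta>\<in>L2 \<mu>. \<forall>\<zeta>\<in>L2 \<mu>. (AE x in \<mu>. \<eta> x = \<zeta> x) \<longrightarrow> (AE x in \<mu>. A \<eta> x = A \<zeta> x)) \<and>
     (\<forall>\<eta>\<in>L2 \<mu>. \<forall>\<zeta>\<in>L2 \<mu>. \<forall>c. AE x in \<mu>. A (\<lambda>y. c * \<eta> y + \<zeta> y) x = c * A \<eta> x + A \<zeta> x) \<and>
     (\<exists>C. \<forall>\<eta>\<in>L2 \<mu>. l2norm \<mu> (A \<eta>) \<le> C * l2norm \<mu> \<eta>)"

definition op_eq :: "pt measure \<Rightarrow> op \<Rightarrow> op \<Rightarrow> bool" where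
  "op_eq \<mu> A B \<longleftrightarrow> (\<forall>\<eta>\<in>L2 \<mu>. AE x in \<mu>. A \<eta> x = B \<eta> x)"

definition opnorm :: "pt measure \<Rightarrow> op \<Rightarrow> real" where
  "opnorm \<mu> A = Sup {l2norm \<mu> (A \<eta>) | \<eta>. \<eta> \<in> L2 \<mu> \<and> l2norm \<mu> \<eta> \<le> 1}"

definition op_add :: "op \<Rightarrow> op \<Rightarrow> op" where
  "op_add A B = (\<lambda>\<eta> x. A \<eta> x + B \<eta> x)"

definition op_scale :: "complex \<Rightarrow> op \<Rightarrow> op" where
  "op_scale c A = (\<lambda>\<eta> x. c * A \<eta> x)"

definition op_diff :: "op \<Rightarrow> op \<Rightarrow> op" where
  "op_diff A B = (\<lambda>\<eta> x. A \<eta> x - B \<eta> x)"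

definition op_adj :: "pt measure \<Rightarrow> op \<Rightarrow> op" where
  "op_adj \<mu> A = (SOME B. is_bop \<mu> B \<and>
      (\<forall>\<eta>\<in>L2 \<mu>. \<forall>\<zeta>\<in>L2 \<mu>. l2inner \<mu> (A \<eta>) \<zeta> = l2inner \<mu> \<eta> (B \<zeta>)))"

definition Mop :: "(pt \<Rightarrow> complex) \<Rightarrow> op" where
  "Mop f = (\<lambda>\<eta> x. f x * \<eta> x)"

definition Sop :: op where
  "Sop = (\<lambda>\<eta>. \<eta> \<circ> shiftT)"

text \<open>e_n = S^n (S^*)^n with S^* = L_p.\<close>
definition e_op :: "nat \<Rightarrow> (pt \<Rightarrow> real) \<Rightarrow> nat \<Rightarrow> op" where
  "e_op k p n = (Sop ^^ n) \<circ> (Lp k p ^^ n)"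

definition generators :: "nat \<Rightarrow> (pt \<Rightarrow> real) \<Rightarrow> op set" where
  "generators k p = {Mop f \<circ> e_op k p n \<circ> Mop g | f g n.
       continuous_on (shift_space k) f \<and> continuous_on (shift_space k) g}"

inductive_set star_alg :: "nat \<Rightarrow> (pt \<Rightarrow> real) \<Rightarrow> pt measure \<Rightarrow> op set"
  for k p \<mu> where
  gen: "A \<in> generators k p \<Longrightarrow> A \<in> star_alg k p \<mu>"
| add: "A \<in> star_alg k p \<mu> \<Longrightarrow> B \<in> star_alg k p \<mu> \<Longrightarrow> op_add A B \<in> star_alg k p \<mu>"
| scale: "A \<in> star_alg k p \<mu> \<Longrightarrow> op_scale c A \<in> star_alg k p \<mu>"
| mult: "A \<in> star_alg k p \<mu> \<Longrightarrow> B \<in> star_alg k p \<mu> \<Longrightarrow> A \<circ> B \<in> star_alg k p \<mu>"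
| adj: "A \<in> star_alg k p \<mu> \<Longrightarrow> op_adj \<mu> A \<in> star_alg k p \<mu>"

text \<open>U(mu): the norm closure (C*-algebra generated), as a set of operator representatives.\<close>
definition Ualg :: "nat \<Rightarrow> (pt \<Rightarrow> real) \<Rightarrow> pt measure \<Rightarrow> op set" where
  "Ualg k p \<mu> = {A. is_bop \<mu> A \<and>
      (\<forall>\<epsilon>>0. \<exists>B\<in>star_alg k p \<mu>. opnorm \<mu> (op_diff A B) < \<epsilon>)}"

definition is_state :: "nat \<Rightarrow> (pt \<Rightarrow> real) \<Rightarrow> pt measure \<Rightarrow> (op \<Rightarrow> complex) \<Rightarrow> bool" where
  "is_state k p \<mu> \<psi> \<longleftrightarrow>
     (\<forall>A\<in>Ualg k p \<mu>. \<forall>B\<in>Ualg k p \<mu>. op_eq \<mu> A B \<longrightarrow> \<psi> A = \<psi> B) \<and>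
     (\<forall>A\<in>Ualg k p \<mu>. \<forall>B\<in>Ualg k p \<mu>. \<forall>c. \<psi> (op_add (op_scale c A) B) = c * \<psi> A + \<psi> B) \<and>
     (\<forall>A\<in>Ualg k p \<mu>. Im (\<psi> (op_adj \<mu> A \<circ> A)) = 0 \<and> Re (\<psi> (op_adj \<mu> A \<circ> A)) \<ge> 0) \<and>
     \<psi> id = 1"

definition Hit :: "(pt \<Rightarrow> real) \<Rightarrow> real \<Rightarrow> nat \<Rightarrow> pt \<Rightarrow> complex" where
  "Hit H t n x = (\<Prod>j<n. cis (t * ln (H ((shiftT ^^ j) x))))"

text \<open>sigma is a one-parameter group of *-automorphisms of U(mu) with sigma_t(M_f) = M_f and
  sigma_t(S) = M_{H^{it}} S; on generators this reads
  sigma_t(M_f e_n M_g) = M_{f h_n^{it}} e_n M_{g h_n^{-it}}.\<close>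
definition is_dynamics :: "nat \<Rightarrow> (pt \<Rightarrow> real) \<Rightarrow> pt measure \<Rightarrow> (pt \<Rightarrow> real) \<Rightarrow> (real \<Rightarrow> op \<Rightarrow> op) \<Rightarrow> bool" where
  "is_dynamics k p \<mu> H \<sigma> \<longleftrightarrow> (\<forall>t.
     (\<forall>A\<in>Ualg k p \<mu>. \<sigma> t A \<in> Ualg k p \<mu>) \<and>
     (\<forall>A\<in>Ualg k p \<mu>. \<forall>B\<in>Ualg k p \<mu>. op_eq \<mu> A B \<longrightarrow> op_eq \<mu> (\<sigma> t A) (\<sigma> t B)) \<and>
     (\<forall>A\<in>Ualg k p \<mu>. \<forall>B\<in>Ualg k p \<mu>. \<forall>c.
         op_eq \<mu> (\<sigma> t (op_add (op_scale c A) B)) (op_add (op_scale c (\<sigma> t A)) (\<sigma> t B))) \<and>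
     (\<forall>A\<in>Ualg k p \<mu>. \<forall>B\<in>Ualg k p \<mu>. op_eq \<mu> (\<sigma> t (A \<circ> B)) (\<sigma> t A \<circ> \<sigma> t B)) \<and>
     (\<forall>A\<in>Ualg k p \<mu>. op_eq \<mu> (\<sigma> t (op_adj \<mu> A)) (op_adj \<mu> (\<sigma> t A))) \<and>
     (\<forall>B\<in>Ualg k p \<mu>. \<exists>A\<in>Ualg k p \<mu>. op_eq \<mu> (\<sigma> t A) B) \<and>
     (\<forall>s. \<forall>A\<in>Ualg k p \<mu>. op_eq \<mu> (\<sigma> (s + t) A) (\<sigma> s (\<sigma> t A))) \<and>
     (\<forall>A\<in>Ualg k p \<mu>. op_eq \<mu> (\<sigma> 0 A) A) \<and>
     (\<forall>f g n. continuous_on (shift_space k) f \<longrightarrow> continuous_on (shift_space k) g \<longrightarrow>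
         op_eq \<mu> (\<sigma> t (Mop f \<circ> e_op k p n \<circ> Mop g))
                 (Mop (\<lambda>x. f x * Hit H t n x) \<circ> e_op k p n \<circ> Mop (\<lambda>x. g x * cnj (Hit H t n x)))))"

definition op_entire :: "pt measure \<Rightarrow> (complex \<Rightarrow> op) \<Rightarrow> bool" where
  "op_entire \<mu> F \<longleftrightarrow> (\<forall>z. \<exists>D. is_bop \<mu> D \<and>
     ((\<lambda>h. opnorm \<mu> (\<lambda>\<eta> x. (F (z + h) \<eta> x - F z \<eta> x) / h - D \<eta> x)) \<longlongrightarrow> 0) (at 0))"

text \<open>F is an entire extension of t \<mapsto> sigma_t(a); then sigma_{i beta}(a) = F (i beta).\<close>
definition analytic_ext :: "nat \<Rightarrow> (pt \<Rightarrow> real) \<Rightarrow> pt measure \<Rightarrow> (real \<Rightarrow> op \<Rightarrow> op) \<Rightarrow> op \<Rightarrow> (complex \<Rightarrow> op) \<Rightarrow> bool" where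
  "analytic_ext k p \<mu> \<sigma> a F \<longleftrightarrow> a \<in> Ualg k p \<mu> \<and> (\<forall>z. F z \<in> Ualg k p \<mu>) \<and>
     (\<forall>t::real. op_eq \<mu> (F (complex_of_real t)) (\<sigma> t a)) \<and> op_entire \<mu> F"

definition is_KMS :: "nat \<Rightarrow> (pt \<Rightarrow> real) \<Rightarrow> pt measure \<Rightarrow> (real \<Rightarrow> op \<Rightarrow> op) \<Rightarrow> real \<Rightarrow> (op \<Rightarrow> complex) \<Rightarrow> bool" where
  "is_KMS k p \<mu> \<sigma> \<beta> \<psi> \<longleftrightarrow> is_state k p \<mu> \<psi> \<and>
     (\<forall>a b F. b \<in> Ualg k p \<mu> \<longrightarrow> analytic_ext k p \<mu> \<sigma> a F \<longrightarrow>
        \<psi> (a \<circ> b) = \<psi> (b \<circ> F (\<i> * complex_of_real \<beta>)))"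

end

(* Elements of the dense subalgebra are integral operators with continuous kernels over the tail
   relations T^n x = T^n y. Restriction to the diagonal is contractive for the operator norm, so
   integrating the diagonal against nu extends to a state. Conformality of nu under the tail relation
   is the KMS identity for kernels; for a general analytic element both sides of the identity are
   values of entire functions that agree on the real line. The invariance needed there uses that
   *-homomorphisms are contractive, which, like the boundedness of states, follows from square roots
   of 1 - c for small self-adjoint c.

   Conversely, the KMS condition kills the off-diagonal part of a state and makes its restriction to
   C(X) invariant under the weighted averages over tail classes. Bounded distortion and a Doeblin
   contraction make these averages converge uniformly to constants, so the restriction is nu. *)

theory Submission
  imports Defs "HOL-Complex_Analysis.Complex_Analysis"
begin


section \<open>The shift space and its tail relations\<close>

text \<open>Operators are maps on representatives, linear and well defined only
  \<open>\<mu>\<close>-almost everywhere, while the eigenprobability \<open>\<nu>\<close> may be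
  singular to \<open>\<mu>\<close>. The diagonal of a kernel must therefore be recovered from the
  operator at every point; this works because kernels are continuous and \<open>\<mu>\<close>
  charges every cylinder. Invariance of \<open>\<mu>\<close> is known for continuous functions and
  has to reach Borel functions before kernels even act on L2.

  Neither states nor automorphisms come with a norm bound, and \<open>op_adj\<close> is a choice
  that means nothing until an adjoint is known to exist. Both gaps are closed by completeness: an
  adjoint is a limit of adjoints of kernels, a square root is the limit of a fixed point iteration.

  The common currency is the cocycle \<open>energy n x - energy n y\<close>, independent of n for
  related points. Multiplying a kernel by the exponential of z times the cocycle gives the dynamics
  for imaginary z and the density that describes \<open>\<nu>\<close> for real z, so the analytic
  continuation in the KMS condition is an explicit formula on kernels.\<close>

lemma shiftT_iterate: "(shiftT ^^ j) x = (\<lambda>i. x (i + j))"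
  by (induction j arbitrary: x) (auto simp: shiftT_def)

text \<open>For a fixed word this is a continuous choice of a point in each tail class; it turns
  sums over the moving sets \<open>tail n x\<close> into sums over a fixed finite index set.\<close>

definition glue :: "nat \<Rightarrow> pt \<Rightarrow> pt \<Rightarrow> pt" where
  "glue n w x = (\<lambda>i. if i < n then w i else x i)"

locale full_shift =
  fixes k :: nat
begin

abbreviation X :: "pt set" where "X \<equiv> shift_space k"

definition tail_rel :: "nat \<Rightarrow> (pt \<times> pt) set" where
  "tail_rel n = {(x, y). x \<in> X \<and> y \<in> X \<and> (\<forall>i\<ge>n. y i = x i)}"

definition tail :: "nat \<Rightarrow> pt \<Rightarrow> pt set" where
  "tail n x = {y \<in> X. \<forall>i\<ge>n. y i = x i}"

text \<open>Words of length \<open>n\<close>, padded by the letter 1 so that they are points of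
  \<open>X\<close> themselves and \<open>glue\<close> applies to them.\<close>

definition wds :: "nat \<Rightarrow> pt set" where
  "wds n = tail n (\<lambda>_. 1)"

lemma glue_in: "w \<in> X \<Longrightarrow> x \<in> X \<Longrightarrow> glue n w x \<in> X"
  by (auto simp: glue_def shift_space_def)

lemma shift_in: "x \<in> X \<Longrightarrow> (shiftT ^^ j) x \<in> X"
  by (auto simp: shift_space_def shiftT_iterate)

lemma tail_in: "y \<in> tail n x \<Longrightarrow> y \<in> X"
  by (simp add: tail_def)

lemma tail_refl: "x \<in> X \<Longrightarrow> x \<in> tail n x"
  by (simp add: tail_def)

lemma tail_eq: "y \<in> tail n x \<Longrightarrow> tail n y = tail n x"
  by (auto simp: tail_def)

lemma tail_sym: "x \<in> X \<Longrightarrow> y \<in> tail n x \<Longrightarrow> x \<in> tail n y"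
  by (auto simp: tail_def)

lemma tail_mono: "n \<le> m \<Longrightarrow> tail n x \<subseteq> tail m x"
  by (auto simp: tail_def)

lemma tail_rel_iff: "(x, y) \<in> tail_rel n \<longleftrightarrow> x \<in> X \<and> y \<in> tail n x"
  by (auto simp: tail_rel_def tail_def)

lemma tail_rel_mono: "n \<le> m \<Longrightarrow> tail_rel n \<subseteq> tail_rel m"
  by (auto simp: tail_rel_def)

lemma wds_in: "w \<in> wds n \<Longrightarrow> w \<in> X"
  by (simp add: wds_def tail_def)

lemma glue_in_tail: "w \<in> X \<Longrightarrow> x \<in> X \<Longrightarrow> glue n w x \<in> tail n x"
  by (auto simp: tail_def glue_in) (auto simp: glue_def)

lemma glue_tail_rel: "w \<in> X \<Longrightarrow> x \<in> X \<Longrightarrow> (x, glue n w x) \<in> tail_rel n"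
  by (simp add: tail_rel_iff glue_in_tail)

lemma glue_wds_bij:
  assumes x: "x \<in> X"
  shows "bij_betw (\<lambda>w. glue n w x) (wds n) (tail n x)"
proof (rule bij_betw_byWitness[where f' = "\<lambda>y. glue n y (\<lambda>_. 1)"])
  \<comment> \<open>A point of \<open>X\<close> forces a nonempty alphabet, so the padding letter is
    admissible.\<close>
  have k: "1 \<le> k" using x by (fastforce simp: shift_space_def dest: spec[of _ 0])
  show "\<forall>w\<in>wds n. glue n (glue n w x) (\<lambda>_. 1) = w"
    by (auto simp: wds_def tail_def glue_def)
  show "\<forall>y\<in>tail n x. glue n (glue n y (\<lambda>_. 1)) x = y"
    by (auto simp: tail_def glue_def)
  show "(\<lambda>w. glue n w x) ` wds n \<subseteq> tail n x"
    using x by (auto intro!: glue_in_tail wds_in)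
  show "(\<lambda>y. glue n y (\<lambda>_. 1)) ` tail n x \<subseteq> wds n"
    using k by (auto simp: wds_def tail_def glue_def shift_space_def)
qed

lemma finite_wds: "finite (wds n)"
proof -
  have "inj_on (\<lambda>w. restrict w {..<n}) (wds n)"
  proof (rule inj_onI)
    fix v w assume v: "v \<in> wds n" and w: "w \<in> wds n"
      and eq: "restrict v {..<n} = restrict w {..<n}"
    show "v = w"
    proof
      fix i show "v i = w i"
      proof (cases "i < n")
        case True
        then show ?thesis using fun_cong[OF eq, of i] by simp
      next
        case False
        then show ?thesis using v w by (auto simp: wds_def tail_def)
      qed
    qed
  qed
  moreover have "(\<lambda>w. restrict w {..<n}) ` wds n \<subseteq> PiE {..<n} (\<lambda>_. {1..k})"
    by (rule image_subsetI) (auto simp: wds_def tail_def shift_space_def intro!: restrict_PiE_iff[THEN iffD2])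
  moreover have "finite (PiE {..<n} (\<lambda>_. {1..k}))" by (intro finite_PiE) auto
  ultimately show ?thesis by (metis finite_imageD finite_subset)
qed

lemma finite_tail: "finite (tail n x)"
proof (cases "tail n x = {}")
  case False
  then obtain y where y: "y \<in> tail n x" by auto
  then have "finite (tail n y)"
    using glue_wds_bij[OF tail_in[OF y]] finite_wds bij_betw_finite by blast
  then show ?thesis using tail_eq[OF y] by simp
qed simp

lemma sum_tail:
  "x \<in> X \<Longrightarrow> (\<Sum>y\<in>tail n x. f y) = (\<Sum>w\<in>wds n. f (glue n w x))"
  using sum.reindex_bij_betw[OF glue_wds_bij, of x f n] by simp

text \<open>Classes of level n partition a class of level m, so both sides sum over the pairs inside
  the larger class that are n-related. This is Fubini for the tail relation and the source of every
  exchange of kernel variables below.\<close>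

lemma sum_tail_swap:
  assumes "n \<le> m"
  shows "(\<Sum>y\<in>tail m x. \<Sum>z\<in>tail n y. F y z) = (\<Sum>z\<in>tail m x. \<Sum>y\<in>tail n z. F y z)"
proof -
  have "(\<Sum>y\<in>tail m x. \<Sum>z\<in>tail n y. F y z)
     = (\<Sum>y\<in>tail m x. \<Sum>z | z \<in> tail m x \<and> z \<in> tail n y. F y z)"
    using assms by (intro sum.cong refl) (auto simp: tail_def)
  also have "\<dots> = (\<Sum>z\<in>tail m x. \<Sum>y | y \<in> tail m x \<and> z \<in> tail n y. F y z)"
    by (rule sum.swap_restrict) (auto simp: finite_tail)
  also have "\<dots> = (\<Sum>z\<in>tail m x. \<Sum>y\<in>tail n z. F y z)"
    using assms by (intro sum.cong refl) (auto simp: tail_def)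
  finally show ?thesis .
qed

lemma shift_fiber: "{z \<in> X. (shiftT ^^ n) z = (shiftT ^^ n) x} = tail n x"
proof -
  have "(shiftT ^^ n) z = (shiftT ^^ n) x \<longleftrightarrow> (\<forall>i\<ge>n. z i = x i)" for z
    unfolding shiftT_iterate fun_eq_iff by (metis add.commute le_add1 le_Suc_ex)
  then show ?thesis by (auto simp: tail_def)
qed

lemma finite_fiber: "finite {z \<in> X. (shiftT ^^ n) z = x}"
proof (cases "\<exists>z\<in>X. (shiftT ^^ n) z = x")
  case True
  then obtain z where "(shiftT ^^ n) z = x" by blast
  then show ?thesis using shift_fiber[of n z] finite_tail by metis
next
  case False
  then have "{z \<in> X. (shiftT ^^ n) z = x} = {}" by auto
  then show ?thesis by (metis finite.emptyI)
qed

text \<open>Stated over a commutative semiring because it serves twice: for \<open>Lp\<close> with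
  complex values and for \<open>ruelle\<close> with real ones.\<close>

lemma iterate_transfer:
  fixes q :: "pt \<Rightarrow> 'a::comm_semiring_1"
  assumes L: "\<And>\<eta> x. L \<eta> x = (\<Sum>z\<in>preim k x. q z * \<eta> z)" and x: "x \<in> X"
  shows "(L ^^ n) \<eta> x = (\<Sum>z | z \<in> X \<and> (shiftT ^^ n) z = x. (\<Prod>j<n. q ((shiftT ^^ j) z)) * \<eta> z)"
  using x
proof (induction n arbitrary: x)
  case 0
  then have "{z. z \<in> X \<and> z = x} = {x}" by auto
  then show ?case by simp
next
  case (Suc n)
  let ?S = "{y \<in> X. (shiftT ^^ Suc n) y = x}"
  let ?h = "\<lambda>y. (\<Prod>j<Suc n. q ((shiftT ^^ j) y)) * \<eta> y"
  have fp: "finite (preim k x)" using finite_fiber[of 1 x] by (simp add: preim_def)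
  have "(L ^^ Suc n) \<eta> x = (\<Sum>z\<in>preim k x. q z * (L ^^ n) \<eta> z)"
    by (simp add: L)
  also have "\<dots> = (\<Sum>z\<in>preim k x. \<Sum>y | y \<in> ?S \<and> (shiftT ^^ n) y = z. ?h y)"
  proof (rule sum.cong[OF refl])
    fix z assume z: "z \<in> preim k x"
    then have zX: "z \<in> X" and zx: "shiftT z = x" by (auto simp: preim_def)
    have S: "{y. y \<in> ?S \<and> (shiftT ^^ n) y = z} = {y. y \<in> X \<and> (shiftT ^^ n) y = z}"
      using zx by auto
    show "q z * (L ^^ n) \<eta> z = (\<Sum>y | y \<in> ?S \<and> (shiftT ^^ n) y = z. ?h y)"
      unfolding S Suc.IH[OF zX] sum_distrib_left
      by (rule sum.cong) (auto simp: ac_simps)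
  qed
  also have "\<dots> = (\<Sum>y\<in>?S. ?h y)"
  proof (rule sum.group[OF finite_fiber fp])
    show "(shiftT ^^ n) ` ?S \<subseteq> preim k x" using shift_in by (auto simp: preim_def)
  qed
  finally show ?case by simp
qed

section \<open>Compactness and the prefix description of the topology\<close>

lemma compact_X: "compact X"
proof -
  have "compactin (product_topology (\<lambda>i::nat. euclidean::nat topology) UNIV) (PiE UNIV (\<lambda>_. {1..k}))"
    by (subst compactin_PiE) (auto simp: finite_imp_compact)
  moreover have "PiE UNIV (\<lambda>_. {1..k}) = X"
    by (auto simp: shift_space_def PiE_def extensional_def)
  ultimately show ?thesis by (simp add: euclidean_product_topology)
qed

lemma X_borel: "X \<in> sets borel"
proof -
  have "X = (\<Inter>i. (\<lambda>x::pt. x i) -` {1..k})" by (auto simp: shift_space_def)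
  moreover have "closed ((\<lambda>x::pt. x i) -` {1..k})" for i
    by (intro closed_vimage continuous_on_product_coordinates) (auto simp: closed_def intro: discrete_topology_class.open_discrete)
  ultimately have "closed X" by (metis closed_INT)
  then show ?thesis by (rule borel_closed)
qed

lemma open_agree: "open {y::pt. \<forall>i<m. y i = x i}"
proof -
  have "open {y::pt. \<forall>i\<in>{..<m}. y i \<in> {x i}}"
    by (rule product_topology_basis') (auto simp: discrete_topology_class.open_discrete)
  then show ?thesis by (simp add: Ball_def)
qed

lemma agree_subset_open:
  assumes "open U" "(x::pt) \<in> U"
  shows "\<exists>m. \<forall>y. (\<forall>i<m. y i = x i) \<longrightarrow> y \<in> U"
proof -
  have "openin (product_topology (\<lambda>i::nat. euclidean::nat topology) UNIV) U"
    using assms(1) by (simp add: euclidean_product_topology)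
  from product_topology_open_contains_basis[OF this assms(2)]
  obtain V where V: "x \<in> PiE UNIV V" "finite {i. V i \<noteq> UNIV}" "PiE UNIV V \<subseteq> U" by auto
  obtain m where m: "\<forall>i\<in>{i. V i \<noteq> UNIV}. i < m"
    using V(2) finite_nat_set_iff_bounded by blast
  have "y \<in> U" if a: "\<forall>i<m. y i = x i" for y
  proof -
    have "y i \<in> V i" for i
      using m a V(1) by (cases "V i = UNIV") (auto simp: PiE_def Pi_def)
    then show ?thesis using V(3) by (auto simp: PiE_def)
  qed
  then show ?thesis by blast
qed

text \<open>Cylinders given by finite prefixes are a neighbourhood base of the product topology, so
  continuity can be tested by agreement on a prefix; the next lemma is the converse.\<close>

lemma continuous_on_agreeI:
  fixes f :: "pt \<Rightarrow> 'a::metric_space"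
  assumes "\<And>x e. x \<in> S \<Longrightarrow> 0 < e \<Longrightarrow> \<exists>m. \<forall>y\<in>S. (\<forall>i<m. y i = x i) \<longrightarrow> dist (f y) (f x) < e"
  shows "continuous_on S f"
  unfolding continuous_on_topological
proof (intro ballI allI impI)
  fix x B assume x: "x \<in> S" "open B" "f x \<in> B"
  then obtain e where e: "0 < e" "\<And>z. dist z (f x) < e \<Longrightarrow> z \<in> B" by (metis open_dist)
  obtain m where m: "\<forall>y\<in>S. (\<forall>i<m. y i = x i) \<longrightarrow> dist (f y) (f x) < e"
    using assms[OF x(1) e(1)] by blast
  then show "\<exists>A. open A \<and> x \<in> A \<and> (\<forall>y\<in>S. y \<in> A \<longrightarrow> f y \<in> B)"
    using e(2) by (intro exI[of _ "{y. \<forall>i<m. y i = x i}"]) (auto simp: open_agree)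
qed

lemma continuous_on_agreeD:
  fixes f :: "pt \<Rightarrow> 'a::metric_space"
  assumes "continuous_on S f" "x \<in> S" "0 < e"
  shows "\<exists>m. \<forall>y\<in>S. (\<forall>i<m. y i = x i) \<longrightarrow> dist (f y) (f x) < e"
proof -
  obtain A where A: "open A" "x \<in> A" "\<forall>y\<in>S. y \<in> A \<longrightarrow> f y \<in> ball (f x) e"
    using assms unfolding continuous_on_topological by (metis centre_in_ball open_ball)
  then show ?thesis using agree_subset_open[OF A(1,2)] by (auto simp: dist_commute)
qed

text \<open>Lebesgue number argument: each centre gets a prefix length for accuracy
  \<open>e / 2\<close>, compactness leaves finitely many centres, and the longest of their prefixes
  works for all pairs.\<close>

lemma uniform_agree:
  fixes f :: "pt \<Rightarrow> 'a::metric_space"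
  assumes f: "continuous_on X f" and e: "0 < e"
  shows "\<exists>m. \<forall>x\<in>X. \<forall>y\<in>X. (\<forall>i<m. y i = x i) \<longrightarrow> dist (f x) (f y) < e"
proof -
  have "\<exists>M. \<forall>x\<in>X. \<forall>y\<in>X. (\<forall>i<M x. y i = x i) \<longrightarrow> dist (f y) (f x) < e / 2"
    using continuous_on_agreeD[OF f, of _ "e / 2"] e by (intro bchoice) auto
  then obtain M where M: "\<And>x y. x \<in> X \<Longrightarrow> y \<in> X \<Longrightarrow> (\<forall>i<M x. y i = x i) \<Longrightarrow> dist (f y) (f x) < e / 2"
    by blast
  obtain D where D: "D \<subseteq> X" "finite D" "X \<subseteq> (\<Union>x\<in>D. {y. \<forall>i<M x. y i = x i})"
    by (rule compactE_image[OF compact_X, of X "\<lambda>x. {y. \<forall>i<M x. y i = x i}"]) (auto simp: open_agree)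
  have "dist (f x) (f y) < e" if x: "x \<in> X" and y: "y \<in> X" and a: "\<forall>i<Max (insert 0 (M ` D)). y i = x i" for x y
  proof -
    obtain z where z: "z \<in> D" "\<forall>i<M z. x i = z i" using D(3) x by blast
    have "M z \<le> Max (insert 0 (M ` D))" using z(1) D(2) by (intro Max_ge) auto
    then have "\<forall>i<M z. y i = z i" using a z(2) by simp
    then have "dist (f y) (f z) < e / 2" "dist (f x) (f z) < e / 2"
      using M[of z] z D(1) x y by blast+
    then show ?thesis by (metis dist_commute dist_triangle_half_l)
  qed
  then show ?thesis by blast
qed

lemma continuous_on_glue [continuous_intros]:
  assumes "continuous_on S f" "continuous_on S g"
  shows "continuous_on S (\<lambda>x. glue n (f x) (g x))"
  unfolding glue_def
proof (rule continuous_on_coordinatewise_then_product)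
  fix i show "continuous_on S (\<lambda>x. if i < n then f x i else g x i)"
    using assms by (cases "i < n") (auto intro: continuous_on_product_then_coordinatewise)
qed

lemma continuous_on_shift [continuous_intros]:
  assumes "continuous_on S f"
  shows "continuous_on S (\<lambda>x. (shiftT ^^ j) (f x))"
  unfolding shiftT_iterate
  by (rule continuous_on_coordinatewise_then_product)
     (auto intro: continuous_on_product_then_coordinatewise assms)

section \<open>Holder functions and uniform bounds on the shift space\<close>

lemma shift_dist_le:
  assumes "\<forall>i<m. x i = y i" shows "shift_dist x y \<le> (1/2) ^ m"
proof (cases "x = y")
  case False
  then have "\<exists>i. x i \<noteq> y i" by auto
  then have "m \<le> (LEAST i. x i \<noteq> y i)"
    using assms by (metis (mono_tags, lifting) LeastI_ex not_less)
  then show ?thesis using False by (simp add: shift_dist_def power_decreasing)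
qed (simp add: shift_dist_def)

lemma shift_dist_nonneg: "0 \<le> shift_dist x y"
  by (simp add: shift_dist_def)

text \<open>The Holder condition becomes exponential decay in the length of the common prefix, with
  rate \<open>(1/2) powr a\<close>. The constant is replaced by its absolute value because
  \<open>holder\<close> does not fix its sign.\<close>

lemma holder_bound:
  assumes "holder k f"
  obtains C r where "0 \<le> C" "0 < r" "r < 1"
    "\<And>x y m. x \<in> X \<Longrightarrow> y \<in> X \<Longrightarrow> (\<forall>i<m. x i = y i) \<Longrightarrow> \<bar>f x - f y\<bar> \<le> C * r ^ m"
proof -
  obtain C a where a: "0 < a" and C: "\<forall>x\<in>X. \<forall>y\<in>X. \<bar>f x - f y\<bar> \<le> C * shift_dist x y powr a"
    using assms unfolding holder_def by blast
  show thesis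
  proof (rule that[of "\<bar>C\<bar>" "(1/2) powr a"])
    show "(1/2::real) powr a < 1" using a powr_less_mono2[of a "1/2" 1] by simp
    fix x y :: pt and m assume *: "x \<in> X" "y \<in> X" "\<forall>i<m. x i = y i"
    have "\<bar>f x - f y\<bar> \<le> C * shift_dist x y powr a" using C * by blast
    also have "\<dots> \<le> \<bar>C\<bar> * shift_dist x y powr a" by (intro mult_right_mono) auto
    also have "\<dots> \<le> \<bar>C\<bar> * ((1/2) ^ m) powr a"
      using shift_dist_le[OF *(3)] shift_dist_nonneg a by (intro mult_left_mono powr_mono2) auto
    also have "((1/2::real) ^ m) powr a = ((1/2) powr a) ^ m"
      by (simp add: powr_realpow[symmetric] powr_powr mult.commute)
    finally show "\<bar>f x - f y\<bar> \<le> \<bar>C\<bar> * ((1/2) powr a) ^ m" .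
  qed auto
qed

lemma holder_continuous:
  assumes "holder k f" shows "continuous_on X f"
proof (rule continuous_on_agreeI)
  fix x e assume x: "x \<in> X" and e: "0 < (e::real)"
  obtain C r where C: "0 \<le> C" "0 < r" "r < 1"
    "\<And>x y m. x \<in> X \<Longrightarrow> y \<in> X \<Longrightarrow> (\<forall>i<m. x i = y i) \<Longrightarrow> \<bar>f x - f y\<bar> \<le> C * r ^ m"
    using holder_bound[OF assms] by blast
  have "(\<lambda>m. C * r ^ m) \<longlonglongrightarrow> C * 0" using C by (intro tendsto_intros LIMSEQ_realpow_zero) auto
  then have "\<forall>\<^sub>F m in sequentially. C * r ^ m < e" using e by (simp add: order_tendstoD(2))
  then obtain m where m: "C * r ^ m < e" by (auto simp: eventually_sequentially)
  then show "\<exists>m. \<forall>y\<in>X. (\<forall>i<m. y i = x i) \<longrightarrow> dist (f y) (f x) < e"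
    using C(4)[OF _ x, of _ m] by (intro exI[of _ m]) (auto simp: dist_real_def intro: le_less_trans)
qed

lemma bounded_X:
  fixes f :: "pt \<Rightarrow> 'a::real_normed_vector"
  assumes "continuous_on X f"
  obtains B where "0 < B" "\<And>x. x \<in> X \<Longrightarrow> norm (f x) \<le> B"
  using compact_imp_bounded[OF compact_continuous_image[OF assms compact_X]]
  by (auto simp: bounded_pos)

lemma positive_X:
  fixes f :: "pt \<Rightarrow> real"
  assumes "continuous_on X f" "\<forall>x\<in>X. 0 < f x"
  obtains d where "0 < d" "\<And>x. x \<in> X \<Longrightarrow> d \<le> f x"
proof (cases "X = {}")
  case True
  then show thesis using that[of 1] by auto
next
  case False
  then obtain x where "x \<in> X" "\<forall>y\<in>X. f x \<le> f y"
    using continuous_attains_inf[OF compact_X _ assms(1)] by blast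
  then show thesis using that[of "f x"] assms(2) by blast
qed

end

section \<open>Averages over tail classes\<close>

context full_shift
begin

definition birkhoff :: "(pt \<Rightarrow> real) \<Rightarrow> nat \<Rightarrow> pt \<Rightarrow> real" where
  "birkhoff A n x = (\<Sum>j<n. A ((shiftT ^^ j) x))"

definition partition_fn :: "(pt \<Rightarrow> real) \<Rightarrow> nat \<Rightarrow> pt \<Rightarrow> real" where
  "partition_fn A n x = (\<Sum>y\<in>tail n x. exp (birkhoff A n y))"

text \<open>The conditional expectation, given all coordinates from n on, of a Gibbs measure with
  potential \<open>A\<close>; the result is constant on tail classes.\<close>

definition tail_avg :: "(pt \<Rightarrow> real) \<Rightarrow> nat \<Rightarrow> (pt \<Rightarrow> real) \<Rightarrow> pt \<Rightarrow> real" where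
  "tail_avg A n G x = (\<Sum>y\<in>tail n x. exp (birkhoff A n y) * G y) / partition_fn A n x"

lemma shiftT_tail: "y \<in> tail n x \<Longrightarrow> n \<le> j \<Longrightarrow> (shiftT ^^ j) y = (shiftT ^^ j) x"
  by (auto simp: tail_def shiftT_iterate)

text \<open>The orbits of related points coincide from time n on, so later terms cancel. Differences
  of Birkhoff sums are thus one cocycle on the union of all tail relations.\<close>

lemma birkhoff_diff_tail:
  assumes "y \<in> tail n x" "n \<le> m"
  shows "birkhoff A m y - birkhoff A m x = birkhoff A n y - birkhoff A n x"
proof -
  have "birkhoff A m z = birkhoff A n z + (\<Sum>j\<in>{n..<m}. A ((shiftT ^^ j) z))" for z
    unfolding birkhoff_def using sum.atLeastLessThan_concat[of 0 n m "\<lambda>j. A ((shiftT ^^ j) z)"] assms(2)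
    by (simp add: atLeast0LessThan)
  moreover have "(\<Sum>j\<in>{n..<m}. A ((shiftT ^^ j) y)) = (\<Sum>j\<in>{n..<m}. A ((shiftT ^^ j) x))"
    using shiftT_tail[OF assms(1)] by (intro sum.cong) auto
  ultimately show ?thesis by simp
qed

lemma continuous_birkhoff:
  assumes "continuous_on X A" shows "continuous_on X (birkhoff A n)"
proof -
  have "continuous_on X (\<lambda>x. A ((shiftT ^^ j) x))" for j
    by (rule continuous_on_compose2[OF assms]) (auto intro: shift_in continuous_on_shift)
  then show ?thesis unfolding birkhoff_def by (intro continuous_on_sum)
qed

lemma partition_fn_pos: "x \<in> X \<Longrightarrow> 0 < partition_fn A n x"
  unfolding partition_fn_def using tail_refl by (intro sum_pos finite_tail) auto

lemma partition_fn_tail: "y \<in> tail n x \<Longrightarrow> partition_fn A n y = partition_fn A n x"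
  by (simp add: partition_fn_def tail_eq)

lemma continuous_tail_sum:
  fixes f :: "pt \<Rightarrow> 'a::real_normed_vector"
  assumes "continuous_on X f"
  shows "continuous_on X (\<lambda>x. \<Sum>y\<in>tail n x. f y)"
proof -
  have "continuous_on X (\<lambda>x. \<Sum>w\<in>wds n. f (glue n w x))"
    by (intro continuous_intros continuous_on_compose2[OF assms]) (auto intro: glue_in wds_in)
  then show ?thesis by (rule continuous_on_eq) (simp add: sum_tail)
qed

lemma continuous_partition_fn: "continuous_on X A \<Longrightarrow> continuous_on X (partition_fn A n)"
  unfolding partition_fn_def by (intro continuous_tail_sum continuous_intros continuous_birkhoff)

lemma continuous_tail_avg:
  "continuous_on X A \<Longrightarrow> continuous_on X G \<Longrightarrow> continuous_on X (tail_avg A n G)"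
  unfolding tail_avg_def
  by (intro continuous_intros continuous_tail_sum continuous_birkhoff continuous_partition_fn)
     (auto dest: partition_fn_pos[of _ A n])

text \<open>The tower property of conditional expectations, here an exchange of finite sums.\<close>

lemma tail_avg_tower:
  assumes nm: "n \<le> m" and x: "x \<in> X"
  shows "tail_avg A m (tail_avg A n G) x = tail_avg A m G x"
proof -
  let ?e = "\<lambda>n y. exp (birkhoff A n y)"
  have "(\<Sum>y\<in>tail m x. ?e m y * tail_avg A n G y)
     = (\<Sum>y\<in>tail m x. \<Sum>z\<in>tail n y. ?e m y * ?e n z * G z / partition_fn A n z)"
    unfolding tail_avg_def
    by (auto simp: sum_distrib_left sum_divide_distrib partition_fn_tail ac_simps intro!: sum.cong)
  also have "\<dots> = (\<Sum>z\<in>tail m x. \<Sum>y\<in>tail n z. ?e m y * ?e n z * G z / partition_fn A n z)"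
    by (rule sum_tail_swap[OF nm])
  also have "\<dots> = (\<Sum>z\<in>tail m x. ?e m z * G z)"
  proof (rule sum.cong[OF refl])
    fix z assume z: "z \<in> tail m x"
    \<comment> \<open>The cocycle identity moves the level m weight from y to z; the level n weight
      left in y sums to the partition function and cancels it.\<close>
    have "?e m y * ?e n z = ?e m z * ?e n y" if "y \<in> tail n z" for y
      using birkhoff_diff_tail[OF that nm, of A] by (simp add: exp_add[symmetric])
    then have "(\<Sum>y\<in>tail n z. ?e m y * ?e n z * G z / partition_fn A n z)
      = (\<Sum>y\<in>tail n z. ?e n y * (?e m z * G z / partition_fn A n z))"
      by (intro sum.cong) auto
    also have "\<dots> = partition_fn A n z * (?e m z * G z / partition_fn A n z)"
      unfolding sum_distrib_right[symmetric] by (simp add: partition_fn_def)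
    also have "\<dots> = ?e m z * G z"
      using partition_fn_pos[OF tail_in[OF z], of A n] by simp
    finally show "(\<Sum>y\<in>tail n z. ?e m y * ?e n z * G z / partition_fn A n z) = ?e m z * G z" .
  qed
  finally show ?thesis by (simp add: tail_avg_def)
qed

text \<open>After j shifts a common prefix of length m still has length \<open>m - j\<close>, so the
  differences are dominated by a geometric series whatever m is. This uniformity makes the
  contraction rate of the averages independent of the level.\<close>

lemma bounded_distortion:
  assumes C: "0 \<le> C" "0 < r" "r < 1"
    "\<And>x y m. x \<in> X \<Longrightarrow> y \<in> X \<Longrightarrow> (\<forall>i<m. x i = y i) \<Longrightarrow> \<bar>A x - A y\<bar> \<le> C * r ^ m"
    and x: "x \<in> X" and y: "y \<in> X" and a: "\<forall>i<m. x i = y i"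
  shows "\<bar>birkhoff A m x - birkhoff A m y\<bar> \<le> C / (1 - r)"
proof -
  have "\<bar>birkhoff A m x - birkhoff A m y\<bar> = \<bar>\<Sum>j<m. A ((shiftT ^^ j) x) - A ((shiftT ^^ j) y)\<bar>"
    by (simp add: birkhoff_def sum_subtractf)
  also have "\<dots> \<le> (\<Sum>j<m. \<bar>A ((shiftT ^^ j) x) - A ((shiftT ^^ j) y)\<bar>)" by (rule sum_abs)
  also have "\<dots> \<le> (\<Sum>j<m. C * r ^ (m - j))"
    using a by (intro sum_mono C(4) shift_in x y) (auto simp: shiftT_iterate)
  \<comment> \<open>Lowering the exponent by one enlarges the terms and makes the reversed sum start
    at \<open>r ^ 0\<close>.\<close>
  also have "\<dots> \<le> (\<Sum>j<m. C * r ^ (m - Suc j))"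
    using C by (intro sum_mono mult_left_mono power_decreasing) auto
  also have "\<dots> = C * (\<Sum>j<m. r ^ j)"
    unfolding sum_distrib_left by (rule sum.nat_diff_reindex)
  also have "\<dots> \<le> C * (1 / (1 - r))"
  proof (intro mult_left_mono C(1))
    have "(\<Sum>j<m. r ^ j) \<le> (\<Sum>j. r ^ j)"
      using C by (intro sum_le_suminf summable_geometric) auto
    then show "(\<Sum>j<m. r ^ j) \<le> 1 / (1 - r)" using C by (simp add: suminf_geometric)
  qed
  finally show ?thesis by simp
qed

text \<open>One Doeblin step: by bounded distortion the normalised weights at two points dominate each
  other up to a constant independent of \<open>m\<close>.\<close>
lemma tail_avg_contract:
  assumes D: "\<And>x y m. x \<in> X \<Longrightarrow> y \<in> X \<Longrightarrow> (\<forall>i<m. x i = y i) \<Longrightarrow>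
      \<bar>birkhoff A m x - birkhoff A m y\<bar> \<le> D"
    and g: "\<And>x y. x \<in> X \<Longrightarrow> y \<in> X \<Longrightarrow> g x - g y \<le> b"
    and m: "\<And>x y. x \<in> X \<Longrightarrow> y \<in> X \<Longrightarrow> (\<forall>i<m. x i = y i) \<Longrightarrow> g x - g y \<le> e"
    and x: "x \<in> X" and x': "x' \<in> X"
  shows "tail_avg A m g x - tail_avg A m g x' \<le> (1 - exp (- 2 * D)) * b + e"
proof -
  define E where "E x w = exp (birkhoff A m (glue m w x))" for x w
  define q where "q x w = E x w / partition_fn A m x" for x w
  have Z: "partition_fn A m x = (\<Sum>w\<in>wds m. E x w)" if "x \<in> X" for x
    using that by (simp add: partition_fn_def sum_tail E_def)
  have q1: "(\<Sum>w\<in>wds m. q x w) = 1" if "x \<in> X" for x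
    using partition_fn_pos[OF that, of A m] by (simp add: q_def sum_divide_distrib[symmetric] Z[OF that])
  have avg: "tail_avg A m g x = (\<Sum>w\<in>wds m. q x w * g (glue m w x))" if "x \<in> X" for x
    using that by (simp add: tail_avg_def sum_tail q_def E_def sum_divide_distrib)
  have agree: "\<forall>i<m. glue m w x i = glue m w x' i" for w x x'
    by (simp add: glue_def)
  have Ele: "E x w \<le> exp D * E x' w" if "w \<in> wds m" "x \<in> X" "x' \<in> X" for x x' w
  proof -
    have "birkhoff A m (glue m w x) \<le> D + birkhoff A m (glue m w x')"
      using D[of "glue m w x" "glue m w x'" m] that agree glue_in[OF wds_in] by (auto simp: abs_le_iff)
    then show ?thesis unfolding E_def by (simp add: exp_add[symmetric])
  qed
  have Zle: "partition_fn A m x \<le> exp D * partition_fn A m x'" if "x \<in> X" "x' \<in> X" for x x'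
    using that unfolding Z[OF that(1)] Z[OF that(2)] sum_distrib_left by (intro sum_mono Ele)
  \<comment> \<open>One factor \<open>exp D\<close> is lost in comparing the weights of a word over
    two tails, a second one in comparing the partition functions.\<close>
  define d where "d = exp (- 2 * D)"
  have qle: "d * q x w \<le> q x' w" if w: "w \<in> wds m" for w
  proof -
    have E0: "0 < E x w" by (simp add: E_def)
    have "d * q x w = (exp (-D) * E x w) * (exp (-D) / partition_fn A m x)"
      by (simp add: q_def d_def exp_add[symmetric])
    also have "\<dots> \<le> E x' w * (1 / partition_fn A m x')"
    proof (rule mult_mono)
      show "exp (-D) * E x w \<le> E x' w"
        using Ele[OF w x x'] by (simp add: exp_minus field_simps)
      show "exp (-D) / partition_fn A m x \<le> 1 / partition_fn A m x'"
        using Zle[OF x' x] partition_fn_pos[OF x, of A m] partition_fn_pos[OF x', of A m]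
        by (simp add: exp_minus field_simps)
    qed (use partition_fn_pos[OF x, of A m] in \<open>auto simp: E_def\<close>)
    finally show ?thesis by (simp add: q_def)
  qed
  have q0: "0 \<le> q x w" if "x \<in> X" for x w
    using partition_fn_pos[OF that, of A m] by (simp add: q_def E_def)
  \<comment> \<open>Both weight vectors sum to 1, so subtracting a constant from g is free.
    Subtracting its minimum over the fibre makes the remaining factor nonnegative, which allows
    \<open>q x w - q x' w\<close> to be replaced by its upper bound
    \<open>(1 - d) * q x w\<close>.\<close>
  obtain x0 where x0: "x0 \<in> X" "\<And>y. y \<in> g ` (\<lambda>w. glue m w x') ` wds m \<Longrightarrow> g x0 \<le> y"
  proof -
    let ?S = "g ` (\<lambda>w. glue m w x') ` wds m"
    have ne: "?S \<noteq> {}"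
      using glue_wds_bij[OF x', of m] tail_refl[OF x', of m] by (auto simp: bij_betw_def)
    have fin: "finite ?S" by (intro finite_imageI finite_wds)
    from Min_in[OF fin ne] obtain w where "w \<in> wds m" "Min ?S = g (glue m w x')" by auto
    then show thesis using that[of "glue m w x'"] fin Min_le[OF fin] glue_in[OF wds_in x'] by metis
  qed
  let ?u = "\<lambda>w. g (glue m w x') - g x0"
  have u0: "0 \<le> ?u w" if "w \<in> wds m" for w using x0(2) that by auto
  have ub: "?u w \<le> b" if "w \<in> wds m" for w using g x0(1) glue_in wds_in that x' by blast
  \<comment> \<open>The same word over two tails costs at most e; the change of the weights is the
    part that contracts.\<close>
  have "tail_avg A m g x - tail_avg A m g x'
    = (\<Sum>w\<in>wds m. q x w * (g (glue m w x) - g (glue m w x'))) + (\<Sum>w\<in>wds m. (q x w - q x' w) * g (glue m w x'))"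
    unfolding avg[OF x] avg[OF x']
    by (simp add: sum.distrib[symmetric] sum_subtractf[symmetric] algebra_simps)
  also have "(\<Sum>w\<in>wds m. q x w * (g (glue m w x) - g (glue m w x'))) \<le> (\<Sum>w\<in>wds m. q x w * e)"
    using x x' by (intro sum_mono mult_left_mono q0 m agree) (auto intro: glue_in wds_in)
  also have "\<dots> = e" by (simp add: sum_distrib_right[symmetric] q1[OF x])
  also have "(\<Sum>w\<in>wds m. (q x w - q x' w) * g (glue m w x')) = (\<Sum>w\<in>wds m. (q x w - q x' w) * ?u w)"
    by (simp add: algebra_simps sum_subtractf sum.distrib sum_distrib_left[symmetric] q1[OF x] q1[OF x'])
  also have "\<dots> \<le> (\<Sum>w\<in>wds m. (1 - d) * q x w * b)"
  proof (rule sum_mono)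
    fix w assume w: "w \<in> wds m"
    have "(q x w - q x' w) * ?u w \<le> (1 - d) * q x w * ?u w"
      using qle[OF w] u0[OF w] by (intro mult_right_mono) (auto simp: algebra_simps)
    also have "\<dots> \<le> (1 - d) * q x w * b"
    proof (intro mult_left_mono ub w mult_nonneg_nonneg q0 x)
      have "0 \<le> D" using D[OF x x, of 0] by (simp add: birkhoff_def)
      then show "0 \<le> 1 - d" by (simp add: d_def)
    qed
    finally show "(q x w - q x' w) * ?u w \<le> (1 - d) * q x w * b" .
  qed
  also have "\<dots> = (1 - d) * b"
    by (simp add: sum_distrib_right[symmetric] sum_distrib_left[symmetric] q1[OF x])
  finally show ?thesis by (simp add: d_def)
qed

text \<open>A contraction step leaves an additive error from the modulus of continuity of the
  function averaged. Each new level is therefore chosen after the previous average, fine enough for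
  an error of \<open>d / 2 * e\<close>; while the oscillation exceeds e, this uses up half of the
  gain and leaves the factor \<open>1 - d / 2\<close>. The tower property turns the iterated
  averages into a single one.\<close>

lemma tail_avg_osc:
  assumes A: "continuous_on X A"
    and C: "0 \<le> C" "0 < r" "r < 1"
    "\<And>x y m. x \<in> X \<Longrightarrow> y \<in> X \<Longrightarrow> (\<forall>i<m. x i = y i) \<Longrightarrow> \<bar>A x - A y\<bar> \<le> C * r ^ m"
    and G: "continuous_on X G" and e: "0 < e"
  shows "\<exists>n. \<forall>x\<in>X. \<forall>y\<in>X. tail_avg A n G x - tail_avg A n G y \<le> e"
proof -
  define D where "D = C / (1 - r)"
  define d where "d = exp (- 2 * D)"
  have D: "\<bar>birkhoff A m x - birkhoff A m y\<bar> \<le> D"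
    if "x \<in> X" "y \<in> X" "\<forall>i<m. x i = y i" for x y m
    unfolding D_def by (rule bounded_distortion[OF C that])
  have "0 \<le> D" using C by (simp add: D_def)
  then have d: "0 < d" "d \<le> 1" by (auto simp: d_def)
  obtain B where B: "0 < B" "\<And>x. x \<in> X \<Longrightarrow> norm (G x) \<le> B" using bounded_X[OF G] by blast
  have step: "\<exists>n. \<forall>x\<in>X. \<forall>y\<in>X. tail_avg A n G x - tail_avg A n G y \<le> max e ((1 - d / 2) ^ j * (2 * B))" for j
  proof (induction j)
    case 0
    have "tail_avg A 0 G x = G x" if "x \<in> X" for x
    proof -
      have "tail 0 x = {x}" using that by (auto simp: tail_def)
      then show ?thesis by (simp add: tail_avg_def partition_fn_def birkhoff_def)
    qed
    moreover have "G x - G y \<le> 2 * B" if "x \<in> X" "y \<in> X" for x y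
      using B(2)[OF that(1)] B(2)[OF that(2)] by (simp add: abs_le_iff)
    ultimately show ?case by (intro exI[of _ 0]) (simp add: le_max_iff_disj)
  next
    case (Suc j)
    then obtain n where n: "\<And>x y. x \<in> X \<Longrightarrow> y \<in> X \<Longrightarrow>
        tail_avg A n G x - tail_avg A n G y \<le> max e ((1 - d / 2) ^ j * (2 * B))" (is "\<And>x y. _ \<Longrightarrow> _ \<Longrightarrow> _ \<le> ?b")
      by blast
    show ?case
    proof (cases "e < (1 - d / 2) ^ j * (2 * B)")
      case False
      then have "?b = e" by simp
      then show ?thesis using n by (intro exI[of _ n]) (auto simp: le_max_iff_disj)
    next
      case True
      then have b: "?b = (1 - d / 2) ^ j * (2 * B)" "e \<le> ?b" by auto
      obtain m0 where m0: "\<forall>x\<in>X. \<forall>y\<in>X. (\<forall>i<m0. y i = x i) \<longrightarrow> dist (tail_avg A n G x) (tail_avg A n G y) < d / 2 * e"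
        using uniform_agree[OF continuous_tail_avg[OF A G]] d(1) e by (metis half_gt_zero mult_pos_pos)
      define m where "m = max n m0"
      have osc: "tail_avg A n G x - tail_avg A n G y \<le> d / 2 * e"
        if "x \<in> X" "y \<in> X" "\<forall>i<m. x i = y i" for x y
      proof -
        have "\<forall>i<m0. y i = x i" using that(3) by (simp add: m_def)
        then have "dist (tail_avg A n G x) (tail_avg A n G y) < d / 2 * e"
          using bspec[OF bspec[OF m0 that(1)] that(2)] by blast
        then show ?thesis unfolding dist_real_def by linarith
      qed
      have "tail_avg A m G x - tail_avg A m G y \<le> (1 - d) * ?b + d / 2 * e" if "x \<in> X" "y \<in> X" for x y
      proof -
        have t: "tail_avg A m (tail_avg A n G) z = tail_avg A m G z" if "z \<in> X" for z
          by (rule tail_avg_tower[OF _ that]) (simp add: m_def)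
        have "tail_avg A m (tail_avg A n G) x - tail_avg A m (tail_avg A n G) y
            \<le> (1 - exp (- 2 * D)) * ?b + d / 2 * e"
        proof (rule tail_avg_contract)
          show "\<bar>birkhoff A m x - birkhoff A m y\<bar> \<le> D"
            if "x \<in> X" "y \<in> X" "\<forall>i<m. x i = y i" for x y m
            using that by (rule D)
        qed (fact n osc that)+
        then show ?thesis unfolding t[OF that(1)] t[OF that(2)] by (simp add: d_def)
      qed
      moreover have "(1 - d) * ?b + d / 2 * e \<le> (1 - d) * ?b + d / 2 * ?b"
        using b(2) d by (intro add_left_mono mult_left_mono) auto
      moreover have "(1 - d) * ?b + d / 2 * ?b = (1 - d / 2) ^ Suc j * (2 * B)"
        unfolding b(1) by (simp add: algebra_simps)
      ultimately show ?thesis by (intro exI[of _ m]) (fastforce simp: le_max_iff_disj)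
    qed
  qed
  have "(\<lambda>j. (1 - d / 2) ^ j * (2 * B)) \<longlonglongrightarrow> 0 * (2 * B)"
    using d by (intro tendsto_intros LIMSEQ_realpow_zero) auto
  then have "\<forall>\<^sub>F j in sequentially. (1 - d / 2) ^ j * (2 * B) < e" using e by (simp add: order_tendstoD(2))
  then obtain j where "(1 - d / 2) ^ j * (2 * B) < e" by (auto simp: eventually_sequentially)
  then have "max e ((1 - d / 2) ^ j * (2 * B)) = e" by simp
  then show ?thesis using step[of j] by metis
qed

end

section \<open>Square-integrable functions\<close>

lemma borel_measurable_cnj [measurable]:
  "f \<in> borel_measurable M \<Longrightarrow> (\<lambda>x. cnj (f x)) \<in> borel_measurable M"
  by (rule borel_measurable_continuous_on[OF continuous_on_cnj[OF continuous_on_id]])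

lemma L2_measurable: "\<eta> \<in> L2 M \<Longrightarrow> \<eta> \<in> borel_measurable M"
  by (simp add: L2_def)

lemma l2norm_nonneg [simp]: "0 \<le> l2norm M \<eta>"
  by (simp add: l2norm_def)

lemma l2norm_sq: "(l2norm M \<eta>)\<^sup>2 = (\<integral>x. (cmod (\<eta> x))\<^sup>2 \<partial>M)"
  by (simp add: l2norm_def)

lemma nn_l2norm:
  assumes "\<eta> \<in> L2 M"
  shows "(\<integral>\<^sup>+x. ennreal ((cmod (\<eta> x))\<^sup>2) \<partial>M) = ennreal ((l2norm M \<eta>)\<^sup>2)"
  using assms unfolding L2_def l2norm_sq by (intro nn_integral_eq_integral) auto

lemma L2I:
  assumes "\<eta> \<in> borel_measurable M" "0 \<le> c"
    and "(\<integral>\<^sup>+x. ennreal ((cmod (\<eta> x))\<^sup>2) \<partial>M) \<le> ennreal (c\<^sup>2)"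
  shows "\<eta> \<in> L2 M" "l2norm M \<eta> \<le> c"
proof -
  have int: "integrable M (\<lambda>x. (cmod (\<eta> x))\<^sup>2)"
    using assms by (intro integrableI_bounded) (auto intro: le_less_trans)
  then show L: "\<eta> \<in> L2 M" using assms by (simp add: L2_def)
  have "(l2norm M \<eta>)\<^sup>2 \<le> c\<^sup>2" using nn_l2norm[OF L] assms(3) by simp
  then show "l2norm M \<eta> \<le> c" using assms(2) by (rule power2_le_imp_le)
qed

lemma l2norm_cong_AE:
  assumes "\<eta> \<in> L2 M" "\<zeta> \<in> L2 M" "AE x in M. \<eta> x = \<zeta> x"
  shows "l2norm M \<eta> = l2norm M \<zeta>"
proof -
  have "(\<integral>x. (cmod (\<eta> x))\<^sup>2 \<partial>M) = (\<integral>x. (cmod (\<zeta> x))\<^sup>2 \<partial>M)"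
    using assms by (intro integral_cong_AE) (auto simp: L2_def)
  then show ?thesis by (simp add: l2norm_def)
qed

lemma l2norm_zero_AE:
  assumes "\<eta> \<in> L2 M" "l2norm M \<eta> = 0"
  shows "AE x in M. \<eta> x = 0"
proof -
  have "(\<integral>\<^sup>+x. ennreal ((cmod (\<eta> x))\<^sup>2) \<partial>M) = 0" using nn_l2norm[OF assms(1)] assms(2) by simp
  then show ?thesis using L2_measurable[OF assms(1)] by (subst (asm) nn_integral_0_iff_AE) auto
qed

lemma L2_scale: "\<eta> \<in> L2 M \<Longrightarrow> (\<lambda>x. c * \<eta> x) \<in> L2 M"
  by (auto simp: L2_def norm_mult power_mult_distrib)

lemma l2norm_scale: "l2norm M (\<lambda>x. c * \<eta> x) = cmod c * l2norm M \<eta>"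
  by (simp add: l2norm_def norm_mult power_mult_distrib real_sqrt_mult)

lemma L2_mult_integrable:
  assumes "\<eta> \<in> L2 M" "\<zeta> \<in> L2 M"
  shows "integrable M (\<lambda>x. \<eta> x * cnj (\<zeta> x))" "integrable M (\<lambda>x. cmod (\<eta> x) * cmod (\<zeta> x))"
proof -
  note [measurable] = L2_measurable[OF assms(1)] L2_measurable[OF assms(2)]
  have int: "integrable M (\<lambda>x. (cmod (\<eta> x))\<^sup>2 + (cmod (\<zeta> x))\<^sup>2)"
    using assms by (auto simp: L2_def)
  have le: "a * b \<le> a\<^sup>2 + b\<^sup>2" for a b :: real
    using sum_squares_bound[of a b] zero_le_power2[of a] zero_le_power2[of b]
    by (cases "0 \<le> a * b") linarith+
  show "integrable M (\<lambda>x. cmod (\<eta> x) * cmod (\<zeta> x))"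
    using le by (intro Bochner_Integration.integrable_bound[OF int]) (auto simp: abs_mult)
  then show "integrable M (\<lambda>x. \<eta> x * cnj (\<zeta> x))"
    by (rule Bochner_Integration.integrable_bound) (auto simp: norm_mult)
qed

lemma L2_cauchy_schwarz:
  assumes "\<eta> \<in> L2 M" "\<zeta> \<in> L2 M"
  shows "(\<integral>x. cmod (\<eta> x) * cmod (\<zeta> x) \<partial>M) \<le> l2norm M \<eta> * l2norm M \<zeta>"
proof -
  note [measurable] = L2_measurable[OF assms(1)] L2_measurable[OF assms(2)]
  let ?I = "\<integral>x. cmod (\<eta> x) * cmod (\<zeta> x) \<partial>M"
  have "(\<integral>\<^sup>+x. ennreal (cmod (\<eta> x) * cmod (\<zeta> x)) \<partial>M) = ennreal ?I"
    by (rule nn_integral_eq_integral[OF L2_mult_integrable(2)[OF assms]]) auto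
  moreover have "(\<integral>\<^sup>+x. ennreal (cmod (\<eta> x)) * ennreal (cmod (\<zeta> x)) \<partial>M)\<^sup>2
      \<le> (\<integral>\<^sup>+x. ennreal (cmod (\<eta> x)) ^ 2 \<partial>M) * (\<integral>\<^sup>+x. ennreal (cmod (\<zeta> x)) ^ 2 \<partial>M)"
    by (rule Cauchy_Schwarz_nn_integral) auto
  ultimately have "(ennreal ?I)\<^sup>2 \<le> ennreal ((l2norm M \<eta>)\<^sup>2) * ennreal ((l2norm M \<zeta>)\<^sup>2)"
    by (simp add: ennreal_power nn_l2norm[OF assms(1)] nn_l2norm[OF assms(2)] ennreal_mult'')
  moreover have "0 \<le> ?I" by (intro integral_nonneg_AE) auto
  ultimately have "?I\<^sup>2 \<le> (l2norm M \<eta> * l2norm M \<zeta>)\<^sup>2"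
    by (simp add: ennreal_power ennreal_mult''[symmetric] power_mult_distrib)
  then show ?thesis by (rule power2_le_imp_le) auto
qed

lemma l2inner_bound:
  assumes "\<eta> \<in> L2 M" "\<zeta> \<in> L2 M"
  shows "cmod (l2inner M \<eta> \<zeta>) \<le> l2norm M \<eta> * l2norm M \<zeta>"
proof -
  have "cmod (l2inner M \<eta> \<zeta>) \<le> (\<integral>x. cmod (\<eta> x * cnj (\<zeta> x)) \<partial>M)"
    unfolding l2inner_def by (rule integral_norm_bound)
  then show ?thesis using L2_cauchy_schwarz[OF assms] by (simp add: norm_mult)
qed

lemma L2_add:
  assumes "\<eta> \<in> L2 M" "\<zeta> \<in> L2 M"
  shows "(\<lambda>x. \<eta> x + \<zeta> x) \<in> L2 M" "l2norm M (\<lambda>x. \<eta> x + \<zeta> x) \<le> l2norm M \<eta> + l2norm M \<zeta>"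
proof -
  note [measurable] = L2_measurable[OF assms(1)] L2_measurable[OF assms(2)]
  have i: "integrable M (\<lambda>x. (cmod (\<eta> x))\<^sup>2)" "integrable M (\<lambda>x. (cmod (\<zeta> x))\<^sup>2)"
    using assms by (auto simp: L2_def)
  note i' = L2_mult_integrable(2)[OF assms]
  let ?f = "\<lambda>x. (cmod (\<eta> x))\<^sup>2 + 2 * (cmod (\<eta> x) * cmod (\<zeta> x)) + (cmod (\<zeta> x))\<^sup>2"
  have int: "integrable M ?f" using i i' by auto
  have le: "(cmod (\<eta> x + \<zeta> x))\<^sup>2 \<le> ?f x" for x
  proof -
    have "(cmod (\<eta> x + \<zeta> x))\<^sup>2 \<le> (cmod (\<eta> x) + cmod (\<zeta> x))\<^sup>2"
      by (intro power_mono norm_triangle_ineq) auto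
    then show ?thesis by (simp add: power2_sum algebra_simps)
  qed
  have int': "integrable M (\<lambda>x. (cmod (\<eta> x + \<zeta> x))\<^sup>2)"
  proof (rule Bochner_Integration.integrable_bound[OF int])
    show "AE x in M. norm ((cmod (\<eta> x + \<zeta> x))\<^sup>2) \<le> norm (?f x)"
    proof (rule AE_I2)
      fix x show "norm ((cmod (\<eta> x + \<zeta> x))\<^sup>2) \<le> norm (?f x)"
        using order_trans[OF le[of x] abs_ge_self] by simp
    qed
  qed simp
  then show "(\<lambda>x. \<eta> x + \<zeta> x) \<in> L2 M" by (simp add: L2_def)
  have "(l2norm M (\<lambda>x. \<eta> x + \<zeta> x))\<^sup>2 \<le> (\<integral>x. ?f x \<partial>M)"
    unfolding l2norm_sq by (rule integral_mono[OF int' int le])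
  also have "\<dots> = (l2norm M \<eta>)\<^sup>2 + 2 * (\<integral>x. cmod (\<eta> x) * cmod (\<zeta> x) \<partial>M) + (l2norm M \<zeta>)\<^sup>2"
    using i i' by (simp add: l2norm_sq)
  also have "\<dots> \<le> (l2norm M \<eta> + l2norm M \<zeta>)\<^sup>2"
    using L2_cauchy_schwarz[OF assms] by (simp add: power2_sum)
  finally show "l2norm M (\<lambda>x. \<eta> x + \<zeta> x) \<le> l2norm M \<eta> + l2norm M \<zeta>"
    by (rule power2_le_imp_le) simp
qed

lemma L2_diff:
  assumes "\<eta> \<in> L2 M" "\<zeta> \<in> L2 M"
  shows "(\<lambda>x. \<eta> x - \<zeta> x) \<in> L2 M" "l2norm M (\<lambda>x. \<eta> x - \<zeta> x) \<le> l2norm M \<eta> + l2norm M \<zeta>"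
  using L2_add[OF assms(1) L2_scale[OF assms(2), of "-1"]] l2norm_scale[of M "-1" \<zeta>] by auto

lemma l2norm_triangle_diff:
  assumes "a \<in> L2 M" "b \<in> L2 M" "c \<in> L2 M"
  shows "l2norm M (\<lambda>x. a x - c x) \<le> l2norm M (\<lambda>x. a x - b x) + l2norm M (\<lambda>x. b x - c x)"
  using L2_add(2)[OF L2_diff(1)[OF assms(1,2)] L2_diff(1)[OF assms(2,3)]] by simp

lemma l2inner_add_left:
  "a \<in> L2 M \<Longrightarrow> b \<in> L2 M \<Longrightarrow> c \<in> L2 M \<Longrightarrow>
    l2inner M (\<lambda>x. z * a x + b x) c = z * l2inner M a c + l2inner M b c"
  by (simp add: l2inner_def distrib_right mult.assoc L2_mult_integrable Bochner_Integration.integral_add)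

lemma l2inner_cnj: "l2inner M a b = cnj (l2inner M b a)"
proof -
  have "l2inner M a b = (\<integral>x. cnj (b x * cnj (a x)) \<partial>M)"
    by (simp add: l2inner_def mult.commute)
  also have "\<dots> = cnj (\<integral>x. b x * cnj (a x) \<partial>M)" by (rule Bochner_Integration.integral_cnj)
  finally show ?thesis by (simp add: l2inner_def)
qed

lemma l2inner_diff_left:
  "a \<in> L2 M \<Longrightarrow> b \<in> L2 M \<Longrightarrow> c \<in> L2 M \<Longrightarrow>
    l2inner M (\<lambda>x. a x - b x) c = l2inner M a c - l2inner M b c"
  using l2inner_add_left[of b M a c "-1"] by simp

lemma l2inner_diff_right:
  "a \<in> L2 M \<Longrightarrow> b \<in> L2 M \<Longrightarrow> c \<in> L2 M \<Longrightarrow>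
    l2inner M c (\<lambda>x. a x - b x) = l2inner M c a - l2inner M c b"
  by (simp add: l2inner_def right_diff_distrib L2_mult_integrable Bochner_Integration.integral_diff)

lemma l2inner_cong_AE:
  assumes "a \<in> L2 M" "a' \<in> L2 M" "b \<in> L2 M" "b' \<in> L2 M" "AE x in M. a x = a' x" "AE x in M. b x = b' x"
  shows "l2inner M a b = l2inner M a' b'"
proof -
  note [measurable] = assms(1-4)[THEN L2_measurable]
  have "AE x in M. a x * cnj (b x) = a' x * cnj (b' x)" using assms(5,6) by eventually_elim simp
  then show ?thesis unfolding l2inner_def by (intro integral_cong_AE) auto
qed

lemma l2inner_self: "l2inner M a a = of_real ((l2norm M a)\<^sup>2)"
  unfolding l2inner_def l2norm_sq by (simp add: complex_norm_square[symmetric] del: of_real_power)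

lemma L2_zero: "(\<lambda>_. 0) \<in> L2 M"
  by (simp add: L2_def)

text \<open>Riesz-Fischer with a rate: on a probability space the L2 norms of the increments bound
  their L1 norms, so the telescoping series converges almost everywhere, and Fatou carries the
  geometric tail estimate over to the pointwise limit.\<close>

lemma L2_complete:
  assumes M: "prob_space M" and f: "\<And>j. f j \<in> L2 M" and r: "0 \<le> r" "r < 1"
    and C: "0 \<le> C" "\<And>j. l2norm M (\<lambda>x. f (Suc j) x - f j x) \<le> C * r ^ j"
  shows "\<exists>g\<in>L2 M. \<forall>j. l2norm M (\<lambda>x. g x - f j x) \<le> C * r ^ j / (1 - r)"
proof -
  interpret prob_space M by fact
  note [measurable] = L2_measurable[OF f]
  have dL2: "(\<lambda>x. f (Suc j) x - f j x) \<in> L2 M" for j by (intro L2_diff f)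
  have one: "(\<lambda>_. 1) \<in> L2 M" by (simp add: L2_def)
  have one_norm: "l2norm M (\<lambda>_. 1) = 1" by (simp add: l2norm_def prob_space)
  have "AE x in M. summable (\<lambda>j. norm (f (Suc j) x - f j x))"
  proof -
    have L1: "(\<integral>\<^sup>+x. ennreal (cmod (f (Suc j) x - f j x)) \<partial>M) \<le> ennreal (C * r ^ j)" for j
    proof -
      have i: "integrable M (\<lambda>x. cmod (f (Suc j) x - f j x))"
        using L2_mult_integrable(2)[OF dL2[of j] one] by simp
      have "(\<integral>x. cmod (f (Suc j) x - f j x) \<partial>M) \<le> C * r ^ j"
        using L2_cauchy_schwarz[OF dL2[of j] one] one_norm C(2)[of j] by simp
      then show ?thesis using nn_integral_eq_integral[OF i] by (simp add: ennreal_leI)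
    qed
    have "(\<integral>\<^sup>+x. (\<Sum>j. ennreal (cmod (f (Suc j) x - f j x))) \<partial>M)
      = (\<Sum>j. \<integral>\<^sup>+x. ennreal (cmod (f (Suc j) x - f j x)) \<partial>M)"
      by (rule nn_integral_suminf) simp
    also have "\<dots> \<le> (\<Sum>j. ennreal (C * r ^ j))"
      by (intro suminf_le L1) auto
    also have "\<dots> = ennreal (\<Sum>j. C * r ^ j)"
      using C r by (intro suminf_ennreal2) (auto intro: summable_mult summable_geometric)
    finally have "(\<integral>\<^sup>+x. (\<Sum>j. ennreal (cmod (f (Suc j) x - f j x))) \<partial>M) \<noteq> \<infinity>"
      using ennreal_less_top by (metis infinity_ennreal_def leD)
    then have "AE x in M. (\<Sum>j. ennreal (cmod (f (Suc j) x - f j x))) \<noteq> \<infinity>"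
      by (intro nn_integral_noteq_infinite) auto
    then show ?thesis by eventually_elim (auto intro!: summable_suminf_not_top)
  qed
  then have conv: "AE x in M. (\<lambda>j. f j x) \<longlonglongrightarrow> lim (\<lambda>j. f j x)"
  proof eventually_elim
    case (elim x)
    then have "summable (\<lambda>j. f (Suc j) x - f j x)" by (rule summable_norm_cancel)
    then have "(\<lambda>n. \<Sum>j<n. f (Suc j) x - f j x) \<longlonglongrightarrow> (\<Sum>j. f (Suc j) x - f j x)"
      by (rule summable_LIMSEQ)
    then have "(\<lambda>n. f n x - f 0 x) \<longlonglongrightarrow> (\<Sum>j. f (Suc j) x - f j x)"
      by (simp add: sum_lessThan_telescope[of "\<lambda>n. f n x"])
    then have "(\<lambda>n. (f n x - f 0 x) + f 0 x) \<longlonglongrightarrow> (\<Sum>j. f (Suc j) x - f j x) + f 0 x"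
      by (intro tendsto_intros)
    then have "convergent (\<lambda>n. f n x)" by (auto simp: convergent_def)
    then show ?case by (rule convergent_LIMSEQ_iff[THEN iffD1])
  qed
  \<comment> \<open>Where the sequence diverges, \<open>lim\<close> returns an unspecified value;
    measurability of g on the whole space is not affected.\<close>
  define g where "g x = lim (\<lambda>j. f j x)" for x
  have gm [measurable]: "g \<in> borel_measurable M"
    unfolding g_def[abs_def] by (rule borel_measurable_lim_metric) simp
  have tail: "l2norm M (\<lambda>x. f (j + n) x - f j x) \<le> C * r ^ j / (1 - r)" for j n
  proof -
    have "l2norm M (\<lambda>x. f (j + n) x - f j x) \<le> (\<Sum>i<n. C * r ^ (j + i))"
    proof (induction n)
      case 0
      show ?case by (simp add: l2norm_def)
    next
      case (Suc n)
      have "l2norm M (\<lambda>x. f (j + Suc n) x - f j x)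
        \<le> l2norm M (\<lambda>x. f (Suc (j + n)) x - f (j + n) x) + l2norm M (\<lambda>x. f (j + n) x - f j x)"
        using l2norm_triangle_diff[OF f[of "Suc (j + n)"] f[of "j + n"] f[of j]] by simp
      then show ?case using C(2)[of "j + n"] Suc by simp
    qed
    also have "\<dots> = C * r ^ j * (\<Sum>i<n. r ^ i)"
      by (simp add: sum_distrib_left power_add ac_simps)
    also have "\<dots> \<le> C * r ^ j * (1 / (1 - r))"
    proof (intro mult_left_mono)
      have "(\<Sum>i<n. r ^ i) \<le> (\<Sum>i. r ^ i)"
        using r by (intro sum_le_suminf summable_geometric) auto
      then show "(\<Sum>i<n. r ^ i) \<le> 1 / (1 - r)" using r by (simp add: suminf_geometric)
    qed (use C r in auto)
    finally show ?thesis by simp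
  qed
  have est: "(\<lambda>x. g x - f j x) \<in> L2 M" "l2norm M (\<lambda>x. g x - f j x) \<le> C * r ^ j / (1 - r)" for j
  proof -
    have b: "0 \<le> C * r ^ j / (1 - r)" using C r by simp
    have "(\<integral>\<^sup>+x. ennreal ((cmod (g x - f j x))\<^sup>2) \<partial>M)
      = (\<integral>\<^sup>+x. liminf (\<lambda>n. ennreal ((cmod (f (j + n) x - f j x))\<^sup>2)) \<partial>M)"
    proof (rule nn_integral_cong_AE)
      show "AE x in M. ennreal ((cmod (g x - f j x))\<^sup>2) = liminf (\<lambda>n. ennreal ((cmod (f (j + n) x - f j x))\<^sup>2))"
        using conv
      proof eventually_elim
        case (elim x)
        then have "(\<lambda>n. f (j + n) x) \<longlonglongrightarrow> g x"
          using LIMSEQ_ignore_initial_segment[of "\<lambda>n. f n x" "g x" j] by (simp add: g_def add.commute)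
        then have "(\<lambda>n. ennreal ((cmod (f (j + n) x - f j x))\<^sup>2)) \<longlonglongrightarrow> ennreal ((cmod (g x - f j x))\<^sup>2)"
          by (intro tendsto_intros)
        then show ?case by (intro lim_imp_Liminf[symmetric]) auto
      qed
    qed
    also have "\<dots> \<le> liminf (\<lambda>n. \<integral>\<^sup>+x. ennreal ((cmod (f (j + n) x - f j x))\<^sup>2) \<partial>M)"
      by (rule nn_integral_liminf) simp
    also have "\<dots> \<le> liminf (\<lambda>n::nat. ennreal ((C * r ^ j / (1 - r))\<^sup>2))"
    proof (rule Liminf_mono, rule always_eventually, rule allI)
      fix n
      show "(\<integral>\<^sup>+x. ennreal ((cmod (f (j + n) x - f j x))\<^sup>2) \<partial>M) \<le> ennreal ((C * r ^ j / (1 - r))\<^sup>2)"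
        unfolding nn_l2norm[OF L2_diff(1)[OF f f], of "j + n" j]
        by (intro ennreal_leI power_mono tail) simp
    qed
    also have "\<dots> = ennreal ((C * r ^ j / (1 - r))\<^sup>2)" by (simp add: Liminf_const)
    finally have le: "(\<integral>\<^sup>+x. ennreal ((cmod (g x - f j x))\<^sup>2) \<partial>M) \<le> ennreal ((C * r ^ j / (1 - r))\<^sup>2)" .
    have m: "(\<lambda>x. g x - f j x) \<in> borel_measurable M" by measurable
    show "(\<lambda>x. g x - f j x) \<in> L2 M" "l2norm M (\<lambda>x. g x - f j x) \<le> C * r ^ j / (1 - r)"
      using L2I[OF m b le] by auto
  qed
  have "(\<lambda>x. (g x - f 0 x) + f 0 x) \<in> L2 M" by (intro L2_add est f)
  then have "g \<in> L2 M" by simp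
  then show ?thesis using est(2) by blast
qed

section \<open>Bounded operators and adjoints\<close>

text \<open>\<open>opb M A C\<close> says that \<open>C\<close> bounds the operator norm; unlike \<^const>\<open>opnorm\<close> it is meaningful
  without knowing beforehand that the supremum is finite.\<close>
definition opb :: "pt measure \<Rightarrow> op \<Rightarrow> real \<Rightarrow> bool" where
  "opb M A C \<longleftrightarrow> (\<forall>\<eta>\<in>L2 M. l2norm M (A \<eta>) \<le> C * l2norm M \<eta>)"

text \<open>Adjointness as a relation between two given operators: \<open>op_adj\<close> is a choice
  and becomes meaningful only after some bounded adjoint has been exhibited.\<close>

definition is_adj :: "pt measure \<Rightarrow> op \<Rightarrow> op \<Rightarrow> bool" where
  "is_adj M A B \<longleftrightarrow> (\<forall>\<eta>\<in>L2 M. \<forall>\<zeta>\<in>L2 M. l2inner M (A \<eta>) \<zeta> = l2inner M \<eta> (B \<zeta>))"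

lemma opbD: "opb M A C \<Longrightarrow> \<eta> \<in> L2 M \<Longrightarrow> l2norm M (A \<eta>) \<le> C * l2norm M \<eta>"
  by (simp add: opb_def)

lemma opb_mono: "opb M A C \<Longrightarrow> C \<le> D \<Longrightarrow> opb M A D"
  unfolding opb_def by (meson l2norm_nonneg mult_right_mono order_trans)

lemma bop_L2: "is_bop M A \<Longrightarrow> \<eta> \<in> L2 M \<Longrightarrow> A \<eta> \<in> L2 M"
  by (simp add: is_bop_def)

lemma bop_cong:
  "is_bop M A \<Longrightarrow> \<eta> \<in> L2 M \<Longrightarrow> \<zeta> \<in> L2 M \<Longrightarrow> AE x in M. \<eta> x = \<zeta> x \<Longrightarrow> AE x in M. A \<eta> x = A \<zeta> x"
  by (simp add: is_bop_def)

lemma bop_linear: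
  "is_bop M A \<Longrightarrow> \<eta> \<in> L2 M \<Longrightarrow> \<zeta> \<in> L2 M \<Longrightarrow> AE x in M. A (\<lambda>y. c * \<eta> y + \<zeta> y) x = c * A \<eta> x + A \<zeta> x"
  by (simp add: is_bop_def)

lemma bop_minus:
  assumes "is_bop M A" "\<eta> \<in> L2 M" "\<zeta> \<in> L2 M"
  shows "AE x in M. A (\<lambda>y. \<eta> y - \<zeta> y) x = A \<eta> x - A \<zeta> x"
  using bop_linear[OF assms(1,3,2), of "-1"] by simp

lemma bop_opb:
  assumes "is_bop M A"
  obtains C where "0 \<le> C" "opb M A C"
proof -
  obtain C where C: "opb M A C" using assms unfolding is_bop_def opb_def by blast
  show thesis by (rule that[of "max 0 C"]) (auto intro: opb_mono[OF C])
qed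

lemma is_bopI:
  assumes "\<And>\<eta>. \<eta> \<in> L2 M \<Longrightarrow> A \<eta> \<in> L2 M"
    and "\<And>\<eta> \<zeta>. \<eta> \<in> L2 M \<Longrightarrow> \<zeta> \<in> L2 M \<Longrightarrow> AE x in M. \<eta> x = \<zeta> x \<Longrightarrow> AE x in M. A \<eta> x = A \<zeta> x"
    and "\<And>\<eta> \<zeta> c. \<eta> \<in> L2 M \<Longrightarrow> \<zeta> \<in> L2 M \<Longrightarrow> AE x in M. A (\<lambda>y. c * \<eta> y + \<zeta> y) x = c * A \<eta> x + A \<zeta> x"
    and "opb M A C"
  shows "is_bop M A"
  using assms unfolding is_bop_def opb_def by blast

lemma is_bop_id: "is_bop M id"
  by (rule is_bopI[where C = 1]) (auto simp: opb_def)

section \<open>Sums, multiples and compositions of bounded operators\<close>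

lemma opb_add:
  assumes "is_bop M A" "is_bop M B" "opb M A a" "opb M B b"
  shows "opb M (op_add A B) (a + b)"
  unfolding opb_def
proof
  fix \<eta> assume "\<eta> \<in> L2 M"
  then show "l2norm M (op_add A B \<eta>) \<le> (a + b) * l2norm M \<eta>"
    using L2_add(2)[OF bop_L2[OF assms(1)] bop_L2[OF assms(2)], of \<eta> \<eta>] assms(3,4)
    unfolding op_add_def opb_def by (fastforce simp: distrib_right)
qed

lemma opb_scale: "opb M A a \<Longrightarrow> opb M (op_scale c A) (cmod c * a)"
  unfolding opb_def op_scale_def l2norm_scale by (simp add: mult.assoc mult_left_mono)

lemma opb_diff:
  assumes "is_bop M A" "is_bop M B" "opb M A a" "opb M B b"
  shows "opb M (op_diff A B) (a + b)"
  unfolding opb_def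
proof
  fix \<eta> assume "\<eta> \<in> L2 M"
  then show "l2norm M (op_diff A B \<eta>) \<le> (a + b) * l2norm M \<eta>"
    using L2_diff(2)[OF bop_L2[OF assms(1)] bop_L2[OF assms(2)], of \<eta> \<eta>] assms(3,4)
    unfolding op_diff_def opb_def by (fastforce simp: distrib_right)
qed

lemma opb_comp:
  assumes "is_bop M B" "opb M A a" "opb M B b" "0 \<le> a"
  shows "opb M (A \<circ> B) (a * b)"
  unfolding opb_def
proof
  fix \<eta> assume \<eta>: "\<eta> \<in> L2 M"
  have "l2norm M (A (B \<eta>)) \<le> a * l2norm M (B \<eta>)" by (rule opbD[OF assms(2) bop_L2[OF assms(1) \<eta>]])
  also have "\<dots> \<le> a * (b * l2norm M \<eta>)" by (rule mult_left_mono[OF opbD[OF assms(3) \<eta>] assms(4)])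
  finally show "l2norm M ((A \<circ> B) \<eta>) \<le> a * b * l2norm M \<eta>" by (simp add: mult.assoc)
qed

lemma is_bop_add:
  assumes A: "is_bop M A" and B: "is_bop M B"
  shows "is_bop M (op_add A B)"
proof -
  obtain a b where "opb M A a" "opb M B b" using bop_opb[OF A] bop_opb[OF B] by metis
  then have C: "opb M (op_add A B) (a + b)" by (rule opb_add[OF A B])
  show ?thesis
  proof (rule is_bopI[OF _ _ _ C])
    fix \<eta> \<zeta> and c :: complex assume L: "\<eta> \<in> L2 M"
    show "op_add A B \<eta> \<in> L2 M" unfolding op_add_def by (intro L2_add(1) bop_L2[OF A L] bop_L2[OF B L])
    assume L': "\<zeta> \<in> L2 M"
    show "AE x in M. op_add A B (\<lambda>y. c * \<eta> y + \<zeta> y) x = c * op_add A B \<eta> x + op_add A B \<zeta> x"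
      using bop_linear[OF A L L', of c] bop_linear[OF B L L', of c]
      by eventually_elim (simp add: op_add_def algebra_simps)
    assume "AE x in M. \<eta> x = \<zeta> x"
    from bop_cong[OF A L L' this] bop_cong[OF B L L' this]
    show "AE x in M. op_add A B \<eta> x = op_add A B \<zeta> x"
      by eventually_elim (simp add: op_add_def)
  qed
qed

lemma is_bop_scale:
  assumes A: "is_bop M A"
  shows "is_bop M (op_scale c A)"
proof -
  obtain a where "opb M A a" using bop_opb[OF A] by metis
  then have C: "opb M (op_scale c A) (cmod c * a)" by (rule opb_scale)
  show ?thesis
  proof (rule is_bopI[OF _ _ _ C])
    fix \<eta> \<zeta> and d :: complex assume L: "\<eta> \<in> L2 M"
    show "op_scale c A \<eta> \<in> L2 M" unfolding op_scale_def by (intro L2_scale bop_L2[OF A L])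
    assume L': "\<zeta> \<in> L2 M"
    show "AE x in M. op_scale c A (\<lambda>y. d * \<eta> y + \<zeta> y) x = d * op_scale c A \<eta> x + op_scale c A \<zeta> x"
      using bop_linear[OF A L L', of d]
      by eventually_elim (simp add: op_scale_def algebra_simps)
    assume "AE x in M. \<eta> x = \<zeta> x"
    from bop_cong[OF A L L' this]
    show "AE x in M. op_scale c A \<eta> x = op_scale c A \<zeta> x"
      by eventually_elim (simp add: op_scale_def)
  qed
qed

lemma op_diff_alt: "op_diff A B = op_add A (op_scale (-1) B)"
  by (simp add: op_diff_def op_add_def op_scale_def)

lemma is_bop_diff: "is_bop M A \<Longrightarrow> is_bop M B \<Longrightarrow> is_bop M (op_diff A B)"
  unfolding op_diff_alt by (intro is_bop_add is_bop_scale)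

lemma is_bop_comp:
  assumes A: "is_bop M A" and B: "is_bop M B"
  shows "is_bop M (A \<circ> B)"
proof -
  obtain a b where ab: "0 \<le> a" "opb M A a" "opb M B b" using bop_opb[OF A] bop_opb[OF B] by metis
  have C: "opb M (A \<circ> B) (a * b)" by (rule opb_comp[OF B ab(2,3,1)])
  show ?thesis
  proof (rule is_bopI[OF _ _ _ C])
    fix \<eta> \<zeta> and c :: complex assume L: "\<eta> \<in> L2 M"
    show "(A \<circ> B) \<eta> \<in> L2 M" by (simp add: bop_L2[OF A] bop_L2[OF B] L)
    assume L': "\<zeta> \<in> L2 M"
    note BL = bop_L2[OF B L] bop_L2[OF B L']
    have cL: "(\<lambda>y. c * \<eta> y + \<zeta> y) \<in> L2 M" by (intro L2_add L2_scale L L')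
    have cBL: "(\<lambda>y. c * B \<eta> y + B \<zeta> y) \<in> L2 M" by (intro L2_add L2_scale BL)
    from bop_cong[OF A bop_L2[OF B cL] cBL bop_linear[OF B L L']] bop_linear[OF A BL, of c]
    show "AE x in M. (A \<circ> B) (\<lambda>y. c * \<eta> y + \<zeta> y) x = c * (A \<circ> B) \<eta> x + (A \<circ> B) \<zeta> x"
      by eventually_elim simp
    assume "AE x in M. \<eta> x = \<zeta> x"
    from bop_cong[OF A BL bop_cong[OF B L L' this]]
    show "AE x in M. (A \<circ> B) \<eta> x = (A \<circ> B) \<zeta> x" by simp
  qed
qed

section \<open>Equality of operators almost everywhere\<close>

lemma op_eq_refl: "op_eq M A A"
  by (simp add: op_eq_def)

lemma op_eq_sym: "op_eq M A B \<Longrightarrow> op_eq M B A"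
  unfolding op_eq_def by (metis (mono_tags, lifting) eventually_mono)

lemma op_eq_trans:
  assumes "op_eq M A B" "op_eq M B C" shows "op_eq M A C"
  unfolding op_eq_def
proof
  fix \<eta> assume "\<eta> \<in> L2 M"
  with assms have "AE x in M. A \<eta> x = B \<eta> x" "AE x in M. B \<eta> x = C \<eta> x" by (auto simp: op_eq_def)
  then show "AE x in M. A \<eta> x = C \<eta> x" by eventually_elim simp
qed

lemma op_eq_add:
  assumes "op_eq M A A'" "op_eq M B B'" shows "op_eq M (op_add A B) (op_add A' B')"
  unfolding op_eq_def
proof
  fix \<eta> assume "\<eta> \<in> L2 M"
  with assms have "AE x in M. A \<eta> x = A' \<eta> x" "AE x in M. B \<eta> x = B' \<eta> x" by (auto simp: op_eq_def)
  then show "AE x in M. op_add A B \<eta> x = op_add A' B' \<eta> x" by eventually_elim (simp add: op_add_def)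
qed

lemma op_eq_scale:
  assumes "op_eq M A A'" shows "op_eq M (op_scale c A) (op_scale c A')"
  unfolding op_eq_def
proof
  fix \<eta> assume "\<eta> \<in> L2 M"
  with assms have "AE x in M. A \<eta> x = A' \<eta> x" by (auto simp: op_eq_def)
  then show "AE x in M. op_scale c A \<eta> x = op_scale c A' \<eta> x" by eventually_elim (simp add: op_scale_def)
qed

lemma op_eq_diff: "op_eq M A A' \<Longrightarrow> op_eq M B B' \<Longrightarrow> op_eq M (op_diff A B) (op_diff A' B')"
  unfolding op_diff_alt by (intro op_eq_add op_eq_scale)

lemma op_eq_comp:
  assumes A: "is_bop M A" and B: "is_bop M B" "is_bop M B'" and eq: "op_eq M A A'" "op_eq M B B'"
  shows "op_eq M (A \<circ> B) (A' \<circ> B')"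
  unfolding op_eq_def
proof
  fix \<eta> assume L: "\<eta> \<in> L2 M"
  have "AE x in M. B \<eta> x = B' \<eta> x" using eq(2) L by (simp add: op_eq_def)
  from bop_cong[OF A bop_L2[OF B(1) L] bop_L2[OF B(2) L] this]
  have "AE x in M. A (B \<eta>) x = A (B' \<eta>) x" .
  moreover have "AE x in M. A (B' \<eta>) x = A' (B' \<eta>) x"
    using eq(1) bop_L2[OF B(2) L] by (simp add: op_eq_def)
  ultimately show "AE x in M. (A \<circ> B) \<eta> x = (A' \<circ> B') \<eta> x" by eventually_elim simp
qed

lemma op_eq_comp_add_right:
  assumes A: "is_bop M A" and B: "is_bop M B" "is_bop M C"
  shows "op_eq M (A \<circ> op_add (op_scale c B) C) (op_add (op_scale c (A \<circ> B)) (A \<circ> C))"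
  unfolding op_eq_def
proof
  fix \<eta> assume L: "\<eta> \<in> L2 M"
  show "AE x in M. (A \<circ> op_add (op_scale c B) C) \<eta> x = op_add (op_scale c (A \<circ> B)) (A \<circ> C) \<eta> x"
    using bop_linear[OF A bop_L2[OF B(1) L] bop_L2[OF B(2) L], of c]
    by (simp add: op_add_def op_scale_def)
qed

lemma comp_add_left: "op_add (op_scale c A) B \<circ> C = op_add (op_scale c (A \<circ> C)) (B \<circ> C)"
  by (simp add: fun_eq_iff op_add_def op_scale_def)

lemma op_eq_comp_diff_right:
  assumes A: "is_bop M A" and B: "is_bop M B" "is_bop M C"
  shows "op_eq M (A \<circ> op_diff B C) (op_diff (A \<circ> B) (A \<circ> C))"
  unfolding op_eq_def
proof
  fix \<eta> assume L: "\<eta> \<in> L2 M"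
  show "AE x in M. (A \<circ> op_diff B C) \<eta> x = op_diff (A \<circ> B) (A \<circ> C) \<eta> x"
    using bop_minus[OF A bop_L2[OF B(1) L] bop_L2[OF B(2) L]]
    by (simp add: op_diff_def)
qed

lemma opb_op_eq:
  assumes "is_bop M A" "is_bop M B" "op_eq M A B" "opb M A c" shows "opb M B c"
  unfolding opb_def
proof
  fix \<eta> assume L: "\<eta> \<in> L2 M"
  have "l2norm M (A \<eta>) = l2norm M (B \<eta>)"
    using assms(3) L by (intro l2norm_cong_AE bop_L2[OF assms(1) L] bop_L2[OF assms(2) L]) (auto simp: op_eq_def)
  then show "l2norm M (B \<eta>) \<le> c * l2norm M \<eta>" using opbD[OF assms(4) L] by simp
qed

text \<open>Bookkeeping for approximation errors: dividing by \<open>K + 1\<close> covers the case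
  \<open>K = 0\<close>.\<close>

lemma shrink_pos:
  assumes "0 \<le> (K::real)" "0 < e"
  shows "0 < e / (K + 1)" "e / (K + 1) * K \<le> e"
proof -
  have K: "0 < K + 1" using assms by linarith
  then show "0 < e / (K + 1)" using assms by simp
  have "e * K \<le> e * (K + 1)" using assms by (intro mult_left_mono) auto
  then show "e / (K + 1) * K \<le> e" using K by (simp add: pos_divide_le_eq)
qed

lemma op_eqI_opb:
  assumes A: "is_bop M A" and B: "is_bop M B" and e: "\<And>e. 0 < e \<Longrightarrow> opb M (op_diff A B) e"
  shows "op_eq M A B"
  unfolding op_eq_def
proof
  fix \<eta> assume L: "\<eta> \<in> L2 M"
  have d: "op_diff A B \<eta> \<in> L2 M" by (rule bop_L2[OF is_bop_diff[OF A B] L])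
  have "l2norm M (op_diff A B \<eta>) \<le> 0 + e" if "0 < e" for e
  proof -
    have "l2norm M (op_diff A B \<eta>) \<le> e / (l2norm M \<eta> + 1) * l2norm M \<eta>"
      using that by (intro opbD[OF e L] shrink_pos) auto
    also have "\<dots> \<le> e" using that by (intro shrink_pos) auto
    finally show ?thesis by simp
  qed
  then have "l2norm M (op_diff A B \<eta>) \<le> 0" by (rule field_le_epsilon)
  then have "l2norm M (op_diff A B \<eta>) = 0" by (simp add: antisym)
  from l2norm_zero_AE[OF d this] show "AE x in M. A \<eta> x = B \<eta> x"
    by eventually_elim (simp add: op_diff_def)
qed

lemma opb_op_eq_zero:
  assumes "is_bop M A" "is_bop M B" "op_eq M A B"
  shows "opb M (op_diff A B) 0"
proof -
  have "op_eq M (op_diff B B) (op_diff A B)"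
    by (intro op_eq_diff op_eq_refl op_eq_sym[OF assms(3)])
  moreover have "opb M (op_diff B B) 0" by (simp add: opb_def op_diff_def l2norm_def)
  ultimately show ?thesis using opb_op_eq assms is_bop_diff by blast
qed

lemma opb_triangle:
  assumes "is_bop M A" "is_bop M B" "is_bop M C" "opb M (op_diff A B) a" "opb M (op_diff B C) b"
  shows "opb M (op_diff A C) (a + b)"
  using opb_add[OF is_bop_diff[OF assms(1,2)] is_bop_diff[OF assms(2,3)] assms(4,5)]
  by (simp add: op_add_def op_diff_def)

lemma opb_diff_commute: "opb M (op_diff A B) a \<Longrightarrow> opb M (op_diff B A) a"
  using opb_scale[of M "op_diff A B" a "-1"] by (simp add: op_scale_def op_diff_def)

lemma opb_comp_diff:
  assumes bop: "is_bop M A" "is_bop M B" "is_bop M A'" "is_bop M B'"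
    and ob: "opb M A a" "opb M B' b" "0 \<le> a" "0 \<le> e"
    and d: "opb M (op_diff A A') e" "opb M (op_diff B B') f"
  shows "opb M (op_diff (A \<circ> B) (A' \<circ> B')) (a * f + e * b)"
proof (rule opb_triangle)
  \<comment> \<open>In the splitting into A (B - B') and (A - A') B' the first part needs a detour
    through \<open>op_eq\<close>, since A is additive only almost everywhere; the second is an
    identity of functions.\<close>
  show "opb M (op_diff (A \<circ> B) (A \<circ> B')) (a * f)"
  proof (rule opb_op_eq[OF _ _ op_eq_comp_diff_right])
    show "opb M (A \<circ> op_diff B B') (a * f)" by (intro opb_comp is_bop_diff bop ob d)
  qed (intro is_bop_comp is_bop_diff bop)+
  have "opb M (op_diff A A' \<circ> B') (e * b)" by (intro opb_comp bop ob d)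
  then show "opb M (op_diff (A \<circ> B') (A' \<circ> B')) (e * b)" by (simp add: op_diff_def comp_def)
qed (intro is_bop_comp bop)+

section \<open>The operator norm as a supremum\<close>

lemma opnorm_le:
  assumes "0 \<le> C" "opb M A C"
  shows "opnorm M A \<le> C"
  unfolding opnorm_def
proof (rule cSup_least)
  show "{l2norm M (A \<eta>) |\<eta>. \<eta> \<in> L2 M \<and> l2norm M \<eta> \<le> 1} \<noteq> {}"
    using L2_zero[of M] by (force simp: l2norm_def intro: exI[of _ "\<lambda>_. 0"])
  fix y assume "y \<in> {l2norm M (A \<eta>) |\<eta>. \<eta> \<in> L2 M \<and> l2norm M \<eta> \<le> 1}"
  then obtain \<eta> where "y = l2norm M (A \<eta>)" "\<eta> \<in> L2 M" "l2norm M \<eta> \<le> 1" by blast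
  then show "y \<le> C" using opbD[OF assms(2), of \<eta>] mult_left_mono[of "l2norm M \<eta>" 1 C] assms(1) by simp
qed

lemma opnorm_opb:
  assumes A: "is_bop M A"
  shows "opb M A (opnorm M A)" "0 \<le> opnorm M A"
proof -
  obtain C where C: "0 \<le> C" "opb M A C" using bop_opb[OF A] .
  let ?S = "{l2norm M (A \<eta>) |\<eta>. \<eta> \<in> L2 M \<and> l2norm M \<eta> \<le> 1}"
  have bdd: "bdd_above ?S"
  proof (rule bdd_aboveI)
    fix y assume "y \<in> ?S"
    then obtain \<eta> where "y = l2norm M (A \<eta>)" "\<eta> \<in> L2 M" "l2norm M \<eta> \<le> 1" by blast
    then show "y \<le> C" using opbD[OF C(2), of \<eta>] mult_left_mono[of "l2norm M \<eta>" 1 C] C(1) by simp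
  qed
  have up: "l2norm M (A \<eta>) \<le> opnorm M A" if "\<eta> \<in> L2 M" "l2norm M \<eta> \<le> 1" for \<eta>
    unfolding opnorm_def using that by (intro cSup_upper bdd) blast
  have "0 \<le> l2norm M (A (\<lambda>_. 0))" by simp
  also have "\<dots> \<le> opnorm M A" by (rule up[OF L2_zero]) (simp add: l2norm_def)
  finally show "0 \<le> opnorm M A" .
  show "opb M A (opnorm M A)"
    unfolding opb_def
  proof
    fix \<eta> assume L: "\<eta> \<in> L2 M"
    show "l2norm M (A \<eta>) \<le> opnorm M A * l2norm M \<eta>"
    proof (cases "l2norm M \<eta> = 0")
      case True
      then show ?thesis using opbD[OF C(2) L] by simp
    next
      case False
      let ?c = "complex_of_real (1 / l2norm M \<eta>)"
      have "l2norm M (\<lambda>x. ?c * \<eta> x) = 1" unfolding l2norm_scale using False by (simp add: norm_divide)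
      then have 1: "l2norm M (A (\<lambda>x. ?c * \<eta> x)) \<le> opnorm M A" by (intro up L2_scale L) simp
      have sL: "A (\<lambda>x. ?c * \<eta> x) \<in> L2 M" by (intro bop_L2[OF A] L2_scale L)
      \<comment> \<open>Homogeneity is available only through \<open>bop_linear\<close>, which has a
        second summand; the zero function is put there, and its image has norm 0.\<close>
      have "AE x in M. A (\<lambda>y. ?c * \<eta> y) x = ?c * A \<eta> x"
      proof -
        have z: "l2norm M (A (\<lambda>_. 0)) = 0" using opbD[OF C(2) L2_zero] by (simp add: l2norm_def antisym)
        show ?thesis
          using bop_linear[OF A L L2_zero, of ?c] l2norm_zero_AE[OF bop_L2[OF A L2_zero] z]
          by eventually_elim simp
      qed
      from l2norm_cong_AE[OF sL L2_scale[OF bop_L2[OF A L]] this]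
      have "l2norm M (A (\<lambda>x. ?c * \<eta> x)) = cmod ?c * l2norm M (A \<eta>)" unfolding l2norm_scale .
      then have "l2norm M (A \<eta>) / l2norm M \<eta> \<le> opnorm M A" using 1 by (simp add: norm_divide)
      moreover have "0 < l2norm M \<eta>" using False l2norm_nonneg[of M \<eta>] by linarith
      ultimately show ?thesis by (simp add: pos_divide_le_eq)
    qed
  qed
qed

lemma opnorm_less: "is_bop M A \<Longrightarrow> opnorm M A < e \<Longrightarrow> opb M A e"
  using opnorm_opb(1) opb_mono less_imp_le by blast

section \<open>Adjoints\<close>

lemma adj_sym: "is_adj M A B \<Longrightarrow> is_adj M B A"
  unfolding is_adj_def
proof (intro ballI)
  fix \<eta> \<zeta> assume *: "\<forall>\<eta>\<in>L2 M. \<forall>\<zeta>\<in>L2 M. l2inner M (A \<eta>) \<zeta> = l2inner M \<eta> (B \<zeta>)"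
    and L: "\<eta> \<in> L2 M" "\<zeta> \<in> L2 M"
  have "l2inner M (B \<eta>) \<zeta> = cnj (l2inner M \<zeta> (B \<eta>))" by (rule l2inner_cnj)
  also have "\<dots> = cnj (l2inner M (A \<zeta>) \<eta>)" using * L by simp
  also have "\<dots> = l2inner M \<eta> (A \<zeta>)" by (rule l2inner_cnj[symmetric])
  finally show "l2inner M (B \<eta>) \<zeta> = l2inner M \<eta> (A \<zeta>)" .
qed

lemma adj_id: "is_adj M id id"
  by (simp add: is_adj_def)

lemma adj_comp:
  assumes "is_bop M B" "is_bop M A'" "is_adj M A A'" "is_adj M B B'"
  shows "is_adj M (A \<circ> B) (B' \<circ> A')"
  unfolding is_adj_def
proof (intro ballI)
  fix \<eta> \<zeta> assume L: "\<eta> \<in> L2 M" "\<zeta> \<in> L2 M"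
  have "l2inner M (A (B \<eta>)) \<zeta> = l2inner M (B \<eta>) (A' \<zeta>)"
    using assms(3) bop_L2[OF assms(1) L(1)] L(2) unfolding is_adj_def by blast
  also have "\<dots> = l2inner M \<eta> (B' (A' \<zeta>))"
    using assms(4) bop_L2[OF assms(2) L(2)] L(1) unfolding is_adj_def by blast
  finally show "l2inner M ((A \<circ> B) \<eta>) \<zeta> = l2inner M \<eta> ((B' \<circ> A') \<zeta>)" by simp
qed

lemma adj_linear:
  assumes "is_bop M A" "is_bop M B" "is_bop M A'" "is_bop M B'" "is_adj M A A'" "is_adj M B B'"
  shows "is_adj M (op_add (op_scale c A) B) (op_add (op_scale (cnj c) A') B')"
  unfolding is_adj_def
proof (intro ballI)
  fix \<eta> \<zeta> assume L: "\<eta> \<in> L2 M" "\<zeta> \<in> L2 M"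
  have "l2inner M (op_add (op_scale c A) B \<eta>) \<zeta> = c * l2inner M (A \<eta>) \<zeta> + l2inner M (B \<eta>) \<zeta>"
    unfolding op_add_def op_scale_def
    by (rule l2inner_add_left[OF bop_L2[OF assms(1) L(1)] bop_L2[OF assms(2) L(1)] L(2)])
  also have "\<dots> = cnj (cnj c * l2inner M (A' \<zeta>) \<eta> + l2inner M (B' \<zeta>) \<eta>)"
  proof -
    have "l2inner M (A \<eta>) \<zeta> = cnj (l2inner M (A' \<zeta>) \<eta>)" "l2inner M (B \<eta>) \<zeta> = cnj (l2inner M (B' \<zeta>) \<eta>)"
      using assms(5,6) L l2inner_cnj[of M \<eta> "A' \<zeta>"] l2inner_cnj[of M \<eta> "B' \<zeta>"] unfolding is_adj_def by auto
    then show ?thesis by simp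
  qed
  also have "\<dots> = cnj (l2inner M (op_add (op_scale (cnj c) A') B' \<zeta>) \<eta>)"
    unfolding op_add_def op_scale_def
      l2inner_add_left[OF bop_L2[OF assms(3) L(2)] bop_L2[OF assms(4) L(2)] L(1)] ..
  finally show "l2inner M (op_add (op_scale c A) B \<eta>) \<zeta> = l2inner M \<eta> (op_add (op_scale (cnj c) A') B' \<zeta>)"
    unfolding l2inner_cnj[of M \<eta> "op_add (op_scale (cnj c) A') B' \<zeta>"] .
qed

text \<open>Testing adjointness on \<open>B \<zeta>\<close> gives
  \<open>(l2norm M (B \<zeta>))\<^sup>2\<close> as an inner product with
  \<open>A (B \<zeta>)\<close>; Cauchy-Schwarz and one cancellation finish. Taking adjoints thus
  preserves distances, on which all limits of adjoints rely.\<close>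

lemma adj_opb:
  assumes A: "is_bop M A" and B: "is_bop M B" and adj: "is_adj M A B" and c: "opb M A c"
  shows "opb M B c"
  unfolding opb_def
proof
  fix \<zeta> assume L: "\<zeta> \<in> L2 M"
  note BL = bop_L2[OF B L]
  have "(l2norm M (B \<zeta>))\<^sup>2 = cmod (l2inner M (B \<zeta>) (B \<zeta>))"
    unfolding l2inner_self by (simp add: norm_power)
  also have "\<dots> = cmod (l2inner M (A (B \<zeta>)) \<zeta>)"
  proof -
    have "l2inner M (A (B \<zeta>)) \<zeta> = l2inner M (B \<zeta>) (B \<zeta>)" using adj BL L unfolding is_adj_def by blast
    then show ?thesis by simp
  qed
  also have "\<dots> \<le> l2norm M (A (B \<zeta>)) * l2norm M \<zeta>" by (rule l2inner_bound[OF bop_L2[OF A BL] L])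
  also have "\<dots> \<le> (c * l2norm M (B \<zeta>)) * l2norm M \<zeta>"
    by (intro mult_right_mono opbD[OF c BL]) simp
  finally have le: "l2norm M (B \<zeta>) * l2norm M (B \<zeta>) \<le> (c * l2norm M \<zeta>) * l2norm M (B \<zeta>)"
    by (simp add: power2_eq_square ac_simps)
  show "l2norm M (B \<zeta>) \<le> c * l2norm M \<zeta>"
  proof (cases "l2norm M (B \<zeta>) = 0")
    case True
    \<comment> \<open>The sign of c is not prescribed, so nonnegativity of the bound is read off
      from A.\<close>
    have "0 \<le> l2norm M (A \<zeta>)" by simp
    also have "\<dots> \<le> c * l2norm M \<zeta>" by (rule opbD[OF c L])
    finally show ?thesis using True by simp
  next
    case False
    then have "0 < l2norm M (B \<zeta>)" using l2norm_nonneg[of M "B \<zeta>"] by linarith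
    then show ?thesis using le by (rule mult_right_le_imp_le[rotated])
  qed
qed

text \<open>The difference of two adjoints of A is adjoint to \<open>A - A\<close>, whose norm bound
  0 passes to it.\<close>

lemma adj_unique:
  assumes B: "is_bop M B" "is_bop M B'" and adj: "is_adj M A B" "is_adj M A B'" and A: "is_bop M A"
  shows "op_eq M B B'"
proof -
  let ?Z = "op_diff A A"
  have "is_adj M (op_add (op_scale (-1) A) A) (op_add (op_scale (cnj (-1)) B') B)"
    by (rule adj_linear[OF A A B(2,1) adj(2,1)])
  then have "is_adj M ?Z (op_diff B B')" by (simp add: op_diff_def op_add_def op_scale_def)
  moreover have "opb M ?Z e" if "0 < e" for e
    using that by (simp add: opb_def op_diff_def l2norm_def)
  ultimately show ?thesis using adj_opb is_bop_diff A B by (intro op_eqI_opb) blast+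
qed

lemma op_adj_ex:
  assumes "is_bop M B" "is_adj M A B"
  shows "is_bop M (op_adj M A)" "is_adj M A (op_adj M A)"
  using someI[of "\<lambda>B. is_bop M B \<and> (\<forall>\<eta>\<in>L2 M. \<forall>\<zeta>\<in>L2 M. l2inner M (A \<eta>) \<zeta> = l2inner M \<eta> (B \<zeta>))" B] assms
  unfolding op_adj_def is_adj_def by auto

lemma op_adj_eq: "is_bop M A \<Longrightarrow> is_bop M B \<Longrightarrow> is_adj M A B \<Longrightarrow> op_eq M (op_adj M A) B"
  using adj_unique op_adj_ex by blast

text \<open>The defect of adjointness consists of two inner products with approximation errors, so
  it is smaller than every positive number.\<close>

lemma adj_approx:
  assumes bop: "is_bop M A" "is_bop M B"
    and ap: "\<And>e. 0 < e \<Longrightarrow> \<exists>A' B'. is_bop M A' \<and> is_bop M B' \<and> is_adj M A' B' \<and>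
      opb M (op_diff A A') e \<and> opb M (op_diff B B') e"
  shows "is_adj M A B"
  unfolding is_adj_def
proof (intro ballI)
  fix \<eta> \<zeta> assume L: "\<eta> \<in> L2 M" "\<zeta> \<in> L2 M"
  let ?K = "2 * l2norm M \<eta> * l2norm M \<zeta>"
  have K: "0 \<le> ?K" by simp
  have "cmod (l2inner M (A \<eta>) \<zeta> - l2inner M \<eta> (B \<zeta>)) \<le> 0 + e" if e: "0 < e" for e
  proof -
    from ap[OF shrink_pos(1)[OF K e]] obtain A' B' where b': "is_bop M A'" "is_bop M B'" and adj: "is_adj M A' B'"
      and d: "opb M (op_diff A A') (e / (?K + 1))" "opb M (op_diff B B') (e / (?K + 1))" by blast
    have "l2inner M (A \<eta>) \<zeta> - l2inner M \<eta> (B \<zeta>)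
        = l2inner M (op_diff A A' \<eta>) \<zeta> - l2inner M \<eta> (op_diff B B' \<zeta>)"
    proof -
      have "l2inner M (A' \<eta>) \<zeta> = l2inner M \<eta> (B' \<zeta>)" using adj L unfolding is_adj_def by blast
      then show ?thesis
        unfolding op_diff_def
          l2inner_diff_left[OF bop_L2[OF bop(1) L(1)] bop_L2[OF b'(1) L(1)] L(2)]
          l2inner_diff_right[OF bop_L2[OF bop(2) L(2)] bop_L2[OF b'(2) L(2)] L(1)] by simp
    qed
    then have "cmod (l2inner M (A \<eta>) \<zeta> - l2inner M \<eta> (B \<zeta>))
      \<le> cmod (l2inner M (op_diff A A' \<eta>) \<zeta>) + cmod (l2inner M \<eta> (op_diff B B' \<zeta>))"
      by (simp add: norm_triangle_ineq4)
    also have "\<dots> \<le> l2norm M (op_diff A A' \<eta>) * l2norm M \<zeta> + l2norm M \<eta> * l2norm M (op_diff B B' \<zeta>)"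
      by (intro add_mono l2inner_bound L bop_L2[OF is_bop_diff] bop b')
    also have "\<dots> \<le> (e / (?K + 1) * l2norm M \<eta>) * l2norm M \<zeta> + l2norm M \<eta> * (e / (?K + 1) * l2norm M \<zeta>)"
      by (intro add_mono mult_right_mono mult_left_mono opbD[OF d(1)] opbD[OF d(2)] L) auto
    also have "\<dots> = e / (?K + 1) * ?K" by simp
    also have "\<dots> \<le> e" by (rule shrink_pos(2)[OF K e])
    finally show ?thesis by simp
  qed
  then have "cmod (l2inner M (A \<eta>) \<zeta> - l2inner M \<eta> (B \<zeta>)) \<le> 0" by (rule field_le_epsilon)
  then show "l2inner M (A \<eta>) \<zeta> = l2inner M \<eta> (B \<zeta>)" by simp
qed

section \<open>Square roots, states and homomorphisms\<close>

lemma geometric_le_zero: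
  assumes "\<And>j::nat. x \<le> K * r ^ j" "0 \<le> r" "r < (1::real)"
  shows "x \<le> 0"
proof -
  have "(\<lambda>j. K * r ^ j) \<longlonglongrightarrow> K * 0"
    using assms by (intro tendsto_intros LIMSEQ_realpow_zero) auto
  from LIMSEQ_le_const[OF this, of x] show ?thesis using assms(1) by auto
qed

lemma geometric_less:
  assumes "0 < e" "0 \<le> r" "r < (1::real)"
  obtains j :: nat where "K * r ^ j < e"
  using geometric_le_zero[of e K r] assms by (metis not_less)

text \<open>The limit is chosen for each vector separately, so linearity and compatibility with null
  sets are not inherited from the construction; each is recovered because its defect has norm
  \<open>O(r ^ j)\<close> for all j.\<close>

lemma op_complete:
  assumes M: "prob_space M" and A: "\<And>j. is_bop M (A j)" and r: "0 \<le> r" "r < 1" and C: "0 \<le> C"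
    and d: "\<And>j. opb M (op_diff (A (Suc j)) (A j)) (C * r ^ j)"
  shows "\<exists>B. is_bop M B \<and> (\<forall>j. opb M (op_diff B (A j)) (C * r ^ j / (1 - r)))"
proof -
  have "\<exists>g\<in>L2 M. \<forall>j. l2norm M (\<lambda>x. g x - A j \<eta> x) \<le> (C * l2norm M \<eta>) * r ^ j / (1 - r)"
    if L: "\<eta> \<in> L2 M" for \<eta>
  proof (rule L2_complete[OF M _ r])
    show "A j \<eta> \<in> L2 M" for j by (rule bop_L2[OF A L])
    show "l2norm M (\<lambda>x. A (Suc j) \<eta> x - A j \<eta> x) \<le> C * l2norm M \<eta> * r ^ j" for j
      using opbD[OF d L, of j] by (simp add: op_diff_def ac_simps)
  qed (use C in simp)
  then have "\<forall>\<eta>\<in>L2 M. \<exists>g. g \<in> L2 M \<and> (\<forall>j. l2norm M (\<lambda>x. g x - A j \<eta> x) \<le> (C * l2norm M \<eta>) * r ^ j / (1 - r))"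
    by blast
  from bchoice[OF this] obtain B where B: "\<And>\<eta>. \<eta> \<in> L2 M \<Longrightarrow> B \<eta> \<in> L2 M"
    and est: "\<And>\<eta> j. \<eta> \<in> L2 M \<Longrightarrow> l2norm M (\<lambda>x. B \<eta> x - A j \<eta> x) \<le> (C / (1 - r) * l2norm M \<eta>) * r ^ j"
    by auto
  have near: "opb M (op_diff B (A j)) (C * r ^ j / (1 - r))" for j
    unfolding opb_def op_diff_def using est[of _ j] by (simp add: ac_simps)
  define K where "K = C / (1 - r)"
  note est = est[folded K_def]
  obtain a where a: "opb M (A 0) a" using bop_opb[OF A] by metis
  have "opb M B (K + a)"
    unfolding opb_def
  proof
    fix \<eta> assume L: "\<eta> \<in> L2 M"
    note AL = bop_L2[OF A L]
    have "l2norm M (B \<eta>) \<le> l2norm M (\<lambda>x. B \<eta> x - A 0 \<eta> x) + l2norm M (A 0 \<eta>)"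
      using L2_add(2)[OF L2_diff(1)[OF B[OF L] AL] AL, of 0 0] by simp
    then show "l2norm M (B \<eta>) \<le> (K + a) * l2norm M \<eta>"
      using est[OF L, of 0] opbD[OF a L] by (simp add: distrib_right)
  qed
  then have "is_bop M B"
  proof (rule is_bopI[rotated -1])
    fix \<eta> \<zeta> and c :: complex assume L: "\<eta> \<in> L2 M" "\<zeta> \<in> L2 M"
    let ?\<theta> = "\<lambda>y. c * \<eta> y + \<zeta> y"
    have T: "?\<theta> \<in> L2 M" by (intro L2_add L2_scale L)
    let ?D = "\<lambda>x. B ?\<theta> x - (c * B \<eta> x + B \<zeta> x)"
    have DL: "?D \<in> L2 M" by (intro L2_add L2_scale L2_diff B L T)
    have "l2norm M ?D \<le> (K * (l2norm M ?\<theta> + cmod c * l2norm M \<eta> + l2norm M \<zeta>)) * r ^ j" for j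
    proof -
      \<comment> \<open>\<open>A j\<close> is linear up to a null set, so subtracting its values in
        all three places does not change the defect almost everywhere and makes every term of order
        \<open>r ^ j\<close>.\<close>
      let ?E = "\<lambda>x. (B ?\<theta> x - A j ?\<theta> x) - (c * (B \<eta> x - A j \<eta> x) + (B \<zeta> x - A j \<zeta> x))"
      note AL = bop_L2[OF A L(1)] bop_L2[OF A L(2)] bop_L2[OF A T]
      have l1: "(\<lambda>x. B ?\<theta> x - A j ?\<theta> x) \<in> L2 M" by (intro L2_diff B T AL)
      have l2: "(\<lambda>x. c * (B \<eta> x - A j \<eta> x)) \<in> L2 M" by (intro L2_diff L2_scale B L AL)
      have l3: "(\<lambda>x. B \<zeta> x - A j \<zeta> x) \<in> L2 M" by (intro L2_diff B L AL)
      have EL: "?E \<in> L2 M" by (intro L2_diff(1)[OF l1] L2_add(1)[OF l2 l3])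
      have "AE x in M. ?D x = ?E x"
        using bop_linear[OF A L, of j c] by eventually_elim (simp add: algebra_simps)
      then have "l2norm M ?D = l2norm M ?E" by (rule l2norm_cong_AE[OF DL EL])
      also have "\<dots> \<le> l2norm M (\<lambda>x. B ?\<theta> x - A j ?\<theta> x) +
          l2norm M (\<lambda>x. c * (B \<eta> x - A j \<eta> x) + (B \<zeta> x - A j \<zeta> x))"
        by (rule L2_diff(2)[OF l1 L2_add(1)[OF l2 l3]])
      also have "l2norm M (\<lambda>x. c * (B \<eta> x - A j \<eta> x) + (B \<zeta> x - A j \<zeta> x))
          \<le> l2norm M (\<lambda>x. c * (B \<eta> x - A j \<eta> x)) + l2norm M (\<lambda>x. B \<zeta> x - A j \<zeta> x)"
        by (rule L2_add(2)[OF l2 l3])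
      also have "l2norm M (\<lambda>x. c * (B \<eta> x - A j \<eta> x)) = cmod c * l2norm M (\<lambda>x. B \<eta> x - A j \<eta> x)"
        by (rule l2norm_scale)
      also have "l2norm M (\<lambda>x. B ?\<theta> x - A j ?\<theta> x) + (cmod c * l2norm M (\<lambda>x. B \<eta> x - A j \<eta> x) + l2norm M (\<lambda>x. B \<zeta> x - A j \<zeta> x))
        \<le> (K * l2norm M ?\<theta>) * r ^ j + (cmod c * ((K * l2norm M \<eta>) * r ^ j) + (K * l2norm M \<zeta>) * r ^ j)"
        by (intro add_mono mult_left_mono est T L) auto
      finally show ?thesis by (simp add: algebra_simps)
    qed
    from geometric_le_zero[OF this r] have "l2norm M ?D = 0" by (simp add: antisym)
    from l2norm_zero_AE[OF DL this] show "AE x in M. B ?\<theta> x = c * B \<eta> x + B \<zeta> x"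
      by eventually_elim simp
    assume eq: "AE x in M. \<eta> x = \<zeta> x"
    let ?F = "\<lambda>x. B \<eta> x - B \<zeta> x"
    have FL: "?F \<in> L2 M" by (intro L2_diff B L)
    have "l2norm M ?F \<le> (K * (l2norm M \<eta> + l2norm M \<zeta>)) * r ^ j" for j
    proof -
      let ?G = "\<lambda>x. (B \<eta> x - A j \<eta> x) - (B \<zeta> x - A j \<zeta> x)"
      have l1: "(\<lambda>x. B \<eta> x - A j \<eta> x) \<in> L2 M" by (intro L2_diff B L bop_L2[OF A L(1)])
      have l2: "(\<lambda>x. B \<zeta> x - A j \<zeta> x) \<in> L2 M" by (intro L2_diff B L bop_L2[OF A L(2)])
      have "AE x in M. ?F x = ?G x"
        using bop_cong[OF A L eq, of j] by eventually_elim simp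
      then have "l2norm M ?F = l2norm M ?G" by (rule l2norm_cong_AE[OF FL L2_diff(1)[OF l1 l2]])
      also have "\<dots> \<le> l2norm M (\<lambda>x. B \<eta> x - A j \<eta> x) + l2norm M (\<lambda>x. B \<zeta> x - A j \<zeta> x)"
        by (rule L2_diff(2)[OF l1 l2])
      also have "\<dots> \<le> (K * l2norm M \<eta>) * r ^ j + (K * l2norm M \<zeta>) * r ^ j"
        by (intro add_mono est L)
      finally show ?thesis by (simp add: algebra_simps)
    qed
    from geometric_le_zero[OF this r] have "l2norm M ?F = 0" by (simp add: antisym)
    from l2norm_zero_AE[OF FL this] show "AE x in M. B \<eta> x = B \<zeta> x"
      by eventually_elim simp
  qed (rule B)
  with near show ?thesis by blast
qed

definition zero_op :: op where "zero_op = (\<lambda>\<eta> x. 0)"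

lemma op_scale_one: "op_scale 1 A = A"
  by (simp add: op_scale_def)

lemma is_bop_zero: "is_bop M zero_op"
  using is_bop_diff[OF is_bop_id is_bop_id, of M] by (simp add: op_diff_def zero_op_def)

lemma adj_zero: "is_adj M zero_op zero_op"
  by (simp add: is_adj_def zero_op_def l2inner_def)

lemma adj_scale:
  "is_bop M A \<Longrightarrow> is_bop M A' \<Longrightarrow> is_adj M A A' \<Longrightarrow> is_adj M (op_scale c A) (op_scale (cnj c) A')"
  using adj_linear[OF _ is_bop_zero _ is_bop_zero _ adj_zero, of M A A' c]
  by (simp add: op_add_def op_scale_def zero_op_def)

lemma adj_add:
  "is_bop M A \<Longrightarrow> is_bop M B \<Longrightarrow> is_bop M A' \<Longrightarrow> is_bop M B' \<Longrightarrow> is_adj M A A' \<Longrightarrow> is_adj M B B' \<Longrightarrow>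
    is_adj M (op_add A B) (op_add A' B')"
  using adj_linear[of M A B A' B' 1] by (simp add: op_scale_one)

lemma adj_diff:
  "is_bop M A \<Longrightarrow> is_bop M B \<Longrightarrow> is_bop M A' \<Longrightarrow> is_bop M B' \<Longrightarrow> is_adj M A A' \<Longrightarrow> is_adj M B B' \<Longrightarrow>
    is_adj M (op_diff A B) (op_diff A' B')"
  using adj_linear[of M B A B' A' "-1"] by (simp add: op_diff_def op_add_def op_scale_def)

lemma adj_cong:
  assumes "is_adj M A B" "op_eq M B B'" "is_bop M A" "is_bop M B" "is_bop M B'"
  shows "is_adj M A B'"
  unfolding is_adj_def
proof (intro ballI)
  fix \<eta> \<zeta> assume L: "\<eta> \<in> L2 M" "\<zeta> \<in> L2 M"
  have "l2inner M (A \<eta>) \<zeta> = l2inner M \<eta> (B \<zeta>)" using assms(1) L unfolding is_adj_def by blast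
  also have "\<dots> = l2inner M \<eta> (B' \<zeta>)"
    using assms(2) L by (intro l2inner_cong_AE[OF L(1) L(1) bop_L2[OF assms(4) L(2)] bop_L2[OF assms(5) L(2)]]) (auto simp: op_eq_def)
  finally show "l2inner M (A \<eta>) \<zeta> = l2inner M \<eta> (B' \<zeta>)" .
qed

text \<open>The square root arguments use nothing about the shift, only an algebra of operators that
  contains the identity, the adjoints of its members and all norm limits. Members are
  representatives, so relations between them hold up to \<open>op_eq\<close>.\<close>

locale op_cstar =
  fixes M :: "pt measure" and U :: "op set"
  assumes prob: "prob_space M"
    and U_bop: "A \<in> U \<Longrightarrow> is_bop M A"
    and U_lin: "A \<in> U \<Longrightarrow> B \<in> U \<Longrightarrow> op_add (op_scale c A) B \<in> U"
    and U_comp: "A \<in> U \<Longrightarrow> B \<in> U \<Longrightarrow> A \<circ> B \<in> U"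
    and U_id: "id \<in> U"
    and U_adj: "A \<in> U \<Longrightarrow> op_adj M A \<in> U"
    and U_is_adj: "A \<in> U \<Longrightarrow> is_adj M A (op_adj M A)"
    and U_closed: "is_bop M A \<Longrightarrow> (\<And>e. 0 < e \<Longrightarrow> \<exists>B\<in>U. opb M (op_diff A B) e) \<Longrightarrow> A \<in> U"
begin

lemma U_zero: "zero_op \<in> U"
  using U_lin[OF U_id U_id, of "-1"] by (simp add: zero_op_def op_add_def op_scale_def)

lemma U_scale: "A \<in> U \<Longrightarrow> op_scale c A \<in> U"
  using U_lin[OF _ U_zero, of A c] by (simp add: zero_op_def op_add_def op_scale_def)

lemma U_add: "A \<in> U \<Longrightarrow> B \<in> U \<Longrightarrow> op_add A B \<in> U"
  using U_lin[of A B 1] by (simp add: op_scale_one)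

lemma U_diff: "A \<in> U \<Longrightarrow> B \<in> U \<Longrightarrow> op_diff A B \<in> U"
  unfolding op_diff_alt by (intro U_add U_scale)

text \<open>The root is \<open>1 - y\<close> for the fixed point \<open>y\<close> of \<open>y \<mapsto> (c + y\<^sup>2) / 2\<close>, a contraction on the ball of
  radius \<open>1 - sqrt (1 - s)\<close>.\<close>
lemma sqrt_exists:
  assumes c: "c \<in> U" "is_adj M c c" "opb M c s" and s: "0 \<le> s" "s < 1"
  shows "\<exists>d\<in>U. is_adj M d d \<and> op_eq M (d \<circ> d) (op_diff id c)"
proof -
  define r where "r = 1 - sqrt (1 - s)"
  have r: "0 \<le> r" "r < 1" using s by (auto simp: r_def)
  \<comment> \<open>\<open>r\<close> is the smaller root of \<open>(s + r * r) / 2 = r\<close>: the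
    iteration keeps the ball of radius r and has Lipschitz constant r on it.\<close>
  have "(1 - r)\<^sup>2 = 1 - s" using s by (simp add: r_def)
  then have rs: "1/2 * s + 1/2 * (r * r) = r" by (simp add: power2_eq_square algebra_simps)
  define F where "F y = op_add (op_scale (1/2) c) (op_scale (1/2) (y \<circ> y))" for y :: op
  define y where "y n = (F ^^ n) zero_op" for n
  have y0: "y 0 = zero_op" and ySuc: "y (Suc n) = F (y n)" for n by (auto simp: y_def)
  have FU: "F z \<in> U" if "z \<in> U" for z unfolding F_def by (intro U_add U_scale U_comp c that)
  have yU: "y n \<in> U" for n by (induction n) (auto simp: y0 ySuc U_zero FU)
  have bop: "is_bop M (y n)" for n by (rule U_bop[OF yU])
  have F_adj: "is_adj M (F z) (F z)" if "z \<in> U" "is_adj M z z" for z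
  proof -
    note b = U_bop[OF c(1)] U_bop[OF that(1)]
    have "is_adj M (op_scale (1/2) c) (op_scale (cnj (1/2)) c)" by (intro adj_scale b c)
    moreover have "is_adj M (op_scale (1/2) (z \<circ> z)) (op_scale (cnj (1/2)) (z \<circ> z))"
      by (intro adj_scale adj_comp is_bop_comp b that)
    ultimately show ?thesis unfolding F_def
      by (intro adj_add is_bop_scale is_bop_comp b) (auto simp: complex_cnj_divide)
  qed
  have y_adj: "is_adj M (y n) (y n)" for n
    by (induction n) (auto simp: y0 ySuc adj_zero F_adj yU)
  have y_opb: "opb M (y n) r" for n
  proof (induction n)
    case 0
    show ?case using r by (simp add: y0 opb_def zero_op_def l2norm_def)
  next
    case (Suc n)
    have "opb M (y (Suc n)) (cmod (1/2) * s + cmod (1/2) * (r * r))"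
      unfolding ySuc F_def
      by (intro opb_add opb_scale opb_comp is_bop_scale is_bop_comp bop U_bop[OF c(1)] c(3) Suc r)
    then show ?case using rs by (simp add: norm_divide)
  qed
  have F_diff: "opb M (op_diff (F z) (F z')) (1/2 * (a * e + e * b))"
    if "z \<in> U" "z' \<in> U" "opb M z a" "opb M z' b" "0 \<le> a" "0 \<le> e" "opb M (op_diff z z') e" for z z' a b e
  proof -
    have "op_diff (F z) (F z') = op_scale (1/2) (op_diff (z \<circ> z) (z' \<circ> z'))"
      by (simp add: fun_eq_iff F_def op_diff_def op_add_def op_scale_def algebra_simps)
    moreover have "opb M (op_diff (z \<circ> z) (z' \<circ> z')) (a * e + e * b)"
      using that by (intro opb_comp_diff U_bop)
    ultimately show ?thesis using opb_scale[of M "op_diff (z \<circ> z) (z' \<circ> z')" _ "1/2"] by (simp add: norm_divide)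
  qed
  have y_diff: "opb M (op_diff (y (Suc n)) (y n)) (r * r ^ n)" for n
  proof (induction n)
    case 0
    have "op_diff (y (Suc 0)) (y 0) = y (Suc 0)" by (simp add: y0 op_diff_def zero_op_def)
    then show ?case using y_opb[of "Suc 0"] by simp
  next
    case (Suc n)
    have "opb M (op_diff (F (y (Suc n))) (F (y n))) (1/2 * (r * (r * r ^ n) + (r * r ^ n) * r))"
      using r by (intro F_diff yU y_opb Suc) auto
    then show ?case by (simp add: ySuc[of "Suc n"] ySuc[of n, symmetric] algebra_simps)
  qed
  from op_complete[OF prob bop r r(1) y_diff] obtain B where B: "is_bop M B"
    and nr: "\<And>n. opb M (op_diff B (y n)) (r * r ^ n / (1 - r))" by blast
  define K where "K = r / (1 - r)"
  have K: "0 \<le> K" using r by (simp add: K_def)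
  have near: "opb M (op_diff B (y n)) (K * r ^ n)" for n using nr[of n] by (simp add: K_def)
  have BU: "B \<in> U"
  proof (rule U_closed[OF B])
    fix e :: real assume "0 < e"
    then obtain n where "K * r ^ n < e" using geometric_less r by blast
    then show "\<exists>z\<in>U. opb M (op_diff B z) e" using yU opb_mono[OF near] less_imp_le by blast
  qed
  have B_adj: "is_adj M B B"
  proof (rule adj_approx[OF B B])
    fix e :: real assume "0 < e"
    then obtain n where "K * r ^ n < e" using geometric_less r by blast
    then have "opb M (op_diff B (y n)) e" using opb_mono[OF near] less_imp_le by blast
    then show "\<exists>A' B'. is_bop M A' \<and> is_bop M B' \<and> is_adj M A' B' \<and> opb M (op_diff B A') e \<and> opb M (op_diff B B') e"
      using bop y_adj by blast
  qed
  obtain b where b: "0 \<le> b" "opb M B b" using bop_opb[OF B] .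
  have fixpt: "op_eq M B (F B)"
  proof (rule op_eqI_opb[OF B U_bop[OF FU[OF BU]]])
    fix e :: real assume e: "0 < e"
    obtain n where n: "(K + 1/2 * (r * K + K * b)) * r ^ n < e" using geometric_less[OF e] r by blast
    have "opb M (op_diff B (F B)) (K * r ^ Suc n + 1/2 * (r * (K * r ^ n) + (K * r ^ n) * b))"
    proof (rule opb_triangle[OF B bop U_bop[OF FU[OF BU]] near])
      show "opb M (op_diff (y (Suc n)) (F B)) (1/2 * (r * (K * r ^ n) + (K * r ^ n) * b))"
        unfolding ySuc using r K by (intro F_diff yU BU y_opb b opb_diff_commute[OF near]) auto
    qed
    moreover have "K * r ^ Suc n \<le> K * r ^ n" using r K by (intro mult_left_mono power_decreasing) auto
    then have "K * r ^ Suc n + 1/2 * (r * (K * r ^ n) + (K * r ^ n) * b) \<le> e"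
      using n by (simp add: algebra_simps)
    ultimately show "opb M (op_diff B (F B)) e" by (rule opb_mono)
  qed
  let ?d = "op_diff id B"
  have "?d \<in> U" by (intro U_diff U_id BU)
  moreover have "is_adj M ?d ?d" by (intro adj_diff is_bop_id B adj_id B_adj)
  \<comment> \<open>The fixed point satisfies 2 B = c + B B, so (1 - B)(1 - B) = 1 - 2 B + B B
    collapses to 1 - c.\<close>
  moreover have "op_eq M (?d \<circ> ?d) (op_diff id c)"
    unfolding op_eq_def
  proof
    fix \<eta> assume L: "\<eta> \<in> L2 M"
    have "AE x in M. B \<eta> x = F B \<eta> x" using fixpt L by (simp add: op_eq_def)
    then show "AE x in M. (?d \<circ> ?d) \<eta> x = op_diff id c \<eta> x"
      using bop_minus[OF B L bop_L2[OF B L]]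
      by eventually_elim (simp add: F_def op_diff_def op_add_def op_scale_def algebra_simps)
  qed
  ultimately show ?thesis by blast
qed

section \<open>States and *-homomorphisms of an operator algebra\<close>

definition state_on :: "(op \<Rightarrow> complex) \<Rightarrow> bool" where
  "state_on \<psi> \<longleftrightarrow>
     (\<forall>A\<in>U. \<forall>B\<in>U. op_eq M A B \<longrightarrow> \<psi> A = \<psi> B) \<and>
     (\<forall>A\<in>U. \<forall>B\<in>U. \<forall>c. \<psi> (op_add (op_scale c A) B) = c * \<psi> A + \<psi> B) \<and>
     (\<forall>A\<in>U. Im (\<psi> (op_adj M A \<circ> A)) = 0 \<and> Re (\<psi> (op_adj M A \<circ> A)) \<ge> 0) \<and>
     \<psi> id = 1"

text \<open>Purely algebraic conditions; the norm estimate is a consequence, see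
  \<open>hom_contractive\<close>.\<close>

definition star_hom :: "(op \<Rightarrow> op) \<Rightarrow> bool" where
  "star_hom \<tau> \<longleftrightarrow>
     (\<forall>A\<in>U. \<tau> A \<in> U) \<and>
     (\<forall>A\<in>U. \<forall>B\<in>U. op_eq M A B \<longrightarrow> op_eq M (\<tau> A) (\<tau> B)) \<and>
     (\<forall>A\<in>U. \<forall>B\<in>U. \<forall>c. op_eq M (\<tau> (op_add (op_scale c A) B)) (op_add (op_scale c (\<tau> A)) (\<tau> B))) \<and>
     (\<forall>A\<in>U. \<forall>B\<in>U. op_eq M (\<tau> (A \<circ> B)) (\<tau> A \<circ> \<tau> B)) \<and>
     (\<forall>A\<in>U. op_eq M (\<tau> (op_adj M A)) (op_adj M (\<tau> A))) \<and>
     op_eq M (\<tau> id) id"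

lemma state_cong: "state_on \<psi> \<Longrightarrow> A \<in> U \<Longrightarrow> B \<in> U \<Longrightarrow> op_eq M A B \<Longrightarrow> \<psi> A = \<psi> B"
  and state_lin: "state_on \<psi> \<Longrightarrow> A \<in> U \<Longrightarrow> B \<in> U \<Longrightarrow> \<psi> (op_add (op_scale c A) B) = c * \<psi> A + \<psi> B"
  and state_pos: "state_on \<psi> \<Longrightarrow> A \<in> U \<Longrightarrow> Im (\<psi> (op_adj M A \<circ> A)) = 0 \<and> 0 \<le> Re (\<psi> (op_adj M A \<circ> A))"
  and state_one: "state_on \<psi> \<Longrightarrow> \<psi> id = 1"
  unfolding state_on_def by blast+

lemma hom_U: "star_hom \<tau> \<Longrightarrow> A \<in> U \<Longrightarrow> \<tau> A \<in> U"
  and hom_cong: "star_hom \<tau> \<Longrightarrow> A \<in> U \<Longrightarrow> B \<in> U \<Longrightarrow> op_eq M A B \<Longrightarrow> op_eq M (\<tau> A) (\<tau> B)"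
  and hom_lin: "star_hom \<tau> \<Longrightarrow> A \<in> U \<Longrightarrow> B \<in> U \<Longrightarrow>
      op_eq M (\<tau> (op_add (op_scale c A) B)) (op_add (op_scale c (\<tau> A)) (\<tau> B))"
  and hom_mult: "star_hom \<tau> \<Longrightarrow> A \<in> U \<Longrightarrow> B \<in> U \<Longrightarrow> op_eq M (\<tau> (A \<circ> B)) (\<tau> A \<circ> \<tau> B)"
  and hom_star: "star_hom \<tau> \<Longrightarrow> A \<in> U \<Longrightarrow> op_eq M (\<tau> (op_adj M A)) (op_adj M (\<tau> A))"
  and hom_one: "star_hom \<tau> \<Longrightarrow> op_eq M (\<tau> id) id"
  unfolding star_hom_def by blast+

text \<open>For self-adjoint g of norm below 1 the element 1 - g is the square of a self-adjoint d,
  and positivity yields that \<open>\<psi> g\<close> is real and at most 1. Taking g to be both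
  multiples of h by plus and minus \<open>1 / (s + e)\<close> bounds \<open>\<psi> h\<close> from
  both sides.\<close>

lemma state_bound_selfadj:
  assumes st: "state_on \<psi>"
    and h: "h \<in> U" "is_adj M h h" "opb M h s" and s: "0 \<le> s"
  shows "cmod (\<psi> h) \<le> s"
proof -
  note cong = state_cong[OF st] and lin = state_lin[OF st] and pos = state_pos[OF st] and one = state_one[OF st]
  have unit: "Im (\<psi> g) = 0 \<and> Re (\<psi> g) \<le> 1" if g: "g \<in> U" "is_adj M g g" "opb M g t" "0 \<le> t" "t < 1" for g t
  proof -
    obtain d where d: "d \<in> U" "is_adj M d d" "op_eq M (d \<circ> d) (op_diff id g)"
      using sqrt_exists[OF g] by blast
    have "op_eq M (op_adj M d) d" by (intro op_adj_eq U_bop d)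
    then have "op_eq M (op_adj M d \<circ> d) (d \<circ> d)"
      by (intro op_eq_comp U_bop U_adj d op_eq_refl)
    then have "op_eq M (op_adj M d \<circ> d) (op_diff id g)" using d(3) op_eq_trans by blast
    then have "\<psi> (op_adj M d \<circ> d) = \<psi> (op_diff id g)"
      by (intro cong U_comp U_adj U_diff U_id d g)
    also have "op_diff id g = op_add (op_scale (-1) g) id" by (simp add: op_diff_def op_add_def op_scale_def)
    also have "\<psi> \<dots> = 1 - \<psi> g" using lin[OF g(1) U_id, of "-1"] one by simp
    finally have e: "\<psi> (op_adj M d \<circ> d) = 1 - \<psi> g" .
    show ?thesis using pos[OF d(1)] unfolding e by simp
  qed
  have scale: "\<psi> (op_scale c h) = c * \<psi> h" for c
  proof -
    have z: "\<psi> zero_op = 0"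
      using lin[OF U_id U_id, of "-1"] by (simp add: zero_op_def op_add_def op_scale_def)
    show ?thesis using lin[OF h(1) U_zero, of c] z by (simp add: zero_op_def op_add_def op_scale_def)
  qed
  have "cmod (\<psi> h) \<le> s + e" if e: "0 < e" for e
  proof -
    have t: "Im (\<psi> h) * u = 0 \<and> Re (\<psi> h) * u \<le> 1" if u: "\<bar>u\<bar> = 1 / (s + e)" for u
    proof -
      have "is_adj M (op_scale (of_real u) h) (op_scale (cnj (of_real u)) h)"
        by (intro adj_scale U_bop h)
      moreover have "opb M (op_scale (of_real u) h) (cmod (of_real u) * s)" by (intro opb_scale h)
      moreover have "cmod (of_real u) * s < 1" using s e by (simp add: u)
      ultimately show ?thesis
        using unit[of "op_scale (of_real u) h" "cmod (of_real u) * s"] U_scale[OF h(1)] s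
        by (simp add: scale ac_simps)
    qed
    have "\<bar>1 / (s + e)\<bar> = 1 / (s + e)" "\<bar>- (1 / (s + e))\<bar> = 1 / (s + e)" using s e by auto
    from t[OF this(1)] t[OF this(2)] have "Im (\<psi> h) = 0" "\<bar>Re (\<psi> h)\<bar> \<le> s + e"
      using s e by (auto simp: field_simps abs_le_iff)
    then show ?thesis by (simp add: cmod_eq_Re)
  qed
  then show ?thesis by (rule field_le_epsilon)
qed

text \<open>The factor 2 is the price of splitting A into real and imaginary parts, each of norm at
  most s. It reappears in the constants of the uniqueness proof.\<close>

lemma state_bound:
  assumes st: "state_on \<psi>"
    and A: "A \<in> U" "opb M A s" and s: "0 \<le> s"
  shows "cmod (\<psi> A) \<le> 2 * s"
proof -
  note lin = state_lin[OF st]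
  let ?A' = "op_adj M A"
  note b = U_bop[OF A(1)] U_bop[OF U_adj[OF A(1)]]
  note adj = U_is_adj[OF A(1)]
  note ob = A(2) adj_opb[OF b adj A(2)]
  define h1 where "h1 = op_scale (1/2) (op_add A ?A')"
  define h2 where "h2 = op_scale (- \<i> / 2) (op_diff A ?A')"
  have U: "h1 \<in> U" "h2 \<in> U" unfolding h1_def h2_def by (intro U_scale U_add U_diff U_adj A)+
  have o1: "opb M h1 s" using opb_scale[OF opb_add[OF b ob], of "1/2"] by (simp add: h1_def norm_divide)
  have o2: "opb M h2 s" using opb_scale[OF opb_diff[OF b ob], of "- \<i> / 2"] by (simp add: h2_def norm_divide)
  have "is_adj M (op_add A ?A') (op_add ?A' A)" by (intro adj_add b adj adj_sym[OF adj])
  moreover have "op_add ?A' A = op_add A ?A'" by (simp add: op_add_def add.commute)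
  ultimately have a1: "is_adj M h1 h1"
    using adj_scale[OF is_bop_add[OF b] is_bop_add[OF b], of "1/2"] by (simp add: h1_def)
  have "is_adj M (op_diff A ?A') (op_diff ?A' A)" by (intro adj_diff b adj adj_sym[OF adj])
  from adj_scale[OF is_bop_diff[OF b] is_bop_diff[OF b(2,1)] this, of "- \<i> / 2"]
  have "is_adj M h2 (op_scale (\<i> / 2) (op_diff ?A' A))" by (simp add: h2_def)
  moreover have "op_scale (\<i> / 2) (op_diff ?A' A) = h2"
    by (simp add: fun_eq_iff h2_def op_diff_def op_scale_def algebra_simps)
  ultimately have a2: "is_adj M h2 h2" by simp
  have "A = op_add (op_scale \<i> h2) h1"
    by (simp add: fun_eq_iff h1_def h2_def op_add_def op_scale_def op_diff_def field_simps)
  then have "\<psi> A = \<i> * \<psi> h2 + \<psi> h1" using lin[OF U(2,1), of \<i>] by simp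
  then have "cmod (\<psi> A) \<le> cmod (\<psi> h2) + cmod (\<psi> h1)"
    using norm_triangle_ineq[of "\<i> * \<psi> h2" "\<psi> h1"] by (simp add: norm_mult)
  also have "\<dots> \<le> s + s"
    by (rule add_mono[OF state_bound_selfadj[OF st U(2) a2 o2 s]
          state_bound_selfadj[OF st U(1) a1 o1 s]])
  finally show ?thesis by simp
qed

text \<open>If A has norm below 1, then 1 - A* A = d d with d self-adjoint, and applying the
  homomorphism shows that the squared norm of \<open>\<eta>\<close> minus that of
  \<open>\<tau> A \<eta>\<close> is the squared norm of \<open>\<tau> d \<eta>\<close>. Scaling by
  \<open>1 / t\<close> needs the strict gap between s and t for the square root to exist.\<close>

lemma hom_contractive:
  assumes hom: "star_hom \<tau>"
    and A: "A \<in> U" "opb M A s" and s: "0 \<le> s" "s < t"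
  shows "opb M (\<tau> A) t"
proof -
  note U = hom_U[OF hom] and cong = hom_cong[OF hom] and lin = hom_lin[OF hom]
    and mult = hom_mult[OF hom] and star = hom_star[OF hom] and one = hom_one[OF hom]
  have unit: "opb M (\<tau> A) 1" if A: "A \<in> U" "opb M A s" and s: "0 \<le> s" "s < 1" for A s
  proof -
    let ?A' = "op_adj M A"
    let ?c = "?A' \<circ> A"
    note b = U_bop[OF A(1)] U_bop[OF U_adj[OF A(1)]]
    note adj = U_is_adj[OF A(1)]
    have cU: "?c \<in> U" by (intro U_comp U_adj A)
    have "is_adj M ?c ?c" by (intro adj_comp b adj adj_sym[OF adj])
    moreover have "opb M ?c (s * s)" by (intro opb_comp b A(2) adj_opb[OF b adj A(2)] s)
    moreover have "0 \<le> s * s" using s by simp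
    moreover have "s * s < 1" using mult_strict_mono[of s 1 s 1] s by (cases "s = 0") auto
    ultimately obtain d where d: "d \<in> U" "is_adj M d d" "op_eq M (d \<circ> d) (op_diff id ?c)"
      using sqrt_exists[OF cU] by blast
    note \<tau>b = U_bop[OF U[OF A(1)]] U_bop[OF U[OF d(1)]] U_bop[OF U[OF cU]]
    have eq1: "op_eq M (op_adj M (\<tau> A) \<circ> \<tau> A) (\<tau> ?c)"
    proof (rule op_eq_sym, rule op_eq_trans[OF mult[OF U_adj[OF A(1)] A(1)]])
      show "op_eq M (\<tau> ?A' \<circ> \<tau> A) (op_adj M (\<tau> A) \<circ> \<tau> A)"
        by (intro op_eq_comp U_bop U U_adj star A op_eq_refl)
    qed
    have eq2: "op_eq M (\<tau> d \<circ> \<tau> d) (op_diff id (\<tau> ?c))"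
    proof -
      have i: "op_diff id ?c = op_add (op_scale (-1) ?c) id"
        by (simp add: op_diff_def op_add_def op_scale_def)
      have j: "op_add (op_scale (-1) (\<tau> ?c)) id = op_diff id (\<tau> ?c)"
        by (simp add: op_diff_def op_add_def op_scale_def)
      have "op_eq M (\<tau> (op_diff id ?c)) (op_diff id (\<tau> ?c))"
        unfolding i j[symmetric]
        by (rule op_eq_trans[OF lin[OF cU U_id] op_eq_add[OF op_eq_refl one]])
      moreover have "op_eq M (\<tau> (d \<circ> d)) (\<tau> (op_diff id ?c))"
        by (intro cong U_comp U_diff U_id d cU U_adj A)
      ultimately show ?thesis
        using op_eq_trans[OF op_eq_trans[OF op_eq_sym[OF mult[OF d(1) d(1)]]]] by blast
    qed
    have d_adj: "is_adj M (\<tau> d) (\<tau> d)"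
    proof (rule adj_cong[OF U_is_adj[OF U[OF d(1)]]])
      have "op_eq M (\<tau> (op_adj M d)) (\<tau> d)"
        by (intro cong U_adj d op_adj_eq U_bop)
      then show "op_eq M (op_adj M (\<tau> d)) (\<tau> d)"
        using op_eq_trans[OF op_eq_sym[OF star[OF d(1)]]] by blast
    qed (intro U_bop U U_adj d)+
    show ?thesis
      unfolding opb_def
    proof
      fix \<eta> assume L: "\<eta> \<in> L2 M"
      note \<tau>L = bop_L2[OF \<tau>b(1) L] bop_L2[OF \<tau>b(2) L] bop_L2[OF \<tau>b(3) L]
      have adjL: "op_adj M (\<tau> A) (\<tau> A \<eta>) \<in> L2 M" by (rule bop_L2[OF U_bop[OF U_adj[OF U[OF A(1)]]] \<tau>L(1)])
      have "l2inner M (\<tau> A \<eta>) (\<tau> A \<eta>) = l2inner M \<eta> (op_adj M (\<tau> A) (\<tau> A \<eta>))"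
        using U_is_adj[OF U[OF A(1)]] L \<tau>L(1) unfolding is_adj_def by blast
      also have "\<dots> = l2inner M \<eta> (\<tau> ?c \<eta>)"
        using eq1 L by (intro l2inner_cong_AE[OF L L adjL \<tau>L(3)]) (auto simp: op_eq_def)
      finally have "l2inner M \<eta> \<eta> - l2inner M (\<tau> A \<eta>) (\<tau> A \<eta>) = l2inner M \<eta> (op_diff id (\<tau> ?c) \<eta>)"
        unfolding op_diff_def by (simp add: l2inner_diff_right[OF L \<tau>L(3) L])
      also have "\<dots> = l2inner M \<eta> (\<tau> d (\<tau> d \<eta>))"
        using op_eq_sym[OF eq2] L
        by (intro l2inner_cong_AE[OF L L bop_L2[OF is_bop_diff[OF is_bop_id \<tau>b(3)] L] bop_L2[OF \<tau>b(2) \<tau>L(2)]])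
           (auto simp: op_eq_def)
      also have "\<dots> = l2inner M (\<tau> d \<eta>) (\<tau> d \<eta>)"
        by (rule bspec[OF bspec[OF d_adj[unfolded is_adj_def] L] \<tau>L(2), symmetric])
      finally have "(l2norm M \<eta>)\<^sup>2 - (l2norm M (\<tau> A \<eta>))\<^sup>2 = (l2norm M (\<tau> d \<eta>))\<^sup>2"
        unfolding l2inner_self of_real_diff[symmetric] of_real_eq_iff .
      then have "(l2norm M (\<tau> A \<eta>))\<^sup>2 \<le> (l2norm M \<eta>)\<^sup>2"
        using zero_le_power2[of "l2norm M (\<tau> d \<eta>)"] by linarith
      then show "l2norm M (\<tau> A \<eta>) \<le> 1 * l2norm M \<eta>"
        unfolding mult_1 by (rule power2_le_imp_le) simp
    qed
  qed
  let ?c = "complex_of_real (1 / t)"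
  have t: "0 < t" using s by linarith
  have zero: "op_eq M (\<tau> zero_op) zero_op"
    using lin[OF U_id U_id, of "-1"] by (simp add: zero_op_def op_add_def op_scale_def)
  have i: "op_scale ?c A = op_add (op_scale ?c A) zero_op"
    by (simp add: op_add_def zero_op_def)
  have eq: "op_eq M (\<tau> (op_scale ?c A)) (op_scale ?c (\<tau> A))"
  proof -
    have j: "op_add (op_scale ?c (\<tau> A)) zero_op = op_scale ?c (\<tau> A)"
      by (simp add: op_add_def zero_op_def)
    have "op_eq M (\<tau> (op_add (op_scale ?c A) zero_op)) (op_add (op_scale ?c (\<tau> A)) zero_op)"
      by (rule op_eq_trans[OF lin[OF A(1) U_zero] op_eq_add[OF op_eq_refl zero]])
    then show ?thesis unfolding i[symmetric] j .
  qed
  have "opb M (op_scale ?c A) (cmod ?c * s)" by (intro opb_scale A)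
  moreover have "cmod ?c * s < 1" using s t by (simp add: norm_divide)
  ultimately have "opb M (\<tau> (op_scale ?c A)) 1" using U_scale[OF A(1)] s by (intro unit) auto
  from opb_op_eq[OF U_bop[OF U[OF U_scale[OF A(1)]]] is_bop_scale[OF U_bop[OF U[OF A(1)]]] eq this]
  have "opb M (op_scale ?c (\<tau> A)) 1" .
  from opb_scale[OF this, of "of_real t"] show ?thesis using t by (simp add: op_scale_def)
qed

end

section \<open>Quasi-invariance of the reference measure\<close>

locale gibbs = full_shift +
  fixes p :: "pt \<Rightarrow> real" and \<mu> :: "pt measure"
  assumes p_pos: "\<forall>x\<in>X. p x > 0"
    and p_cont: "continuous_on X p"
    and p_norm: "\<forall>x\<in>X. (\<Sum>z\<in>preim k x. p z) = 1"
    and mu_prob: "prob_space \<mu>"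
    and mu_sets: "sets \<mu> = sets (restrict_space borel X)"
    and mu_inv: "\<forall>f::pt \<Rightarrow> complex. continuous_on X f \<longrightarrow> (\<integral>x. Lp k p f x \<partial>\<mu>) = (\<integral>x. f x \<partial>\<mu>)"
begin

text \<open>The reciprocal of \<open>lambda_n\<close>. By normalization of \<open>p\<close> these
  numbers are the probabilities of the points in a fibre of \<open>T^n\<close>.\<close>

definition weight :: "nat \<Rightarrow> pt \<Rightarrow> real" where
  "weight n x = (\<Prod>j<n. p ((shiftT ^^ j) x))"

lemma lambda_n_weight: "lambda_n p n x = 1 / weight n x"
  by (simp add: lambda_n_def weight_def prod_dividef)

lemma weight_pos: "x \<in> X \<Longrightarrow> 0 < weight n x"
  unfolding weight_def using p_pos shift_in by (intro prod_pos) auto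

lemma continuous_weight: "continuous_on X (weight n)"
proof -
  have "continuous_on X (\<lambda>x. p ((shiftT ^^ j) x))" for j
    by (rule continuous_on_compose2[OF p_cont]) (auto intro: shift_in continuous_on_shift)
  then show ?thesis unfolding weight_def by (intro continuous_on_prod)
qed

lemma space_mu: "space \<mu> = X"
  using sets_eq_imp_space_eq[OF mu_sets] by (simp add: space_restrict_space)

lemma continuous_measurable:
  fixes f :: "pt \<Rightarrow> 'a::topological_space"
  assumes "continuous_on X f" shows "f \<in> borel_measurable \<mu>"
  using borel_measurable_continuous_on_restrict[OF assms] measurable_cong_sets[OF mu_sets refl] by blast

lemma glue_measurable: "w \<in> X \<Longrightarrow> glue n w \<in> measurable \<mu> \<mu>"
proof -
  assume w: "w \<in> X"
  have "continuous_on X (\<lambda>x. glue n w x)" by (intro continuous_on_glue continuous_on_const continuous_on_id)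
  from borel_measurable_continuous_on_restrict[OF this]
  have "glue n w \<in> measurable (restrict_space borel X) (restrict_space borel X)"
    using w by (intro measurable_restrict_space2) (auto simp: space_restrict_space glue_in)
  then show ?thesis using measurable_cong_sets[OF mu_sets mu_sets] by blast
qed

lemma continuous_integrable:
  fixes f :: "pt \<Rightarrow> 'a::{banach, second_countable_topology}"
  assumes "continuous_on X f" shows "integrable \<mu> f"
proof -
  interpret prob_space \<mu> by (rule mu_prob)
  obtain B where "\<And>x. x \<in> X \<Longrightarrow> norm (f x) \<le> B" using bounded_X[OF assms] by blast
  then show ?thesis
    by (intro integrable_const_bound[of _ B] continuous_measurable assms) (auto simp: space_mu)
qed

lemma Lp_iterate:
  "x \<in> X \<Longrightarrow> (Lp k p ^^ n) \<eta> x = (\<Sum>z | z \<in> X \<and> (shiftT ^^ n) z = x. of_real (weight n z) * \<eta> z)"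
  using iterate_transfer[of "Lp k p" "\<lambda>z. complex_of_real (p z)" x n \<eta>]
  by (simp add: Lp_def weight_def)

text \<open>The action of \<open>e_op k p n\<close> at points of \<open>X\<close>: conditional
  expectation given \<open>T^n x\<close>.\<close>

definition transfer :: "nat \<Rightarrow> vec \<Rightarrow> vec" where
  "transfer n \<eta> x = (\<Sum>y\<in>tail n x. of_real (weight n y) * \<eta> y)"

lemma Lp_shift: "x \<in> X \<Longrightarrow> (Lp k p ^^ n) \<eta> ((shiftT ^^ n) x) = transfer n \<eta> x"
  by (simp add: Lp_iterate shift_in shift_fiber transfer_def)

lemma Sop_iterate: "(Sop ^^ n) \<eta> x = \<eta> ((shiftT ^^ n) x)"
  by (induction n arbitrary: x) (simp_all add: Sop_def funpow_swap1)

lemma e_op_transfer: "x \<in> X \<Longrightarrow> e_op k p n \<eta> x = transfer n \<eta> x"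
  by (simp add: e_op_def Sop_iterate Lp_shift)

lemma continuous_transfer: "continuous_on X f \<Longrightarrow> continuous_on X (transfer n f)"
  unfolding transfer_def by (intro continuous_tail_sum continuous_intros continuous_weight)

text \<open>A continuous right inverse of \<open>T^n\<close>; it pulls facts about functions of the
  form h(T^n x), such as \<open>transfer n f\<close>, back to the iterate \<open>Lp k p ^^ n\<close>
  itself.\<close>

definition pad :: "nat \<Rightarrow> pt \<Rightarrow> pt" where
  "pad n x = (\<lambda>i. if i < n then 1 else x (i - n))"

lemma X_k: "x \<in> X \<Longrightarrow> 1 \<le> k"
  by (fastforce simp: shift_space_def dest: spec[of _ 0])

lemma pad_in: "x \<in> X \<Longrightarrow> pad n x \<in> X"
  using X_k by (auto simp: pad_def shift_space_def)

lemma shift_pad: "(shiftT ^^ n) (pad n x) = x"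
  by (simp add: shiftT_iterate pad_def)

lemma continuous_pad: "continuous_on S (pad n)"
  unfolding pad_def
proof (rule continuous_on_coordinatewise_then_product)
  fix i show "continuous_on S (\<lambda>x. if i < n then 1 else x (i - n))"
    by (cases "i < n") (auto intro: continuous_on_product_then_coordinatewise continuous_on_id)
qed

lemma continuous_Lp_iterate:
  assumes "continuous_on X f" shows "continuous_on X ((Lp k p ^^ n) f)"
proof -
  have "continuous_on X (\<lambda>x. transfer n f (pad n x))"
    by (rule continuous_on_compose2[OF continuous_transfer[OF assms] continuous_pad]) (auto intro: pad_in)
  moreover have "transfer n f (pad n x) = (Lp k p ^^ n) f x" if "x \<in> X" for x
    using Lp_shift[OF pad_in[OF that], of n f n] by (simp add: shift_pad)
  ultimately show ?thesis by (rule continuous_on_eq)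
qed

text \<open>\<open>mu_inv\<close> handles the iterates of \<open>Lp\<close>. Shift invariance of
  \<open>\<mu>\<close> follows from it, since \<open>Lp\<close> maps g(T x) to g(x) by
  normalization, and the two together give the claim.\<close>

lemma integral_transfer_continuous:
  assumes f: "continuous_on X f"
  shows "(\<integral>x. transfer n f x \<partial>\<mu>) = (\<integral>x. f x \<partial>\<mu>)"
proof -
  have L: "(\<integral>x. (Lp k p ^^ n) f x \<partial>\<mu>) = (\<integral>x. f x \<partial>\<mu>)" for n
    by (induction n) (use mu_inv continuous_Lp_iterate[OF f] in auto)
  have T1: "(\<integral>x. g (shiftT x) \<partial>\<mu>) = (\<integral>x. g x \<partial>\<mu>)" if g: "continuous_on X g" for g :: vec
  proof -
    have "continuous_on X (\<lambda>x. g ((shiftT ^^ 1) x))"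
      by (rule continuous_on_compose2[OF g]) (auto intro: shift_in continuous_on_shift simp del: funpow.simps)
    then have "(\<integral>x. Lp k p (\<lambda>x. g (shiftT x)) x \<partial>\<mu>) = (\<integral>x. g (shiftT x) \<partial>\<mu>)"
      using mu_inv by simp
    moreover have "Lp k p (\<lambda>x. g (shiftT x)) x = g x" if "x \<in> X" for x
    proof -
      have "Lp k p (\<lambda>x. g (shiftT x)) x = (\<Sum>z\<in>preim k x. of_real (p z) * g x)"
        unfolding Lp_def by (rule sum.cong) (auto simp: preim_def)
      also have "\<dots> = of_real (\<Sum>z\<in>preim k x. p z) * g x" by (simp add: sum_distrib_right)
      finally show ?thesis using p_norm that by simp
    qed
    then have "(\<integral>x. Lp k p (\<lambda>x. g (shiftT x)) x \<partial>\<mu>) = (\<integral>x. g x \<partial>\<mu>)"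
      by (intro Bochner_Integration.integral_cong refl) (auto simp: space_mu)
    ultimately show ?thesis by simp
  qed
  have T: "(\<integral>x. g ((shiftT ^^ n) x) \<partial>\<mu>) = (\<integral>x. g x \<partial>\<mu>)" if g: "continuous_on X g" for g :: vec and n
  proof (induction n)
    case (Suc n)
    have "continuous_on X (\<lambda>x. g ((shiftT ^^ n) x))"
      by (rule continuous_on_compose2[OF g]) (auto intro: shift_in continuous_on_shift)
    from T1[OF this] Suc show ?case by (simp add: funpow_swap1)
  qed simp
  have "(\<integral>x. transfer n f x \<partial>\<mu>) = (\<integral>x. (Lp k p ^^ n) f ((shiftT ^^ n) x) \<partial>\<mu>)"
    by (intro Bochner_Integration.integral_cong refl) (auto simp: space_mu Lp_shift)
  then show ?thesis using T[OF continuous_Lp_iterate[OF f]] L by simp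
qed

text \<open>The same averaging for nonnegative Borel functions. Indexing by words instead of tail
  classes makes measurability a matter of composing with \<open>glue\<close>.\<close>

definition nn_transfer :: "nat \<Rightarrow> (pt \<Rightarrow> ennreal) \<Rightarrow> pt \<Rightarrow> ennreal" where
  "nn_transfer n f x = (\<Sum>w\<in>wds n. ennreal (weight n (glue n w x)) * f (glue n w x))"

lemma weight_glue_measurable:
  "w \<in> X \<Longrightarrow> (\<lambda>x. ennreal (weight n (glue n w x))) \<in> borel_measurable \<mu>"
  by (rule measurable_compose[OF glue_measurable measurable_compose[OF continuous_measurable[OF continuous_weight] measurable_ennreal]])

lemma nn_transfer_measurable:
  assumes "f \<in> borel_measurable \<mu>" shows "nn_transfer n f \<in> borel_measurable \<mu>"
  unfolding nn_transfer_def[abs_def]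
  by (intro borel_measurable_sum borel_measurable_times_ennreal weight_glue_measurable
      measurable_compose[OF glue_measurable assms]) (auto intro: wds_in)

text \<open>A set fixed by finitely many coordinates is open and closed, so its indicator is
  continuous and the known case of the invariance applies.\<close>

lemma cylinder_integral:
  assumes J: "finite J" and C: "C = {x. \<forall>i\<in>J. x i \<in> (A i :: nat set)}"
  shows "(\<integral>\<^sup>+x. nn_transfer n (indicator C) x \<partial>\<mu>) = emeasure \<mu> (C \<inter> X)"
proof -
  interpret prob_space \<mu> by (rule mu_prob)
  have "continuous_on X (\<lambda>x. indicator C x :: real)"
  proof (rule continuous_on_agreeI)
    fix x and e :: real assume "0 < e"
    have same: "(indicator C y :: real) = indicator C x" if "\<forall>i<Suc (Max (insert 0 J)). y i = x i" for y
    proof -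
      have "y i = x i" if "i \<in> J" for i
      proof -
        have "i \<le> Max (insert 0 J)" using J that by (intro Max_ge) auto
        then show ?thesis using \<open>\<forall>i<Suc (Max (insert 0 J)). y i = x i\<close> by (meson le_imp_less_Suc)
      qed
      then show ?thesis unfolding C indicator_def by auto
    qed
    show "\<exists>m. \<forall>y\<in>X. (\<forall>i<m. y i = x i) \<longrightarrow> dist (indicator C y :: real) (indicator C x) < e"
    proof (intro exI ballI impI)
      fix y assume "\<forall>i<Suc (Max (insert 0 J)). y i = x i"
      from same[OF this] show "dist (indicator C y :: real) (indicator C x) < e"
        using \<open>0 < e\<close> by simp
    qed
  qed
  then have cR: "continuous_on X (\<lambda>x. indicator C x :: real)" .
  let ?t = "\<lambda>x. \<Sum>y\<in>tail n x. weight n y * indicator C y"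
  have ct: "continuous_on X ?t" by (intro continuous_tail_sum continuous_intros continuous_weight cR)
  have t0: "0 \<le> ?t x" if "x \<in> X" for x
    using weight_pos tail_in by (intro sum_nonneg mult_nonneg_nonneg) (auto intro: less_imp_le)
  have tt: "transfer n (\<lambda>x. of_real (indicator C x)) x = of_real (?t x)" for x
    by (simp add: transfer_def)
  have "continuous_on X (\<lambda>x. complex_of_real (indicator C x))" by (intro continuous_on_of_real cR)
  from integral_transfer_continuous[OF this, of n]
  have eq: "(\<integral>x. ?t x \<partial>\<mu>) = (\<integral>x. indicator C x \<partial>\<mu>)"
    unfolding tt integral_complex_of_real of_real_eq_iff .
  have "(\<integral>\<^sup>+x. nn_transfer n (indicator C) x \<partial>\<mu>) = (\<integral>\<^sup>+x. ennreal (?t x) \<partial>\<mu>)"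
  proof (rule nn_integral_cong)
    fix x assume "x \<in> space \<mu>"
    then have x: "x \<in> X" by (simp add: space_mu)
    have "nn_transfer n (indicator C) x = (\<Sum>w\<in>wds n. ennreal (weight n (glue n w x) * indicator C (glue n w x)))"
      unfolding nn_transfer_def
      using weight_pos[OF glue_in[OF wds_in x]] by (intro sum.cong refl) (auto simp: indicator_def)
    also have "\<dots> = ennreal (\<Sum>w\<in>wds n. weight n (glue n w x) * indicator C (glue n w x))"
      using weight_pos[OF glue_in[OF wds_in x]]
      by (intro sum_ennreal mult_nonneg_nonneg) (auto intro: less_imp_le)
    finally show "nn_transfer n (indicator C) x = ennreal (?t x)" by (simp add: sum_tail[OF x])
  qed
  also have "\<dots> = ennreal (\<integral>x. ?t x \<partial>\<mu>)"
    using t0 by (intro nn_integral_eq_integral continuous_integrable ct) (auto simp: space_mu)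
  also have "\<dots> = ennreal (\<integral>x. indicator C x \<partial>\<mu>)" unfolding eq ..
  also have "\<dots> = (\<integral>\<^sup>+x. ennreal (indicator C x) \<partial>\<mu>)"
    by (intro nn_integral_eq_integral[symmetric] continuous_integrable cR) auto
  also have "\<dots> = (\<integral>\<^sup>+x. indicator (C \<inter> X) x \<partial>\<mu>)"
    by (intro nn_integral_cong) (auto simp: space_mu indicator_def)
  also have "\<dots> = emeasure \<mu> (C \<inter> X)"
  proof (rule nn_integral_indicator)
    have "C = (\<Inter>i\<in>J. (\<lambda>x. x i) -` A i)" unfolding C by auto
    moreover have "open ((\<lambda>x::pt. x i) -` A i)" for i
      by (intro open_vimage continuous_on_product_coordinates) (rule discrete_topology_class.open_discrete)
    ultimately have "open C" using J by (auto intro!: open_INT)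
    then have "C \<in> sets borel" by (rule borel_open)
    then show "C \<inter> X \<in> sets \<mu>" unfolding mu_sets by (auto simp: sets_restrict_space)
  qed
  finally show ?thesis .
qed

text \<open>Both sides are measures in \<open>E\<close> that agree on cylinders, and the right one
  is finite. They are first moved from \<open>X\<close> to the whole of \<open>pt\<close>, where the
  Borel sets form the product sigma-algebra and cylinders determine a measure.\<close>

lemma set_integral_transfer:
  assumes E: "E \<in> sets \<mu>"
  shows "(\<integral>\<^sup>+x. nn_transfer n (indicator E) x \<partial>\<mu>) = emeasure \<mu> E"
proof -
  interpret prob_space \<mu> by (rule mu_prob)
  define P where "P = distr \<mu> borel (\<lambda>x. x)"
  define m where "m D = (\<integral>\<^sup>+x. nn_transfer n (indicator D) x \<partial>\<mu>)" for D
  define Q where "Q = measure_of UNIV (sets (borel :: pt measure)) m"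
  have idm: "(\<lambda>x. x) \<in> measurable \<mu> (borel :: pt measure)"
    by (rule continuous_measurable[OF continuous_on_id])
  have ind: "(indicator D :: pt \<Rightarrow> ennreal) \<in> borel_measurable \<mu>" if "D \<in> sets borel" for D
    using measurable_compose[OF idm borel_measurable_indicator[OF that]] by simp
  have sb: "sigma_algebra UNIV (sets (borel :: pt measure))"
    using sets.sigma_algebra_axioms[of "borel :: pt measure"] by simp
  have sQ: "sets Q = sets borel"
    unfolding Q_def using sigma_algebra.sigma_sets_eq[OF sb] by (subst sets_measure_of) auto
  have mQ: "emeasure Q D = m D" if D: "D \<in> sets borel" for D
    unfolding Q_def
  proof (rule emeasure_measure_of_sigma[OF sb _ _ D])
    show "positive (sets borel) m" by (simp add: positive_def m_def nn_transfer_def)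
    show "countably_additive (sets borel) m"
    proof (rule countably_additiveI)
      fix F :: "nat \<Rightarrow> pt set" assume F: "range F \<subseteq> sets borel" "disjoint_family F" "\<Union> (range F) \<in> sets borel"
      have "(\<Sum>i. m (F i)) = (\<integral>\<^sup>+x. (\<Sum>i. nn_transfer n (indicator (F i)) x) \<partial>\<mu>)"
        unfolding m_def using F by (intro nn_integral_suminf[symmetric] nn_transfer_measurable ind) auto
      also have "(\<lambda>x. \<Sum>i. nn_transfer n (indicator (F i)) x) = nn_transfer n (indicator (\<Union> (range F)))"
      proof
        fix x
        have "(\<Sum>i. nn_transfer n (indicator (F i)) x)
          = (\<Sum>w\<in>wds n. \<Sum>i. ennreal (weight n (glue n w x)) * indicator (F i) (glue n w x))"
          unfolding nn_transfer_def by (intro suminf_sum) auto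
        also have "\<dots> = nn_transfer n (indicator (\<Union> (range F))) x"
          unfolding nn_transfer_def by (simp add: suminf_indicator[OF F(2)])
        finally show "(\<Sum>i. nn_transfer n (indicator (F i)) x) = nn_transfer n (indicator (\<Union> (range F))) x" .
      qed
      finally show "(\<Sum>i. m (F i)) = m (\<Union> (range F))" by (simp add: m_def)
    qed
  qed
  have "P = Q"
  proof (rule measure_eqI_PiM_infinite)
    show "sets P = sets (Pi\<^sub>M UNIV (\<lambda>_::nat. borel :: nat measure))"
      by (simp add: P_def sets_PiM_equal_borel)
    show "sets Q = sets (Pi\<^sub>M UNIV (\<lambda>_::nat. borel :: nat measure))"
      by (simp add: sQ sets_PiM_equal_borel)
    show "finite_measure P" unfolding P_def by (rule finite_measure_distr[OF idm])
    fix A :: "nat \<Rightarrow> nat set" and J assume J: "finite J" and A: "\<And>i. i \<in> J \<Longrightarrow> A i \<in> sets borel"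
    let ?C = "prod_emb UNIV (\<lambda>_::nat. borel :: nat measure) J (Pi\<^sub>E J A)"
    have C: "?C = {x. \<forall>i\<in>J. x i \<in> A i}" by (auto simp: prod_emb_def PiE_def Pi_def extensional_def)
    have "?C \<in> sets (Pi\<^sub>M UNIV (\<lambda>_::nat. borel :: nat measure))"
      using J A by (intro sets_PiM_I) auto
    then have Cb: "?C \<in> sets borel" by (simp add: sets_PiM_equal_borel)
    have "emeasure P ?C = emeasure \<mu> (?C \<inter> X)"
      unfolding P_def by (subst emeasure_distr[OF idm Cb]) (simp add: space_mu)
    then show "emeasure P ?C = emeasure Q ?C"
      using cylinder_integral[OF J C, of n] mQ[OF Cb] by (simp add: m_def)
  qed
  moreover have Eb: "E \<in> sets borel" "E \<subseteq> X"
    using E X_borel unfolding mu_sets by (auto simp: sets_restrict_space)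
  ultimately have "m E = emeasure P E" using mQ by simp
  also have "\<dots> = emeasure \<mu> E"
    unfolding P_def using Eb by (subst emeasure_distr[OF idm]) (auto simp: space_mu Int_absorb2)
  finally show ?thesis by (simp add: m_def)
qed

lemma nn_integral_transfer:
  assumes "f \<in> borel_measurable \<mu>"
  shows "(\<integral>\<^sup>+x. nn_transfer n f x \<partial>\<mu>) = (\<integral>\<^sup>+x. f x \<partial>\<mu>)"
  using assms
proof (induction rule: borel_measurable_induct)
  case (cong f g)
  have "nn_transfer n f x = nn_transfer n g x" if "x \<in> X" for x
    unfolding nn_transfer_def using cong(3) that by (intro sum.cong refl) (auto simp: space_mu glue_in wds_in)
  then have "(\<integral>\<^sup>+x. nn_transfer n f x \<partial>\<mu>) = (\<integral>\<^sup>+x. nn_transfer n g x \<partial>\<mu>)"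
    by (intro nn_integral_cong) (simp add: space_mu)
  moreover have "(\<integral>\<^sup>+x. f x \<partial>\<mu>) = (\<integral>\<^sup>+x. g x \<partial>\<mu>)" using cong(3) by (intro nn_integral_cong) auto
  ultimately show ?case using cong by simp
next
  case (set A)
  then show ?case using set_integral_transfer by simp
next
  case (mult u c)
  have "nn_transfer n (\<lambda>x. c * u x) = (\<lambda>x. c * nn_transfer n u x)"
    by (simp add: fun_eq_iff nn_transfer_def sum_distrib_left ac_simps)
  then show ?case using mult by (simp add: nn_integral_cmult nn_transfer_measurable)
next
  case (add u v)
  have "nn_transfer n (\<lambda>x. v x + u x) = (\<lambda>x. nn_transfer n v x + nn_transfer n u x)"
    by (simp add: fun_eq_iff nn_transfer_def sum.distrib distrib_left)
  then show ?case using add by (simp add: nn_integral_add nn_transfer_measurable)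
next
  case (seq U)
  have mono: "mono (\<lambda>i. ennreal (weight n (glue n w x)) * U i (glue n w x))" for w x
    using \<open>incseq U\<close> by (intro monoI mult_left_mono) (auto simp: incseq_def le_fun_def)
  have "nn_transfer n (SUP i. U i) x = (SUP i. nn_transfer n (U i) x)" for x
  proof -
    have "nn_transfer n (SUP i. U i) x = (\<Sum>w\<in>wds n. SUP i. ennreal (weight n (glue n w x)) * U i (glue n w x))"
      by (simp add: nn_transfer_def SUP_mult_left_ennreal image_comp)
    also have "\<dots> = (SUP i. nn_transfer n (U i) x)"
      unfolding nn_transfer_def by (rule ennreal_SUP_sum[symmetric]) (rule mono)
    finally show ?thesis .
  qed
  then have "(\<integral>\<^sup>+x. nn_transfer n (SUP i. U i) x \<partial>\<mu>) = (\<integral>\<^sup>+x. (SUP i. nn_transfer n (U i) x) \<partial>\<mu>)"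
    by simp
  also have "\<dots> = (SUP i. \<integral>\<^sup>+x. nn_transfer n (U i) x \<partial>\<mu>)"
  proof (rule nn_integral_monotone_convergence_SUP)
    show "incseq (\<lambda>i. nn_transfer n (U i))"
      using mono unfolding nn_transfer_def[abs_def] mono_def le_fun_def by (auto intro!: sum_mono)
  qed (rule nn_transfer_measurable[OF seq(1)])
  also have "\<dots> = (SUP i. \<integral>\<^sup>+x. U i x \<partial>\<mu>)" using seq.IH by simp
  also have "\<dots> = (\<integral>\<^sup>+x. (SUP i. U i x) \<partial>\<mu>)"
    by (rule nn_integral_monotone_convergence_SUP[symmetric]) (use seq in auto)
  also have "\<dots> = (\<integral>\<^sup>+x. (SUP i. U i) x \<partial>\<mu>)" by (simp add: image_comp)
  finally show ?case .
qed

end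

section \<open>Kernel operators\<close>

context gibbs
begin

text \<open>Integrability of the averaged function is part of the claim, so the nonnegative case
  goes through \<open>nn_integral_transfer\<close>, and real and complex functions are split into
  nonnegative pieces.\<close>

lemma has_bochner_integral_transfer:
  fixes f :: vec
  assumes f: "integrable \<mu> f"
  shows "has_bochner_integral \<mu> (transfer n f) (\<integral>x. f x \<partial>\<mu>)"
proof -
  let ?E = "\<lambda>f x. \<Sum>w\<in>wds n. weight n (glue n w x) * f (glue n w x) :: real"
  have nonneg: "has_bochner_integral \<mu> (?E f) (\<integral>x. f x \<partial>\<mu>)" if f: "integrable \<mu> f" "\<And>x. 0 \<le> f x" for f
  proof (rule has_bochner_integral_nn_integral)
    have fm: "f \<in> borel_measurable \<mu>" using f by auto
    show "?E f \<in> borel_measurable \<mu>"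
      by (intro borel_measurable_sum borel_measurable_times
          measurable_compose[OF glue_measurable continuous_measurable[OF continuous_weight]]
          measurable_compose[OF glue_measurable fm]) (auto intro: wds_in)
    have w0: "0 \<le> weight n (glue n w x) * f (glue n w x)" if "x \<in> X" "w \<in> wds n" for w x
      using f(2) weight_pos[OF glue_in[OF wds_in]] that by (intro mult_nonneg_nonneg) (auto intro: less_imp_le)
    show "AE x in \<mu>. 0 \<le> ?E f x" using w0 by (intro AE_I2 sum_nonneg) (simp add: space_mu)
    show "0 \<le> (\<integral>x. f x \<partial>\<mu>)" using f by (intro integral_nonneg_AE) auto
    have "(\<integral>\<^sup>+x. ennreal (?E f x) \<partial>\<mu>) = (\<integral>\<^sup>+x. nn_transfer n (\<lambda>x. ennreal (f x)) x \<partial>\<mu>)"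
    proof (rule nn_integral_cong)
      fix x assume "x \<in> space \<mu>"
      then have x: "x \<in> X" by (simp add: space_mu)
      have "nn_transfer n (\<lambda>x. ennreal (f x)) x = (\<Sum>w\<in>wds n. ennreal (weight n (glue n w x) * f (glue n w x)))"
        unfolding nn_transfer_def
        using weight_pos[OF glue_in[OF wds_in x]] f(2) by (intro sum.cong refl) (auto simp: ennreal_mult'' )
      then show "ennreal (?E f x) = nn_transfer n (\<lambda>x. ennreal (f x)) x"
        using sum_ennreal[of "wds n" "\<lambda>w. weight n (glue n w x) * f (glue n w x)"] w0[OF x] by simp
    qed
    also have "\<dots> = (\<integral>\<^sup>+x. ennreal (f x) \<partial>\<mu>)" by (rule nn_integral_transfer) (use fm in simp)
    also have "\<dots> = ennreal (\<integral>x. f x \<partial>\<mu>)" using f by (intro nn_integral_eq_integral) auto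
    finally show "(\<integral>\<^sup>+x. ennreal (?E f x) \<partial>\<mu>) = ennreal (\<integral>x. f x \<partial>\<mu>)" .
  qed
  have real: "has_bochner_integral \<mu> (?E f) (\<integral>x. f x \<partial>\<mu>)" if f: "integrable \<mu> f" for f
  proof -
    let ?f1 = "\<lambda>x. max (f x) 0" and ?f2 = "\<lambda>x. max (- f x) 0"
    have i: "integrable \<mu> ?f1" "integrable \<mu> ?f2" using f by auto
    have "has_bochner_integral \<mu> (\<lambda>x. ?E ?f1 x - ?E ?f2 x) ((\<integral>x. ?f1 x \<partial>\<mu>) - (\<integral>x. ?f2 x \<partial>\<mu>))"
      by (intro has_bochner_integral_diff nonneg i) auto
    also have "(\<lambda>x. ?E ?f1 x - ?E ?f2 x) = ?E f"
      by (auto simp: fun_eq_iff sum_subtractf[symmetric] right_diff_distrib[symmetric] max_def intro!: sum.cong)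
    also have "(\<integral>x. ?f1 x \<partial>\<mu>) - (\<integral>x. ?f2 x \<partial>\<mu>) = (\<integral>x. ?f1 x - ?f2 x \<partial>\<mu>)" using i by simp
    also have "(\<lambda>x. ?f1 x - ?f2 x) = f" by (auto simp: max_def)
    finally show ?thesis .
  qed
  have "has_bochner_integral \<mu> (\<lambda>x. of_real (?E (\<lambda>x. Re (f x)) x) + \<i> * of_real (?E (\<lambda>x. Im (f x)) x))
      (of_real (\<integral>x. Re (f x) \<partial>\<mu>) + \<i> * of_real (\<integral>x. Im (f x) \<partial>\<mu>))"
    using f by (intro has_bochner_integral_add has_bochner_integral_mult_right has_bochner_integral_of_real real) auto
  also have "of_real (\<integral>x. Re (f x) \<partial>\<mu>) + \<i> * of_real (\<integral>x. Im (f x) \<partial>\<mu>) = (\<integral>x. f x \<partial>\<mu>)"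
    using f by (intro complex_eqI) auto
  finally have "has_bochner_integral \<mu> (\<lambda>x. of_real (?E (\<lambda>x. Re (f x)) x) + \<i> * of_real (?E (\<lambda>x. Im (f x)) x)) (\<integral>x. f x \<partial>\<mu>)" .
  moreover have "of_real (?E (\<lambda>x. Re (f x)) x) + \<i> * of_real (?E (\<lambda>x. Im (f x)) x) = transfer n f x"
    if "x \<in> X" for x
    unfolding transfer_def sum_tail[OF that] by (intro complex_eqI) auto
  ultimately show ?thesis
    by (subst has_bochner_integral_cong[OF refl _ refl, symmetric]) (auto simp: space_mu)
qed

text \<open>Averaging preserves integrals, and both integrands have the same average. This expresses
  the quasi-invariance of \<open>\<mu>\<close> under the tail relation.\<close>

lemma integral_transfer_swap:
  assumes G: "integrable \<mu> (\<lambda>x. \<Sum>y\<in>tail n x. of_real (weight n y) * F x y)"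
    and G': "integrable \<mu> (\<lambda>y. \<Sum>x\<in>tail n y. of_real (weight n x) * (F x y :: complex))"
  shows "(\<integral>x. (\<Sum>y\<in>tail n x. of_real (weight n y) * F x y) \<partial>\<mu>)
    = (\<integral>y. (\<Sum>x\<in>tail n y. of_real (weight n x) * F x y) \<partial>\<mu>)" (is "(\<integral>x. ?G x \<partial>\<mu>) = (\<integral>y. ?G' y \<partial>\<mu>)")
proof -
  have "transfer n ?G x = transfer n ?G' x" for x
  proof -
    have "transfer n ?G x = (\<Sum>x'\<in>tail n x. \<Sum>y\<in>tail n x'. of_real (weight n x') * of_real (weight n y) * F x' y)"
      by (simp add: transfer_def sum_distrib_left mult.assoc)
    also have "\<dots> = (\<Sum>y\<in>tail n x. \<Sum>x'\<in>tail n y. of_real (weight n x') * of_real (weight n y) * F x' y)"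
      by (rule sum_tail_swap) simp
    also have "\<dots> = transfer n ?G' x"
      by (simp add: transfer_def sum_distrib_left ac_simps)
    finally show ?thesis .
  qed
  then have eq: "transfer n ?G = transfer n ?G'" by blast
  show ?thesis
    by (rule has_bochner_integral_eq[OF has_bochner_integral_transfer[OF G, of n, unfolded eq]
          has_bochner_integral_transfer[OF G', of n]])
qed

text \<open>Elements of the dense subalgebra are integral operators over the relation
  \<open>T\<^sup>n x = T\<^sup>n y\<close>; a kernel vanishes off the relation, so that it does not depend on the chosen \<open>n\<close>.\<close>
definition kern :: "nat \<Rightarrow> (pt \<Rightarrow> pt \<Rightarrow> complex) \<Rightarrow> bool" where
  "kern n a \<longleftrightarrow> (\<forall>x y. (x, y) \<notin> tail_rel n \<longrightarrow> a x y = 0) \<and>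
     continuous_on (tail_rel n) (\<lambda>z. a (fst z) (snd z))"

definition Kop :: "nat \<Rightarrow> (pt \<Rightarrow> pt \<Rightarrow> complex) \<Rightarrow> op" where
  "Kop n a \<eta> x = (\<Sum>y\<in>tail n x. a x y * \<eta> y)"

definition on_rel :: "nat \<Rightarrow> (pt \<Rightarrow> pt \<Rightarrow> complex) \<Rightarrow> pt \<Rightarrow> pt \<Rightarrow> complex" where
  "on_rel n \<phi> x y = (if (x, y) \<in> tail_rel n then \<phi> x y else 0)"

lemma kern_on_rel:
  assumes "continuous_on (tail_rel n) (\<lambda>z. \<phi> (fst z) (snd z))" shows "kern n (on_rel n \<phi>)"
  unfolding kern_def
proof (intro conjI allI impI)
  show "continuous_on (tail_rel n) (\<lambda>z. on_rel n \<phi> (fst z) (snd z))"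
    by (rule continuous_on_eq[OF assms]) (auto simp: on_rel_def)
qed (simp add: on_rel_def)

lemma kern_zero: "kern n a \<Longrightarrow> (x, y) \<notin> tail_rel n \<Longrightarrow> a x y = 0"
  by (simp add: kern_def)

lemma kern_cont: "kern n a \<Longrightarrow> continuous_on (tail_rel n) (\<lambda>z. a (fst z) (snd z))"
  by (simp add: kern_def)

text \<open>A continuous image of \<open>X \<times> X\<close>: a pair keeps x, and y is replaced by
  x with the first n letters of y.\<close>

lemma compact_tail_rel: "compact (tail_rel n)"
proof -
  have "tail_rel n = (\<lambda>z. (fst z, glue n (snd z) (fst z))) ` (X \<times> X)"
  proof
    show "tail_rel n \<subseteq> (\<lambda>z. (fst z, glue n (snd z) (fst z))) ` (X \<times> X)"
    proof (rule subrelI)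
      fix x y assume xy: "(x, y) \<in> tail_rel n"
      then have "y = glue n y x" by (auto simp: tail_rel_def glue_def)
      then show "(x, y) \<in> (\<lambda>z. (fst z, glue n (snd z) (fst z))) ` (X \<times> X)"
        using xy by (intro image_eqI[of _ _ "(x, y)"]) (auto simp: tail_rel_def)
    qed
  qed (auto intro: glue_tail_rel)
  moreover have c: "continuous_on (X \<times> X) (\<lambda>z. (fst z, glue n (snd z) (fst z)))"
    by (intro continuous_on_Pair continuous_on_glue continuous_on_fst continuous_on_snd continuous_on_id)
  ultimately show ?thesis
    using compact_continuous_image[OF c compact_Times[OF compact_X compact_X]] by simp
qed

lemma kern_bounded:
  assumes "kern n a" obtains B where "0 < B" "\<And>x y. cmod (a x y) \<le> B"
proof -
  have "bounded ((\<lambda>z. a (fst z) (snd z)) ` tail_rel n)"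
    by (intro compact_imp_bounded compact_continuous_image kern_cont assms compact_tail_rel)
  then obtain B where B: "0 < B" "\<forall>z\<in>tail_rel n. cmod (a (fst z) (snd z)) \<le> B"
    by (auto simp: bounded_pos)
  have "cmod (a x y) \<le> B" for x y
    using B kern_zero[OF assms, of x y] by (cases "(x, y) \<in> tail_rel n") force+
  with B(1) show thesis by (rule that)
qed

lemma kern_compose:
  assumes "kern n a" "continuous_on S f" "continuous_on S g" "\<And>x. x \<in> S \<Longrightarrow> (f x, g x) \<in> tail_rel n"
  shows "continuous_on S (\<lambda>x. a (f x) (g x))"
  using continuous_on_compose2[OF kern_cont[OF assms(1)] continuous_on_Pair[OF assms(2,3)]] assms(4)
  by (auto simp: image_subset_iff)

lemma kern_glue:
  assumes "kern n a" "w \<in> X" shows "continuous_on X (\<lambda>x. a x (glue n w x))"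
  using assms
  by (intro kern_compose[where a = a and f = "\<lambda>x. x" and g = "glue n w"])
     (auto intro: glue_tail_rel continuous_on_glue[where f = "\<lambda>_. w"] continuous_on_const continuous_on_id)

lemma kern_diag:
  assumes "kern n a" shows "continuous_on X (\<lambda>x. a x x)"
  using assms by (intro kern_compose[where a = a and f = "\<lambda>x. x" and g = "\<lambda>x. x"])
    (auto intro: continuous_on_id simp: tail_rel_iff tail_refl)

text \<open>The relation of level n is open and closed in that of level m, being cut out by equality
  of the finitely many coordinates in between; extension by zero therefore remains
  continuous.\<close>

lemma kern_mono:
  assumes nm: "n \<le> m" and a: "kern n a" shows "kern m a"
  unfolding kern_def
proof (intro conjI allI impI)
  show "a x y = 0" if "(x, y) \<notin> tail_rel m" for x y
    using that tail_rel_mono[OF nm] kern_zero[OF a] by blast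
  let ?D = "{z :: pt \<times> pt. \<exists>i\<in>{n..<m}. fst z i \<noteq> snd z i}"
  have cl: "closed {z :: pt \<times> pt. fst z i \<noteq> snd z i}" and op: "open {z :: pt \<times> pt. fst z i \<noteq> snd z i}" for i
  proof -
    have eq: "{z :: pt \<times> pt. fst z i \<noteq> snd z i} = (\<lambda>z. (fst z i, snd z i)) -` {(u, v). u \<noteq> v}" by auto
    have c: "continuous_on UNIV (\<lambda>z :: pt \<times> pt. (fst z i, snd z i))"
      by (rule continuous_on_Pair[OF
            continuous_on_product_then_coordinatewise[OF continuous_on_fst[OF continuous_on_id]]
            continuous_on_product_then_coordinatewise[OF continuous_on_snd[OF continuous_on_id]]])
    have o: "open S" for S :: "(nat \<times> nat) set"
    proof -
      have "open (\<Union>z\<in>S. {fst z} \<times> {snd z})"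
        by (intro open_UN ballI open_Times discrete_topology_class.open_discrete)
      moreover have "(\<Union>z\<in>S. {fst z} \<times> {snd z}) = S" by force
      ultimately show ?thesis by simp
    qed
    have "closed S" for S :: "(nat \<times> nat) set" unfolding closed_def by (rule o)
    then show "closed {z :: pt \<times> pt. fst z i \<noteq> snd z i}" unfolding eq by (rule closed_vimage[OF _ c])
    show "open {z :: pt \<times> pt. fst z i \<noteq> snd z i}" unfolding eq by (rule open_vimage[OF o c])
  qed
  have D: "?D = (\<Union>i\<in>{n..<m}. {z. fst z i \<noteq> snd z i})" by auto
  have cD: "closed ?D" unfolding D by (rule closed_UN) (auto intro: cl)
  have oD: "open ?D" unfolding D by (intro open_UN op ballI)
  have "(\<forall>i\<ge>n. y i = x i) \<longleftrightarrow> (\<forall>i\<ge>m. y i = x i) \<and> (\<forall>i\<in>{n..<m}. x i = y i)" for x y :: pt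
    using nm by (auto simp: Ball_def) (metis not_le)
  then have dec: "tail_rel n = tail_rel m - ?D" by (auto simp: tail_rel_def)
  then have dec2: "tail_rel m = tail_rel n \<union> (tail_rel m \<inter> ?D)" by blast
  have "tail_rel n = tail_rel m \<inter> - ?D" using dec by blast
  then have clo: "closedin (top_of_set (tail_rel m)) (tail_rel n)"
    using closedin_closed_Int[of "- ?D" "tail_rel m"] oD by (simp add: closed_def)
  have clo2: "closedin (top_of_set (tail_rel m)) (tail_rel m \<inter> ?D)"
    by (rule closedin_closed_Int[OF cD])
  have "continuous_on (tail_rel n \<union> (tail_rel m \<inter> ?D)) (\<lambda>z. a (fst z) (snd z))"
  proof (rule continuous_on_Un_local)
    show "continuous_on (tail_rel m \<inter> ?D) (\<lambda>z. a (fst z) (snd z))"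
    proof (rule continuous_on_eq[OF continuous_on_const[of _ 0]])
      fix z assume "z \<in> tail_rel m \<inter> ?D"
      then have "z \<notin> tail_rel n" using dec by blast
      then show "0 = a (fst z) (snd z)" using kern_zero[OF a] by simp
    qed
  qed (use clo clo2 kern_cont[OF a] dec2[symmetric] in simp_all)
  then show "continuous_on (tail_rel m) (\<lambda>z. a (fst z) (snd z))" using dec2[symmetric] by simp
qed

lemma Kop_mono:
  assumes "n \<le> m" "kern n a" shows "Kop m a = Kop n a"
proof (intro ext)
  fix \<eta> x
  have "a x y = 0" if "y \<in> tail m x - tail n x" for y
    using that kern_zero[OF assms(2), of x y] by (auto simp: tail_rel_iff)
  then show "Kop m a \<eta> x = Kop n a \<eta> x"
    unfolding Kop_def using tail_mono[OF assms(1)] finite_tail by (intro sum.mono_neutral_right) auto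
qed

text \<open>Convolution in the groupoid of the tail relation, that is, multiplication of matrices
  indexed by a tail class.\<close>

definition kmul :: "nat \<Rightarrow> (pt \<Rightarrow> pt \<Rightarrow> complex) \<Rightarrow> (pt \<Rightarrow> pt \<Rightarrow> complex) \<Rightarrow> pt \<Rightarrow> pt \<Rightarrow> complex" where
  "kmul n a b x z = (\<Sum>y\<in>tail n x. a x y * b y z)"

text \<open>The modular factor comes from \<open>\<mu>\<close> being quasi-invariant with cocycle \<open>weight n y / weight n x\<close>.\<close>
definition kadj :: "nat \<Rightarrow> (pt \<Rightarrow> pt \<Rightarrow> complex) \<Rightarrow> pt \<Rightarrow> pt \<Rightarrow> complex" where
  "kadj n a = on_rel n (\<lambda>x y. cnj (a y x) * of_real (weight n y / weight n x))"

section \<open>The *-algebra of kernels and its action on L2\<close>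

lemma kern_add_scale: "kern n a \<Longrightarrow> kern n b \<Longrightarrow> kern n (\<lambda>x y. c * a x y + b x y)"
  unfolding kern_def by (auto intro!: continuous_intros)

lemma kern_kmul:
  assumes a: "kern n a" and b: "kern n b" shows "kern n (kmul n a b)"
  unfolding kern_def
proof (intro conjI allI impI)
  show "kmul n a b x z = 0" if "(x, z) \<notin> tail_rel n" for x z
  proof -
    have "a x y * b y z = 0" if y: "y \<in> tail n x" for y
    proof (cases "x \<in> X \<and> (y, z) \<in> tail_rel n")
      case True
      then have "(x, z) \<in> tail_rel n" using tail_eq[OF y] by (auto simp: tail_rel_iff)
      with \<open>(x, z) \<notin> tail_rel n\<close> show ?thesis by simp
    next
      case False
      then show ?thesis using kern_zero[OF a, of x y] kern_zero[OF b, of y z] by (auto simp: tail_rel_iff)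
    qed
    then show ?thesis unfolding kmul_def by (intro sum.neutral ballI)
  qed
  have "continuous_on (tail_rel n) (\<lambda>z. \<Sum>w\<in>wds n. a (fst z) (glue n w (fst z)) * b (glue n w (fst z)) (snd z))"
  proof (intro continuous_on_sum continuous_on_mult)
    fix w assume "w \<in> wds n"
    then have w: "w \<in> X" by (rule wds_in)
    show "continuous_on (tail_rel n) (\<lambda>z. a (fst z) (glue n w (fst z)))"
    proof (intro kern_compose[OF a, where f = fst and g = "\<lambda>z. glue n w (fst z)"]
          continuous_on_fst continuous_on_glue continuous_on_const continuous_on_id)
      fix z assume "z \<in> tail_rel n"
      then have "fst z \<in> X" by (auto simp: tail_rel_def)
      then show "(fst z, glue n w (fst z)) \<in> tail_rel n" by (rule glue_tail_rel[OF w])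
    qed
    show "continuous_on (tail_rel n) (\<lambda>z. b (glue n w (fst z)) (snd z))"
    proof (intro kern_compose[OF b, where f = "\<lambda>z. glue n w (fst z)" and g = snd] continuous_on_fst continuous_on_snd continuous_on_glue continuous_on_const continuous_on_id)
      fix z assume "z \<in> tail_rel n"
      then have z: "fst z \<in> X" "snd z \<in> tail n (fst z)" by (cases z; simp add: tail_rel_iff)+
      then show "(glue n w (fst z), snd z) \<in> tail_rel n"
        using tail_eq[OF glue_in_tail[OF w z(1)]] glue_in[OF w z(1)] by (simp add: tail_rel_iff)
    qed
  qed
  then show "continuous_on (tail_rel n) (\<lambda>z. kmul n a b (fst z) (snd z))"
    by (rule continuous_on_eq) (auto simp: kmul_def tail_rel_iff sum_tail)
qed

lemma kern_kadj:
  assumes a: "kern n a" shows "kern n (kadj n a)"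
  unfolding kadj_def
proof (rule kern_on_rel, intro continuous_intros)
  have s: "(snd z, fst z) \<in> tail_rel n" if "z \<in> tail_rel n" for z
    using that by (auto simp: tail_rel_def)
  show "continuous_on (tail_rel n) (\<lambda>z. a (snd z) (fst z))"
    by (intro kern_compose[OF a, where f = snd and g = fst] continuous_on_fst continuous_on_snd continuous_on_id s)
  have X: "fst z \<in> X" "snd z \<in> X" if "z \<in> tail_rel n" for z
    using that by (auto simp: tail_rel_def)
  show "continuous_on (tail_rel n) (\<lambda>z. weight n (fst z))"
    using X by (intro continuous_on_compose2[OF continuous_weight] continuous_on_fst continuous_on_id) auto
  show "continuous_on (tail_rel n) (\<lambda>z. weight n (snd z))"
    using X by (intro continuous_on_compose2[OF continuous_weight] continuous_on_snd continuous_on_id) auto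
  show "\<forall>z\<in>tail_rel n. weight n (fst z) \<noteq> 0"
    using X weight_pos[of "fst _" n] by force
qed

lemma Kop_comp: "Kop n a \<circ> Kop n b = Kop n (kmul n a b)"
proof (intro ext)
  fix \<eta> x
  have "(Kop n a \<circ> Kop n b) \<eta> x = (\<Sum>y\<in>tail n x. \<Sum>z\<in>tail n y. a x y * (b y z * \<eta> z))"
    by (simp add: Kop_def sum_distrib_left)
  also have "\<dots> = (\<Sum>z\<in>tail n x. \<Sum>y\<in>tail n z. a x y * (b y z * \<eta> z))" by (rule sum_tail_swap) simp
  also have "\<dots> = Kop n (kmul n a b) \<eta> x"
    unfolding Kop_def kmul_def sum_distrib_right by (intro sum.cong refl) (auto simp: tail_eq ac_simps)
  finally show "(Kop n a \<circ> Kop n b) \<eta> x = Kop n (kmul n a b) \<eta> x" .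
qed

lemma Kop_add_scale: "op_add (op_scale c (Kop n a)) (Kop n b) = Kop n (\<lambda>x y. c * a x y + b x y)"
  by (simp add: fun_eq_iff op_add_def op_scale_def Kop_def sum.distrib sum_distrib_left algebra_simps)

lemma Kop_diff: "op_diff (Kop n a) (Kop n b) = Kop n (\<lambda>x y. a x y - b x y)"
  by (simp add: fun_eq_iff op_diff_def Kop_def sum_subtractf algebra_simps)

lemma Kop_linear: "Kop n a (\<lambda>y. c * \<eta> y + \<zeta> y) x = c * Kop n a \<eta> x + Kop n a \<zeta> x"
  by (simp add: Kop_def sum.distrib sum_distrib_left algebra_simps)

lemma Kop_measurable:
  assumes a: "kern n a" and e: "\<eta> \<in> borel_measurable \<mu>" shows "Kop n a \<eta> \<in> borel_measurable \<mu>"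
proof -
  have "(\<lambda>x. \<Sum>w\<in>wds n. a x (glue n w x) * \<eta> (glue n w x)) \<in> borel_measurable \<mu>"
    by (intro borel_measurable_sum borel_measurable_times continuous_measurable kern_glue[OF a]
        measurable_compose[OF glue_measurable e]) (auto intro: wds_in)
  then show ?thesis
    by (rule measurable_cong[THEN iffD1, rotated]) (simp add: Kop_def sum_tail space_mu)
qed

text \<open>Cauchy-Schwarz over the words, a lower bound for the weights, and preservation of
  integrals under averaging. The constant depends on the level alone, so uniform convergence of
  kernels of one level gives norm convergence of operators.\<close>

lemma Kop_bound:
  "\<exists>c>0. \<forall>a B. kern n a \<longrightarrow> 0 \<le> B \<longrightarrow> (\<forall>x y. cmod (a x y) \<le> B) \<longrightarrow>
      opb \<mu> (Kop n a) (c * B) \<and> (\<forall>\<eta>\<in>L2 \<mu>. Kop n a \<eta> \<in> L2 \<mu>)"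
proof -
  obtain d where d: "0 < d" "\<And>x. x \<in> X \<Longrightarrow> d \<le> weight n x"
    using positive_X[OF continuous_weight, of n] weight_pos by blast
  \<comment> \<open>Adding 1 keeps N positive even if there are no words.\<close>
  define N where "N = real (card (wds n)) + 1"
  define c where "c = sqrt (N / d)"
  have N: "0 < N" by (simp add: N_def add_nonneg_pos)
  have c0: "0 < c" using d N by (simp add: c_def)
  have c2: "c\<^sup>2 = N / d" using d N by (simp add: c_def)
  show ?thesis
  proof (intro exI[of _ c] conjI[OF c0] allI impI)
    fix a and B :: real assume a: "kern n a" and "0 \<le> B" and "\<forall>x y. cmod (a x y) \<le> B"
    then have B: "0 \<le> B" "\<And>x y. cmod (a x y) \<le> B" by auto
    have main: "Kop n a \<eta> \<in> L2 \<mu> \<and> l2norm \<mu> (Kop n a \<eta>) \<le> c * B * l2norm \<mu> \<eta>" if L: "\<eta> \<in> L2 \<mu>" for \<eta>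
    proof -
      note m = L2_measurable[OF L]
      let ?s = "\<lambda>x. ennreal ((cmod (\<eta> x))\<^sup>2)"
      have sm: "?s \<in> borel_measurable \<mu>" using m by simp
      have "(\<integral>\<^sup>+x. ennreal ((cmod (Kop n a \<eta> x))\<^sup>2) \<partial>\<mu>) \<le> (\<integral>\<^sup>+x. ennreal ((c * B)\<^sup>2) * nn_transfer n ?s x \<partial>\<mu>)"
      proof (rule nn_integral_mono)
        fix x assume "x \<in> space \<mu>"
        then have x: "x \<in> X" by (simp add: space_mu)
        let ?u = "\<lambda>w. weight n (glue n w x) * (cmod (\<eta> (glue n w x)))\<^sup>2"
        have g: "glue n w x \<in> X" if "w \<in> wds n" for w by (rule glue_in[OF wds_in[OF that] x])
        have u0: "0 \<le> ?u w" if "w \<in> wds n" for w using weight_pos[OF g[OF that]] by (intro mult_nonneg_nonneg) (auto intro: less_imp_le)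
        have "cmod (Kop n a \<eta> x) \<le> (\<Sum>w\<in>wds n. cmod (a x (glue n w x) * \<eta> (glue n w x)))"
          unfolding Kop_def sum_tail[OF x] by (rule norm_sum)
        also have "\<dots> \<le> (\<Sum>w\<in>wds n. B * cmod (\<eta> (glue n w x)))"
          unfolding norm_mult by (intro sum_mono mult_right_mono B) auto
        also have "\<dots> = B * (\<Sum>w\<in>wds n. cmod (\<eta> (glue n w x)))" by (simp add: sum_distrib_left)
        finally have "(cmod (Kop n a \<eta> x))\<^sup>2 \<le> (B * (\<Sum>w\<in>wds n. cmod (\<eta> (glue n w x))))\<^sup>2"
          by (intro power_mono) auto
        also have "\<dots> = B\<^sup>2 * (\<Sum>w\<in>wds n. cmod (\<eta> (glue n w x)))\<^sup>2" by (simp add: power_mult_distrib)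
        also have "\<dots> \<le> B\<^sup>2 * ((\<Sum>w\<in>wds n. (cmod (\<eta> (glue n w x)))\<^sup>2) * N)"
        proof (intro mult_left_mono)
          have "(\<Sum>w\<in>wds n. cmod (\<eta> (glue n w x)))\<^sup>2 \<le> (\<Sum>w\<in>wds n. (cmod (\<eta> (glue n w x)))\<^sup>2) * card (wds n)"
            by (rule sum_squared_le_sum_of_squares)
          also have "\<dots> \<le> (\<Sum>w\<in>wds n. (cmod (\<eta> (glue n w x)))\<^sup>2) * N"
            by (intro mult_left_mono sum_nonneg) (auto simp: N_def)
          finally show "(\<Sum>w\<in>wds n. cmod (\<eta> (glue n w x)))\<^sup>2 \<le> (\<Sum>w\<in>wds n. (cmod (\<eta> (glue n w x)))\<^sup>2) * N" .
        qed simp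
        also have "\<dots> \<le> B\<^sup>2 * ((\<Sum>w\<in>wds n. ?u w / d) * N)"
        proof (intro mult_left_mono mult_right_mono sum_mono)
          fix w assume w: "w \<in> wds n"
          have "d * (cmod (\<eta> (glue n w x)))\<^sup>2 \<le> ?u w" by (intro mult_right_mono d(2) g w) simp
          then show "(cmod (\<eta> (glue n w x)))\<^sup>2 \<le> ?u w / d" using d(1) by (simp add: field_simps)
        qed (use N in auto)
        also have "\<dots> = (c * B)\<^sup>2 * (\<Sum>w\<in>wds n. ?u w)"
          by (simp add: power_mult_distrib c2 sum_divide_distrib[symmetric])
        finally have "ennreal ((cmod (Kop n a \<eta> x))\<^sup>2) \<le> ennreal ((c * B)\<^sup>2 * (\<Sum>w\<in>wds n. ?u w))"
          by (rule ennreal_leI)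
        also have "\<dots> = ennreal ((c * B)\<^sup>2) * ennreal (\<Sum>w\<in>wds n. ?u w)" by (rule ennreal_mult') simp
        also have "ennreal (\<Sum>w\<in>wds n. ?u w) = (\<Sum>w\<in>wds n. ennreal (?u w))"
          using u0 by (intro sum_ennreal[symmetric])
        also have "\<dots> = nn_transfer n ?s x"
          unfolding nn_transfer_def by (intro sum.cong refl) (simp add: ennreal_mult'')
        finally show "ennreal ((cmod (Kop n a \<eta> x))\<^sup>2) \<le> ennreal ((c * B)\<^sup>2) * nn_transfer n ?s x" .
      qed
      also have "\<dots> = ennreal ((c * B)\<^sup>2) * (\<integral>\<^sup>+x. ?s x \<partial>\<mu>)"
        by (simp add: nn_integral_cmult nn_transfer_measurable[OF sm] nn_integral_transfer[OF sm])
      also have "\<dots> = ennreal ((c * B)\<^sup>2) * ennreal ((l2norm \<mu> \<eta>)\<^sup>2)" by (simp add: nn_l2norm[OF L])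
      also have "\<dots> = ennreal ((c * B * l2norm \<mu> \<eta>)\<^sup>2)" by (simp add: ennreal_mult'' power_mult_distrib)
      finally have le: "(\<integral>\<^sup>+x. ennreal ((cmod (Kop n a \<eta> x))\<^sup>2) \<partial>\<mu>) \<le> ennreal ((c * B * l2norm \<mu> \<eta>)\<^sup>2)" .
      have nn: "0 \<le> c * B * l2norm \<mu> \<eta>" using c0 B by simp
      show ?thesis using L2I[OF Kop_measurable[OF a m] nn le] by blast
    qed
    then show "opb \<mu> (Kop n a) (c * B) \<and> (\<forall>\<eta>\<in>L2 \<mu>. Kop n a \<eta> \<in> L2 \<mu>)" by (auto simp: opb_def)
  qed
qed

lemma is_bop_Kop:
  assumes a: "kern n a" shows "is_bop \<mu> (Kop n a)"
proof -
  obtain B where B: "0 < B" "\<And>x y. cmod (a x y) \<le> B" using kern_bounded[OF a] by blast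
  obtain c where "\<forall>a B. kern n a \<longrightarrow> 0 \<le> B \<longrightarrow> (\<forall>x y. cmod (a x y) \<le> B) \<longrightarrow>
      opb \<mu> (Kop n a) (c * B) \<and> (\<forall>\<eta>\<in>L2 \<mu>. Kop n a \<eta> \<in> L2 \<mu>)"
    using Kop_bound[of n] by blast
  from this[rule_format, OF a less_imp_le[OF B(1)] B(2)]
  have c: "opb \<mu> (Kop n a) (c * B)" "\<And>\<eta>. \<eta> \<in> L2 \<mu> \<Longrightarrow> Kop n a \<eta> \<in> L2 \<mu>" by auto
  show ?thesis
  proof (rule is_bopI[OF c(2) _ _ c(1)])
    fix \<eta> \<zeta> assume L: "\<eta> \<in> L2 \<mu>" "\<zeta> \<in> L2 \<mu>" and eq: "AE x in \<mu>. \<eta> x = \<zeta> x"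
    let ?d = "\<lambda>x. \<eta> x - \<zeta> x"
    have "l2norm \<mu> ?d = l2norm \<mu> (\<lambda>_. 0)"
      using eq by (intro l2norm_cong_AE L2_diff L L2_zero) auto
    then have "l2norm \<mu> (Kop n a ?d) \<le> 0" using opbD[OF c(1) L2_diff(1)[OF L]] by (simp add: l2norm_def)
    then have "l2norm \<mu> (Kop n a ?d) = 0" by (simp add: antisym)
    from l2norm_zero_AE[OF c(2)[OF L2_diff(1)[OF L]] this]
    show "AE x in \<mu>. Kop n a \<eta> x = Kop n a \<zeta> x"
      by eventually_elim (simp add: Kop_def right_diff_distrib sum_subtractf)
  qed (auto simp: Kop_linear)
qed

lemma is_adj_Kop:
  assumes a: "kern n a" shows "is_adj \<mu> (Kop n a) (Kop n (kadj n a))"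
  unfolding is_adj_def
proof (intro ballI)
  fix \<eta> \<zeta> assume L: "\<eta> \<in> L2 \<mu>" "\<zeta> \<in> L2 \<mu>"
  \<comment> \<open>Dividing by the weight of y brings the unweighted kernel sum into the form that
    \<open>integral_transfer_swap\<close> exchanges; afterwards the quotient of weights in
    \<open>kadj\<close> is left over.\<close>
  let ?F = "\<lambda>x y. a x y * \<eta> y * cnj (\<zeta> x) / of_real (weight n y)"
  have w: "weight n y \<noteq> 0" if "y \<in> X" for y using weight_pos[OF that, of n] by simp
  have 1: "(\<Sum>y\<in>tail n x. of_real (weight n y) * ?F x y) = Kop n a \<eta> x * cnj (\<zeta> x)" for x
    unfolding Kop_def sum_distrib_right by (intro sum.cong refl) (auto simp: w tail_in)
  have 2: "(\<Sum>x\<in>tail n y. of_real (weight n x) * ?F x y) = \<eta> y * cnj (Kop n (kadj n a) \<zeta> y)" if y: "y \<in> X" for y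
  proof -
    have "cnj (Kop n (kadj n a) \<zeta> y) = (\<Sum>x\<in>tail n y. a x y * of_real (weight n x / weight n y) * cnj (\<zeta> x))"
      unfolding Kop_def cnj_sum kadj_def on_rel_def using y by (intro sum.cong refl) (simp add: tail_rel_iff)
    then show ?thesis
      unfolding sum_distrib_left by (simp add: sum_distrib_left ac_simps)
  qed
  have i1: "integrable \<mu> (\<lambda>x. \<Sum>y\<in>tail n x. of_real (weight n y) * ?F x y)"
    unfolding 1 by (intro L2_mult_integrable bop_L2[OF is_bop_Kop[OF a]] L)
  have i2: "integrable \<mu> (\<lambda>y. \<Sum>x\<in>tail n y. of_real (weight n x) * ?F x y)"
  proof -
    have "integrable \<mu> (\<lambda>y. \<Sum>x\<in>tail n y. of_real (weight n x) * ?F x y) \<longleftrightarrow>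
        integrable \<mu> (\<lambda>y. \<eta> y * cnj (Kop n (kadj n a) \<zeta> y))"
      by (rule Bochner_Integration.integrable_cong[OF refl]) (simp only: space_mu 2)
    then show ?thesis
      using L2_mult_integrable(1)[OF L(1) bop_L2[OF is_bop_Kop[OF kern_kadj[OF a]] L(2)]] by blast
  qed
  have "l2inner \<mu> (Kop n a \<eta>) \<zeta> = (\<integral>y. (\<Sum>x\<in>tail n y. of_real (weight n x) * ?F x y) \<partial>\<mu>)"
    unfolding l2inner_def 1[symmetric] by (rule integral_transfer_swap[OF i1 i2])
  also have "\<dots> = l2inner \<mu> \<eta> (Kop n (kadj n a) \<zeta>)"
    unfolding l2inner_def by (intro Bochner_Integration.integral_cong refl) (simp only: 2 space_mu)
  finally show "l2inner \<mu> (Kop n a \<eta>) \<zeta> = l2inner \<mu> \<eta> (Kop n (kadj n a) \<zeta>)" .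
qed

end

section \<open>The C*-algebra\<close>

lemma l2norm_mono:
  assumes "\<eta> \<in> L2 M" "\<zeta> \<in> L2 M" "\<And>x. x \<in> space M \<Longrightarrow> cmod (\<eta> x) \<le> cmod (\<zeta> x)"
  shows "l2norm M \<eta> \<le> l2norm M \<zeta>"
  unfolding l2norm_def using assms
  by (intro real_sqrt_le_mono integral_mono power_mono) (auto simp: L2_def)

lemma adj_cong_left:
  assumes "is_adj M A B" "op_eq M A A'" "is_bop M A" "is_bop M A'" "is_bop M B"
  shows "is_adj M A' B"
  by (rule adj_sym[OF adj_cong[OF adj_sym[OF assms(1)] assms(2,5,3,4)]])

lemma L2_space_cong:
  assumes "\<zeta> \<in> L2 M" "\<And>x. x \<in> space M \<Longrightarrow> \<eta> x = \<zeta> x"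
  shows "\<eta> \<in> L2 M" "l2norm M \<eta> = l2norm M \<zeta>"
proof -
  have "\<eta> \<in> borel_measurable M \<longleftrightarrow> \<zeta> \<in> borel_measurable M"
    by (rule measurable_cong) (rule assms(2))
  moreover have "integrable M (\<lambda>x. (cmod (\<eta> x))\<^sup>2) \<longleftrightarrow> integrable M (\<lambda>x. (cmod (\<zeta> x))\<^sup>2)"
    by (rule Bochner_Integration.integrable_cong[OF refl]) (simp add: assms(2))
  ultimately show "\<eta> \<in> L2 M" using assms(1) by (simp add: L2_def)
  show "l2norm M \<eta> = l2norm M \<zeta>"
    unfolding l2norm_def by (intro arg_cong[of _ _ sqrt] Bochner_Integration.integral_cong refl) (simp add: assms(2))
qed

text \<open>Generators match their kernel operators only at points of \<open>X\<close>, which is all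
  of \<open>space \<mu>\<close>; boundedness and well-definedness are carried over from the kernel
  side.\<close>

lemma is_bop_space_cong:
  assumes B: "is_bop M B" and eq: "\<And>\<eta> x. x \<in> space M \<Longrightarrow> A \<eta> x = B \<eta> x"
  shows "is_bop M A" "op_eq M A B"
proof -
  have ae: "AE x in M. A \<eta> x = B \<eta> x" for \<eta> by (rule AE_I2) (rule eq)
  then show "op_eq M A B" by (simp add: op_eq_def)
  obtain c where c: "opb M B c" using bop_opb[OF B] by metis
  have c': "opb M A c"
    unfolding opb_def
  proof
    fix \<eta> assume L: "\<eta> \<in> L2 M"
    show "l2norm M (A \<eta>) \<le> c * l2norm M \<eta>"
      using L2_space_cong(2)[OF bop_L2[OF B L] eq] opbD[OF c L] by simp
  qed
  show "is_bop M A"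
  proof (rule is_bopI[OF _ _ _ c'])
    fix \<eta> \<zeta> and d :: complex assume L: "\<eta> \<in> L2 M"
    show "A \<eta> \<in> L2 M" by (rule L2_space_cong(1)[OF bop_L2[OF B L] eq])
    assume L': "\<zeta> \<in> L2 M"
    show "AE x in M. A (\<lambda>y. d * \<eta> y + \<zeta> y) x = d * A \<eta> x + A \<zeta> x"
      using bop_linear[OF B L L', of d] ae[of "\<lambda>y. d * \<eta> y + \<zeta> y"] ae[of \<eta>] ae[of \<zeta>]
      by eventually_elim simp
    assume "AE x in M. \<eta> x = \<zeta> x"
    from bop_cong[OF B L L' this] ae[of \<eta>] ae[of \<zeta>]
    show "AE x in M. A \<eta> x = A \<zeta> x" by eventually_elim simp
  qed
qed

context gibbs
begin

section \<open>Full support of the reference measure\<close>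

lemma continuous_L2: "continuous_on X \<eta> \<Longrightarrow> \<eta> \<in> L2 \<mu>"
  unfolding L2_def
  by (auto intro!: continuous_measurable continuous_integrable continuous_intros)

lemma cylinder_indicator_continuous:
  "continuous_on X (\<lambda>x. indicator {y. \<forall>i<m. y i = x0 i} x :: 'a::real_normed_algebra_1)"
proof (rule continuous_on_agreeI)
  fix x and e :: real assume e: "0 < e"
  show "\<exists>m'. \<forall>y\<in>X. (\<forall>i<m'. y i = x i) \<longrightarrow>
      dist (indicator {y. \<forall>i<m. y i = x0 i} y :: 'a) (indicator {y. \<forall>i<m. y i = x0 i} x) < e"
  proof (intro exI ballI impI)
    fix y assume "\<forall>i<m. y i = x i"
    then have "(indicator {y. \<forall>i<m. y i = x0 i} y :: 'a) = indicator {y. \<forall>i<m. y i = x0 i} x"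
      by (simp add: indicator_def)
    then show "dist (indicator {y. \<forall>i<m. y i = x0 i} y :: 'a) (indicator {y. \<forall>i<m. y i = x0 i} x) < e"
      using e by simp
  qed
qed

lemma cylinder_sets: "{y. \<forall>i<m. y i = x0 i} \<inter> X \<in> sets \<mu>"
  unfolding mu_sets using borel_open[OF open_agree[of m x0]] by (auto simp: sets_restrict_space)

text \<open>Every tail class of level m contains a point that starts with the first m letters of
  \<open>x0\<close>. Its summand alone keeps the averaged indicator above the minimum of the weight,
  and averaging preserves the integral.\<close>

lemma cylinder_pos:
  assumes x0: "x0 \<in> X"
  shows "emeasure \<mu> ({y. \<forall>i<m. y i = x0 i} \<inter> X) > 0"
proof -
  interpret prob_space \<mu> by (rule mu_prob)
  let ?C = "{y. \<forall>i<m. y i = x0 i} \<inter> X"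
  obtain d where d: "0 < d" "\<And>x. x \<in> X \<Longrightarrow> d \<le> weight m x"
    using positive_X[OF continuous_weight, of m] weight_pos by blast
  have "ennreal d = (\<integral>\<^sup>+x. ennreal d \<partial>\<mu>)" by (simp add: emeasure_space_1)
  also have "\<dots> \<le> (\<integral>\<^sup>+x. nn_transfer m (indicator ?C) x \<partial>\<mu>)"
  proof (rule nn_integral_mono)
    fix x assume "x \<in> space \<mu>"
    then have x: "x \<in> X" by (simp add: space_mu)
    have g: "glue m x0 x \<in> tail m x" by (rule glue_in_tail[OF x0 x])
    have t: "nn_transfer m (indicator ?C) x = (\<Sum>y\<in>tail m x. ennreal (weight m y) * indicator ?C y)"
      by (simp add: nn_transfer_def sum_tail[OF x])
    have "ennreal d \<le> ennreal (weight m (glue m x0 x)) * indicator ?C (glue m x0 x)"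
      using d(2)[OF glue_in[OF x0 x]] glue_in[OF x0 x] by (simp add: glue_def ennreal_leI)
    also have "\<dots> \<le> nn_transfer m (indicator ?C) x"
      unfolding t by (rule member_le_sum[OF g _ finite_tail]) simp
    finally show "ennreal d \<le> nn_transfer m (indicator ?C) x" .
  qed
  also have "\<dots> = emeasure \<mu> ?C" by (rule set_integral_transfer[OF cylinder_sets])
  finally have "ennreal d \<le> emeasure \<mu> ?C" .
  moreover have "0 < ennreal d" using d(1) by simp
  ultimately show ?thesis by (rule order_less_le_trans[rotated])
qed

text \<open>Test the operator on the indicator of a small cylinder around the point: two points of the
  cylinder that are related must coincide.\<close>
lemma diag_bound:
  assumes a: "kern n a" and C: "opb \<mu> (Kop n a) C" and x0: "x0 \<in> X"
  shows "cmod (a x0 x0) \<le> C"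
proof -
  interpret prob_space \<mu> by (rule mu_prob)
  have "cmod (a x0 x0) \<le> C + e" if e: "0 < e" for e
  proof -
    obtain m0 where m0: "\<forall>y\<in>X. (\<forall>i<m0. y i = x0 i) \<longrightarrow> dist (a y y) (a x0 x0) < e"
      using continuous_on_agreeD[OF kern_diag[OF a] x0 e] by blast
    \<comment> \<open>At least n letters, so that related points of the cylinder coincide; at least
      m0, so that the diagonal varies by less than e on it.\<close>
    define m where "m = max n m0"
    let ?C = "{y. \<forall>i<m. y i = x0 i}"
    let ?\<eta> = "\<lambda>x. indicator ?C x :: complex"
    have L: "?\<eta> \<in> L2 \<mu>" by (intro continuous_L2 cylinder_indicator_continuous)
    have K: "Kop n a ?\<eta> x = a x x" if x: "x \<in> X" "x \<in> ?C" for x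
    proof -
      have "a x y * ?\<eta> y = (if y = x then a x x else 0)" if y: "y \<in> tail n x" for y
      proof (cases "y \<in> ?C")
        case True
        have "y i = x i" for i
        proof (cases "i < n")
          case True
          then have "i < m" by (simp add: m_def)
          then show ?thesis using \<open>y \<in> ?C\<close> x(2) by simp
        next
          case False
          then show ?thesis using y by (simp add: tail_def)
        qed
        then have "y = x" by blast
        then show ?thesis using x(2) by simp
      next
        case False
        then have "y \<noteq> x" using x(2) by blast
          
        moreover have "?\<eta> y = 0" using False by (rule indicator_simps(2))
          ultimately show ?thesis by simp
      qed
      then have "Kop n a ?\<eta> x = (\<Sum>y\<in>tail n x. if y = x then a x x else 0)"
        unfolding Kop_def by (intro sum.cong refl)
      then show ?thesis using tail_refl[OF x(1)] finite_tail by simp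
    qed
    have pos: "0 < l2norm \<mu> ?\<eta>"
    proof -
      have "(l2norm \<mu> ?\<eta>)\<^sup>2 = (\<integral>x. indicator (?C \<inter> X) x \<partial>\<mu>)"
        unfolding l2norm_sq by (intro Bochner_Integration.integral_cong refl) (auto simp: space_mu indicator_def)
      also have "\<dots> = measure \<mu> (?C \<inter> X)" using cylinder_sets by simp
      also have "\<dots> > 0" using cylinder_pos[OF x0, of m] by (simp add: emeasure_eq_measure)
      finally have "l2norm \<mu> ?\<eta> \<noteq> 0" by (simp only: zero_less_power2 not_False_eq_True)
      then show ?thesis using l2norm_nonneg[of \<mu> ?\<eta>] by linarith
    qed
    have "(cmod (a x0 x0) - e) \<le> C"
    proof (cases "0 \<le> cmod (a x0 x0) - e")
      case False
      have "0 \<le> C * l2norm \<mu> ?\<eta>" using opbD[OF C L] l2norm_nonneg order_trans by blast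
      then have "0 \<le> C" using pos by (simp add: zero_le_mult_iff)
      then show ?thesis using False by linarith
    next
      case True
      let ?t = "cmod (a x0 x0) - e"
      have "?t * l2norm \<mu> ?\<eta> = l2norm \<mu> (\<lambda>x. of_real ?t * ?\<eta> x)"
        unfolding l2norm_scale norm_of_real using True by simp
      also have "\<dots> \<le> l2norm \<mu> (Kop n a ?\<eta>)"
      proof (rule l2norm_mono[OF L2_scale[OF L] bop_L2[OF is_bop_Kop[OF a] L]])
        fix x assume "x \<in> space \<mu>"
        then have x: "x \<in> X" by (simp add: space_mu)
        show "cmod (of_real ?t * ?\<eta> x) \<le> cmod (Kop n a ?\<eta> x)"
        proof (cases "x \<in> ?C")
          case True
          then have "\<forall>i<m0. x i = x0 i" by (simp add: m_def)
          then have "dist (a x x) (a x0 x0) < e" using m0 x by blast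
          then have "?t \<le> cmod (a x x)"
            using norm_triangle_ineq2[of "a x0 x0" "a x x"] by (simp add: dist_norm norm_minus_commute)
          moreover have "cmod (of_real ?t * ?\<eta> x) = ?t"
            using True \<open>0 \<le> ?t\<close> by (simp only: indicator_simps mult_1_right norm_of_real abs_of_nonneg)
          ultimately show ?thesis unfolding K[OF x True] by simp
        next
          case False
          then have "?\<eta> x = 0" by (rule indicator_simps(2))
          then show ?thesis by simp
        qed
      qed
      also have "\<dots> \<le> C * l2norm \<mu> ?\<eta>" by (rule opbD[OF C L])
      finally show ?thesis using pos by (rule mult_right_le_imp_le)
    qed
    then show ?thesis by simp
  qed
  then show ?thesis by (rule field_le_epsilon)
qed

text \<open>Its diagonal is f g divided by \<open>lambda_n\<close>, the integrand in the formula for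
  the KMS state.\<close>

definition gker :: "nat \<Rightarrow> vec \<Rightarrow> vec \<Rightarrow> pt \<Rightarrow> pt \<Rightarrow> complex" where
  "gker n f g = on_rel n (\<lambda>x y. f x * of_real (weight n y) * g y)"

lemma generator_Kop:
  "x \<in> X \<Longrightarrow> (Mop f \<circ> e_op k p n \<circ> Mop g) \<eta> x = Kop n (gker n f g) \<eta> x"
  unfolding Kop_def gker_def on_rel_def
  by (simp add: Mop_def e_op_transfer transfer_def tail_rel_iff sum_distrib_left ac_simps)

lemma kern_gker:
  assumes "continuous_on X f" "continuous_on X g"
  shows "kern n (gker n f g)"
  unfolding gker_def
proof (rule kern_on_rel, intro continuous_on_mult continuous_on_of_real)
  have X: "fst ` tail_rel n \<subseteq> X" "snd ` tail_rel n \<subseteq> X" by (auto simp: tail_rel_def)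
  show "continuous_on (tail_rel n) (\<lambda>z. f (fst z))"
    by (rule continuous_on_compose2[OF assms(1) continuous_on_fst[OF continuous_on_id] X(1)])
  show "continuous_on (tail_rel n) (\<lambda>z. weight n (snd z))"
    by (rule continuous_on_compose2[OF continuous_weight continuous_on_snd[OF continuous_on_id] X(2)])
  show "continuous_on (tail_rel n) (\<lambda>z. g (snd z))"
    by (rule continuous_on_compose2[OF assms(2) continuous_on_snd[OF continuous_on_id] X(2)])
qed

lemma generator_bop:
  assumes "continuous_on X f" "continuous_on X g"
  shows "is_bop \<mu> (Mop f \<circ> e_op k p n \<circ> Mop g)" "op_eq \<mu> (Mop f \<circ> e_op k p n \<circ> Mop g) (Kop n (gker n f g))"
  using is_bop_space_cong[OF is_bop_Kop[OF kern_gker[OF assms]], where A = "Mop f \<circ> e_op k p n \<circ> Mop g"]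
    generator_Kop space_mu by blast+

lemma common_level:
  assumes "kern n a" "kern m b"
  obtains l where "kern l a" "kern l b" "Kop l a = Kop n a" "Kop l b = Kop m b"
  by (rule that[of "max n m", OF kern_mono[OF _ assms(1)] kern_mono[OF _ assms(2)]
        Kop_mono[OF _ assms(1)] Kop_mono[OF _ assms(2)]]) auto

lemma star_alg_kernel:
  assumes "A \<in> star_alg k p \<mu>"
  shows "is_bop \<mu> A \<and> (\<exists>n a. kern n a \<and> op_eq \<mu> A (Kop n a))"
  using assms
proof (induction rule: star_alg.induct)
  case (gen A)
  then obtain f g n where "A = Mop f \<circ> e_op k p n \<circ> Mop g" "continuous_on X f" "continuous_on X g"
    by (auto simp: generators_def)
  then show ?case using generator_bop kern_gker by blast
next
  case (add A B)
  then obtain n a m b where a: "kern n a" "op_eq \<mu> A (Kop n a)" and b: "kern m b" "op_eq \<mu> B (Kop m b)" by blast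
  obtain l where l: "kern l a" "kern l b" "Kop l a = Kop n a" "Kop l b = Kop m b"
    using common_level[OF a(1) b(1)] .
  have "op_eq \<mu> (op_add A B) (op_add (op_scale 1 (Kop l a)) (Kop l b))"
    unfolding op_scale_one l(3,4) by (rule op_eq_add[OF a(2) b(2)])
  then have "op_eq \<mu> (op_add A B) (Kop l (\<lambda>x y. 1 * a x y + b x y))" unfolding Kop_add_scale .
  then show ?case using kern_add_scale[OF l(1,2), of 1] is_bop_add add.IH by blast
next
  case (scale A c)
  then obtain n a where a: "kern n a" "op_eq \<mu> A (Kop n a)" by blast
  have "op_eq \<mu> (op_scale c A) (op_scale c (Kop n a))" by (rule op_eq_scale[OF a(2)])
  moreover have "op_scale c (Kop n a) = Kop n (\<lambda>x y. c * a x y)"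
    by (simp add: fun_eq_iff op_scale_def Kop_def sum_distrib_left ac_simps)
  moreover have "kern n (\<lambda>x y. c * a x y)"
    using a(1) unfolding kern_def by (auto intro!: continuous_intros)
  ultimately show ?case using is_bop_scale scale.IH by metis
next
  case (mult A B)
  then obtain n a m b where a: "kern n a" "op_eq \<mu> A (Kop n a)" and b: "kern m b" "op_eq \<mu> B (Kop m b)" by blast
  obtain l where l: "kern l a" "kern l b" "Kop l a = Kop n a" "Kop l b = Kop m b"
    using common_level[OF a(1) b(1)] .
  have "op_eq \<mu> (A \<circ> B) (Kop l a \<circ> Kop l b)"
    using mult.IH a(2) b(2) l by (intro op_eq_comp is_bop_Kop) auto
  then have "op_eq \<mu> (A \<circ> B) (Kop l (kmul l a b))" unfolding Kop_comp .
  then show ?case using kern_kmul[OF l(1,2)] is_bop_comp mult.IH by blast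
next
  case (adj A)
  then obtain n a where A: "is_bop \<mu> A" and a: "kern n a" "op_eq \<mu> A (Kop n a)" by blast
  have b: "is_bop \<mu> (Kop n (kadj n a))" by (intro is_bop_Kop kern_kadj a)
  have "is_adj \<mu> A (Kop n (kadj n a))"
    by (rule adj_cong_left[OF is_adj_Kop[OF a(1)] op_eq_sym[OF a(2)] is_bop_Kop[OF a(1)] A b])
  from op_adj_ex(1)[OF b this] op_adj_eq[OF A b this] kern_kadj[OF a(1)] show ?case by blast
qed

lemma kern_const_zero: "kern n (\<lambda>x y. 0)"
  by (simp add: kern_def)

lemma kern_sum:
  assumes "\<And>w. w \<in> W \<Longrightarrow> kern n (a w)"
  shows "kern n (\<lambda>x y. \<Sum>w\<in>W. a w x y)"
  using assms unfolding kern_def by (auto intro!: continuous_on_sum)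

text \<open>Within a tail class a point is determined by its first n letters. The cylinder indicator
  in \<open>g w\<close> selects the point with prefix w, and the division cancels the weight inside
  \<open>gker\<close>.\<close>

lemma kern_decompose:
  assumes a: "kern n a"
  shows "\<exists>f g. (\<forall>w\<in>wds n. continuous_on X (f w) \<and> continuous_on X (g w)) \<and>
    a = (\<lambda>x y. \<Sum>w\<in>wds n. gker n (f w) (g w) x y)"
proof -
  define f where "f w x = a x (glue n w x)" for w x
  define g where "g w x = indicator {y. \<forall>i<n. y i = w i} x / complex_of_real (weight n x)" for w :: pt and x
  have "continuous_on X (f w) \<and> continuous_on X (g w)" if "w \<in> wds n" for w
  proof
    show "continuous_on X (f w)" unfolding f_def[abs_def] by (rule kern_glue[OF a wds_in[OF that]])
    have "\<forall>x\<in>X. complex_of_real (weight n x) \<noteq> 0"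
    proof
      fix x assume "x \<in> X"
      then show "complex_of_real (weight n x) \<noteq> 0" using weight_pos[of x n] by simp
    qed
    then show "continuous_on X (g w)"
      unfolding g_def[abs_def]
      by (intro continuous_on_divide cylinder_indicator_continuous continuous_on_of_real continuous_weight)
  qed
  moreover have "a x y = (\<Sum>w\<in>wds n. gker n (f w) (g w) x y)" for x y
  proof (cases "(x, y) \<in> tail_rel n")
    case False
    then show ?thesis by (simp add: gker_def on_rel_def kern_zero[OF a])
  next
    case True
    then have x: "x \<in> X" and y: "y \<in> tail n x" by (auto simp: tail_rel_iff)
    obtain v where v: "v \<in> wds n" "y = glue n v x" using glue_wds_bij[OF x, of n] y by (auto simp: bij_betw_def)
    have "weight n y \<noteq> 0" using weight_pos[OF tail_in[OF y], of n] by simp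
    moreover have "(\<forall>i<n. y i = w i) \<longleftrightarrow> w = v" if w: "w \<in> wds n" for w
    proof
      assume *: "\<forall>i<n. y i = w i"
      show "w = v"
      proof
        fix i show "w i = v i"
          using * v w by (cases "i < n") (auto simp: glue_def wds_def tail_def)
      qed
    qed (simp add: v(2) glue_def)
    ultimately have "gker n (f w) (g w) x y = (if w = v then a x y else 0)" if "w \<in> wds n" for w
      using True that v(2) by (simp add: gker_def on_rel_def f_def g_def indicator_def)
    then show ?thesis using v(1) finite_wds by simp
  qed
  then have "a = (\<lambda>x y. \<Sum>w\<in>wds n. gker n (f w) (g w) x y)" by blast
  ultimately show ?thesis by - (rule exI[of _ f], rule exI[of _ g], rule conjI, blast, assumption)
qed

lemma Kop_in_star_alg:
  assumes a: "kern n a"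
  shows "\<exists>A\<in>star_alg k p \<mu>. \<forall>\<eta>. \<forall>x\<in>X. A \<eta> x = Kop n a \<eta> x"
proof -
  obtain f g where fg: "\<forall>w\<in>wds n. continuous_on X (f w) \<and> continuous_on X (g w)"
    and dec: "a = (\<lambda>x y. \<Sum>w\<in>wds n. gker n (f w) (g w) x y)" using kern_decompose[OF a] by blast
  have "\<exists>A\<in>star_alg k p \<mu>. \<forall>\<eta>. \<forall>x\<in>X. A \<eta> x = (\<Sum>w\<in>W. (Mop (f w) \<circ> e_op k p n \<circ> Mop (g w)) \<eta> x)"
    if "finite W" "W \<subseteq> wds n" for W
    using that
  proof (induction W rule: finite_induct)
    case empty
    \<comment> \<open>The empty sum is the zero operator, realized as a generator with zero
      multipliers.\<close>
    have "Mop (\<lambda>_. 0) \<circ> e_op k p n \<circ> Mop (\<lambda>_. 0) \<in> generators k p"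
      unfolding generators_def
      by (rule CollectI, rule exI[of _ "\<lambda>_. 0"], rule exI[of _ "\<lambda>_. 0"], rule exI[of _ n])
         (simp add: continuous_on_const)
    then have "Mop (\<lambda>_. 0) \<circ> e_op k p n \<circ> Mop (\<lambda>_. 0) \<in> star_alg k p \<mu>" by (rule star_alg.gen)
    then show ?case by (rule bexI[rotated]) (simp add: Mop_def)
  next
    case (insert w W)
    then obtain A where A: "A \<in> star_alg k p \<mu>"
      "\<forall>\<eta>. \<forall>x\<in>X. A \<eta> x = (\<Sum>w\<in>W. (Mop (f w) \<circ> e_op k p n \<circ> Mop (g w)) \<eta> x)" by auto
    have "w \<in> wds n" using insert by simp
    then have "Mop (f w) \<circ> e_op k p n \<circ> Mop (g w) \<in> generators k p"
      using fg unfolding generators_def by blast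
    from star_alg.add[OF star_alg.gen[OF this] A(1)] show ?case
      by (rule bexI[rotated]) (use A(2) insert in \<open>simp add: op_add_def\<close>)
  qed
  from this[OF finite_wds subset_refl] obtain A where A: "A \<in> star_alg k p \<mu>"
    "\<forall>\<eta>. \<forall>x\<in>X. A \<eta> x = (\<Sum>w\<in>wds n. (Mop (f w) \<circ> e_op k p n \<circ> Mop (g w)) \<eta> x)" by blast
  have "(\<Sum>w\<in>wds n. (Mop (f w) \<circ> e_op k p n \<circ> Mop (g w)) \<eta> x) = Kop n a \<eta> x" if "x \<in> X" for \<eta> x
  proof -
    have "(\<Sum>w\<in>wds n. (Mop (f w) \<circ> e_op k p n \<circ> Mop (g w)) \<eta> x)
        = (\<Sum>w\<in>wds n. \<Sum>y\<in>tail n x. gker n (f w) (g w) x y * \<eta> y)"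
      by (intro sum.cong refl) (simp only: generator_Kop[OF that] Kop_def)
    also have "\<dots> = Kop n a \<eta> x"
      unfolding Kop_def by (subst sum.swap) (simp add: dec sum_distrib_right)
    finally show ?thesis .
  qed
  then have "\<forall>\<eta>. \<forall>x\<in>X. A \<eta> x = Kop n a \<eta> x" using A(2) by simp
  with A(1) show ?thesis by blast
qed

text \<open>From here on the algebra is handled only as the norm closure of kernel operators, with
  \<open>opb\<close> in place of the supremum norm.\<close>

lemma Ualg_iff:
  "A \<in> Ualg k p \<mu> \<longleftrightarrow> is_bop \<mu> A \<and> (\<forall>e>0. \<exists>n a. kern n a \<and> opb \<mu> (op_diff A (Kop n a)) e)"
proof (intro iffI conjI allI impI)
  assume A: "A \<in> Ualg k p \<mu>"
  then show bA: "is_bop \<mu> A" by (simp add: Ualg_def)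
  fix e :: real assume "0 < e"
  then obtain B where B: "B \<in> star_alg k p \<mu>" "opnorm \<mu> (op_diff A B) < e" using A by (auto simp: Ualg_def)
  from star_alg_kernel[OF B(1)] obtain n a where bB: "is_bop \<mu> B" and a: "kern n a" "op_eq \<mu> B (Kop n a)" by blast
  have "opb \<mu> (op_diff A B) e" by (rule opnorm_less[OF is_bop_diff[OF bA bB] B(2)])
  then have "opb \<mu> (op_diff A (Kop n a)) e"
    by (rule opb_op_eq[OF is_bop_diff[OF bA bB] is_bop_diff[OF bA is_bop_Kop[OF a(1)]] op_eq_diff[OF op_eq_refl a(2)]])
  with a(1) show "\<exists>n a. kern n a \<and> opb \<mu> (op_diff A (Kop n a)) e" by blast
next
  assume R: "is_bop \<mu> A \<and> (\<forall>e>0. \<exists>n a. kern n a \<and> opb \<mu> (op_diff A (Kop n a)) e)"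
  have "\<exists>B\<in>star_alg k p \<mu>. opnorm \<mu> (op_diff A B) < e" if e: "0 < e" for e
  proof -
    \<comment> \<open>Half of e is used because \<open>opb\<close> gives a non-strict bound while
      the closure asks for a strict one.\<close>
    obtain n a where a: "kern n a" "opb \<mu> (op_diff A (Kop n a)) (e / 2)" using R e half_gt_zero by blast
    obtain B where B: "B \<in> star_alg k p \<mu>" "\<forall>\<eta>. \<forall>x\<in>X. B \<eta> x = Kop n a \<eta> x"
      using Kop_in_star_alg[OF a(1)] by blast
    have bB: "is_bop \<mu> B" using star_alg_kernel[OF B(1)] by blast
    have eq: "op_eq \<mu> B (Kop n a)"
      by (rule is_bop_space_cong(2)[OF is_bop_Kop[OF a(1)]]) (use B(2) space_mu in auto)
    have "opb \<mu> (op_diff A B) (e / 2)"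
      using R by (intro opb_op_eq[OF is_bop_diff[OF _ is_bop_Kop[OF a(1)]] is_bop_diff[OF _ bB]
          op_eq_diff[OF op_eq_refl op_eq_sym[OF eq]] a(2)]) auto
    then have "opnorm \<mu> (op_diff A B) \<le> e / 2" using e by (intro opnorm_le) auto
    then show ?thesis using B(1) e by (intro bexI[of _ B]) auto
  qed
  then show "A \<in> Ualg k p \<mu>" using R by (simp add: Ualg_def)
qed

section \<open>Closure properties of the algebra\<close>

lemma Ualg_bop: "A \<in> Ualg k p \<mu> \<Longrightarrow> is_bop \<mu> A"
  by (simp add: Ualg_iff)

lemma Ualg_approx:
  assumes "A \<in> Ualg k p \<mu>" "0 < e"
  obtains n a where "kern n a" "opb \<mu> (op_diff A (Kop n a)) e"
  using assms by (auto simp: Ualg_iff)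

lemma Kop_Ualg: "kern n a \<Longrightarrow> Kop n a \<in> Ualg k p \<mu>"
proof -
  assume a: "kern n a"
  have "opb \<mu> (op_diff (Kop n a) (Kop n a)) e" if "0 < e" for e
    using that by (simp add: opb_def op_diff_def l2norm_def)
  with a show ?thesis by (auto simp: Ualg_iff is_bop_Kop)
qed

lemma Ualg_closed:
  assumes A: "is_bop \<mu> A" and ap: "\<And>e. 0 < e \<Longrightarrow> \<exists>B\<in>Ualg k p \<mu>. opb \<mu> (op_diff A B) e"
  shows "A \<in> Ualg k p \<mu>"
  unfolding Ualg_iff
proof (intro conjI allI impI A)
  fix e :: real assume e: "0 < e"
  obtain B where B: "B \<in> Ualg k p \<mu>" "opb \<mu> (op_diff A B) (e/2)" using ap[of "e/2"] e by auto
  obtain n a where a: "kern n a" "opb \<mu> (op_diff B (Kop n a)) (e/2)" using Ualg_approx[OF B(1), of "e/2"] e by auto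
  have "opb \<mu> (op_diff A (Kop n a)) (e/2 + e/2)"
    by (rule opb_triangle[OF A Ualg_bop[OF B(1)] is_bop_Kop[OF a(1)] B(2) a(2)])
  with a(1) show "\<exists>n a. kern n a \<and> opb \<mu> (op_diff A (Kop n a)) e" by auto
qed

lemma Ualg_op_eq:
  assumes "A \<in> Ualg k p \<mu>" "is_bop \<mu> B" "op_eq \<mu> A B" shows "B \<in> Ualg k p \<mu>"
proof (rule Ualg_closed[OF assms(2)])
  fix e :: real assume "0 < e"
  then have "opb \<mu> (op_diff B A) e"
    using opb_mono[OF opb_op_eq_zero[OF assms(2) Ualg_bop[OF assms(1)] op_eq_sym[OF assms(3)]]] by simp
  with assms(1) show "\<exists>C\<in>Ualg k p \<mu>. opb \<mu> (op_diff B C) e" by blast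
qed

lemma generator_Ualg:
  assumes "continuous_on X f" "continuous_on X g"
  shows "Mop f \<circ> e_op k p n \<circ> Mop g \<in> Ualg k p \<mu>"
  by (rule Ualg_op_eq[OF Kop_Ualg[OF kern_gker[OF assms]] generator_bop(1)[OF assms]
        op_eq_sym[OF generator_bop(2)[OF assms]]])

lemma Ualg_lin:
  assumes A: "A \<in> Ualg k p \<mu>" and B: "B \<in> Ualg k p \<mu>"
  shows "op_add (op_scale c A) B \<in> Ualg k p \<mu>"
proof (rule Ualg_closed)
  note b = Ualg_bop[OF A] Ualg_bop[OF B]
  show "is_bop \<mu> (op_add (op_scale c A) B)" by (intro is_bop_add is_bop_scale b)
  fix e :: real assume e: "0 < e"
  define e1 where "e1 = e / (cmod c + 1 + 1)"
  have e1: "0 < e1" "e1 * (cmod c + 1) \<le> e" unfolding e1_def using shrink_pos[of "cmod c + 1" e] e by auto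
  obtain n a where a: "kern n a" "opb \<mu> (op_diff A (Kop n a)) e1" using Ualg_approx[OF A e1(1)] .
  obtain m b where b': "kern m b" "opb \<mu> (op_diff B (Kop m b)) e1" using Ualg_approx[OF B e1(1)] .
  obtain l where l: "kern l a" "kern l b" "Kop l a = Kop n a" "Kop l b = Kop m b"
    using common_level[OF a(1) b'(1)] .
  let ?K = "op_add (op_scale c (Kop l a)) (Kop l b)"
  have "?K \<in> Ualg k p \<mu>" unfolding Kop_add_scale by (intro Kop_Ualg kern_add_scale l)
  moreover have "op_diff (op_add (op_scale c A) B) ?K = op_add (op_scale c (op_diff A (Kop l a))) (op_diff B (Kop l b))"
    by (simp add: fun_eq_iff op_diff_def op_add_def op_scale_def algebra_simps)
  moreover have "opb \<mu> (op_add (op_scale c (op_diff A (Kop l a))) (op_diff B (Kop l b))) (cmod c * e1 + e1)"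
    using a(2) b'(2) l by (intro opb_add opb_scale is_bop_scale is_bop_diff is_bop_Kop b) auto
  moreover have "cmod c * e1 + e1 \<le> e" using e1(2) by (simp add: algebra_simps)
  ultimately show "\<exists>C\<in>Ualg k p \<mu>. opb \<mu> (op_diff (op_add (op_scale c A) B) C) e"
    using opb_mono by (intro bexI[of _ ?K]) auto
qed

lemma comp_approx:
  assumes A: "A \<in> Ualg k p \<mu>" and B: "B \<in> Ualg k p \<mu>" and e: "0 < e"
  obtains n a b where "kern n a" "kern n b" "opb \<mu> (op_diff A (Kop n a)) e" "opb \<mu> (op_diff B (Kop n b)) e"
    "opb \<mu> (op_diff (A \<circ> B) (Kop n (kmul n a b))) e"
proof -
  note bo = Ualg_bop[OF A] Ualg_bop[OF B]
  obtain c where c: "0 \<le> c" "opb \<mu> A c" using bop_opb[OF bo(1)] .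
  obtain d where d: "0 \<le> d" "opb \<mu> B d" using bop_opb[OF bo(2)] .
  define K where "K = c + d + 1"
  \<comment> \<open>The product error is at most \<open>c * e1 + e1 * (d + e1)\<close>; with
    \<open>e1\<close> at most 1 this is at most \<open>e1 * (c + d + 1)\<close>.\<close>
  define e1 where "e1 = min 1 (min e (e / (K + 1)))"
  have K: "0 \<le> K" using c d by (simp add: K_def)
  have e1: "0 < e1" "e1 \<le> 1" "e1 \<le> e" "e1 * K \<le> e"
  proof -
    show "0 < e1" using e shrink_pos(1)[OF K e] by (simp add: e1_def)
    have "e1 * K \<le> e / (K + 1) * K" by (intro mult_right_mono K) (simp add: e1_def)
    then show "e1 * K \<le> e" using shrink_pos(2)[OF K e] by linarith
  qed (auto simp: e1_def)
  obtain n a where a: "kern n a" "opb \<mu> (op_diff A (Kop n a)) e1" using Ualg_approx[OF A e1(1)] .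
  obtain m b where b: "kern m b" "opb \<mu> (op_diff B (Kop m b)) e1" using Ualg_approx[OF B e1(1)] .
  obtain l where l: "kern l a" "kern l b" "Kop l a = Kop n a" "Kop l b = Kop m b"
    using common_level[OF a(1) b(1)] .
  have db: "opb \<mu> (op_diff B (Kop l b)) e1" using b(2) l by simp
  have ob: "opb \<mu> (Kop l b) (d + e1)"
  proof -
    have "Kop l b = op_diff B (op_diff B (Kop l b))" by (simp add: op_diff_def)
    moreover have "opb \<mu> (op_diff B (op_diff B (Kop l b))) (d + e1)"
      by (intro opb_diff is_bop_diff is_bop_Kop bo l d db)
    ultimately show ?thesis by simp
  qed
  have "opb \<mu> (op_diff (A \<circ> B) (Kop l a \<circ> Kop l b)) (c * e1 + e1 * (d + e1))"
    using a(2) l e1 by (intro opb_comp_diff bo is_bop_Kop l c ob db) auto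
  moreover have "c * e1 + e1 * (d + e1) \<le> e"
  proof -
    have "e1 * e1 \<le> e1 * 1" using e1 by (intro mult_left_mono) auto
    then show ?thesis using e1(4) by (simp add: K_def algebra_simps)
  qed
  ultimately have "opb \<mu> (op_diff (A \<circ> B) (Kop l (kmul l a b))) e" unfolding Kop_comp by (rule opb_mono)
  then show thesis using that[OF l(1,2)] a(2) b(2) l opb_mono[OF _ e1(3)] by simp
qed

lemma Ualg_comp:
  assumes A: "A \<in> Ualg k p \<mu>" and B: "B \<in> Ualg k p \<mu>"
  shows "A \<circ> B \<in> Ualg k p \<mu>"
proof (rule Ualg_closed[OF is_bop_comp[OF Ualg_bop[OF A] Ualg_bop[OF B]]])
  fix e :: real assume "0 < e"
  from comp_approx[OF A B this] show "\<exists>C\<in>Ualg k p \<mu>. opb \<mu> (op_diff (A \<circ> B) C) e"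
    using Kop_Ualg[OF kern_kmul] by metis
qed

lemma Mop_generator: "Mop f = Mop f \<circ> e_op k p 0 \<circ> Mop (\<lambda>_. 1)"
  by (simp add: fun_eq_iff Mop_def e_op_def)

lemma Mop_Ualg: "continuous_on X f \<Longrightarrow> Mop f \<in> Ualg k p \<mu>"
  by (subst Mop_generator) (intro generator_Ualg continuous_on_const)

lemma id_Mop: "id = Mop (\<lambda>_. 1)"
  by (simp add: fun_eq_iff Mop_def)

lemma Ualg_id: "id \<in> Ualg k p \<mu>"
  unfolding id_Mop by (intro Mop_Ualg continuous_on_const)

lemma adj_approx_Kop:
  assumes A: "is_bop \<mu> A" "is_bop \<mu> B" "is_adj \<mu> A B" and a: "kern n a" "opb \<mu> (op_diff A (Kop n a)) e"
  shows "opb \<mu> (op_diff B (Kop n (kadj n a))) e"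
  by (rule adj_opb[OF is_bop_diff[OF A(1) is_bop_Kop[OF a(1)]] is_bop_diff[OF A(2) is_bop_Kop[OF kern_kadj[OF a(1)]]]
        adj_diff[OF A(1) is_bop_Kop[OF a(1)] A(2) is_bop_Kop[OF kern_kadj[OF a(1)]] A(3) is_adj_Kop[OF a(1)]] a(2)])

text \<open>Kernel operators have explicit adjoints and adjoints preserve distances, so the adjoints
  along a fast approximating sequence converge. Their limit is a bounded adjoint of A, which gives
  the choice in \<open>op_adj\<close> a witness.\<close>

lemma Ualg_has_adj:
  assumes A: "A \<in> Ualg k p \<mu>"
  shows "is_bop \<mu> (op_adj \<mu> A)" "is_adj \<mu> A (op_adj \<mu> A)" "op_adj \<mu> A \<in> Ualg k p \<mu>"
proof -
  note bA = Ualg_bop[OF A]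
  have "\<forall>j. \<exists>na. kern (fst na) (snd na) \<and> opb \<mu> (op_diff A (Kop (fst na) (snd na))) ((1/2) ^ j)"
  proof
    fix j :: nat
    obtain n a where "kern n a" "opb \<mu> (op_diff A (Kop n a)) ((1/2) ^ j)" by (rule Ualg_approx[OF A, of "(1/2)^j"]) auto
    then show "\<exists>na. kern (fst na) (snd na) \<and> opb \<mu> (op_diff A (Kop (fst na) (snd na))) ((1/2) ^ j)"
      by (intro exI[of _ "(n, a)"]) simp
  qed
  from choice[OF this] obtain na where na: "\<And>j. kern (fst (na j)) (snd (na j))"
    "\<And>j. opb \<mu> (op_diff A (Kop (fst (na j)) (snd (na j)))) ((1/2) ^ j)" by blast
  define K where "K j = Kop (fst (na j)) (snd (na j))" for j
  define B where "B j = Kop (fst (na j)) (kadj (fst (na j)) (snd (na j)))" for j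
  have bK: "is_bop \<mu> (K j)" and bB: "is_bop \<mu> (B j)" and adj: "is_adj \<mu> (K j) (B j)"
    and near: "opb \<mu> (op_diff A (K j)) ((1/2) ^ j)" for j
    unfolding K_def B_def by (intro is_bop_Kop kern_kadj is_adj_Kop na)+
  have step: "opb \<mu> (op_diff (B (Suc j)) (B j)) (2 * (1/2) ^ j)" for j
  proof (rule adj_opb[OF is_bop_diff[OF bK bK] is_bop_diff[OF bB bB] adj_diff[OF bK bK bB bB adj adj]])
    have "opb \<mu> (op_diff (K (Suc j)) (K j)) ((1/2) ^ Suc j + (1/2) ^ j)"
      by (rule opb_triangle[OF bK bA bK opb_diff_commute[OF near] near])
    then show "opb \<mu> (op_diff (K (Suc j)) (K j)) (2 * (1/2) ^ j)" by (rule opb_mono) simp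
  qed
  obtain D where D: "is_bop \<mu> D" "\<And>j. opb \<mu> (op_diff D (B j)) (2 * (1/2) ^ j / (1 - 1/2))"
    using op_complete[OF mu_prob bB _ _ _ step] by auto
  have "is_adj \<mu> A D"
  proof (rule adj_approx[OF bA D(1)])
    fix e :: real assume e: "0 < e"
    obtain j :: nat where j: "4 * (1/2::real) ^ j < e" by (rule geometric_less[OF e, of "1/2" 4]) auto
    have "opb \<mu> (op_diff A (K j)) e" 
    proof (rule opb_mono[OF near])
      have "0 \<le> (1/2::real) ^ j" by simp
      then show "(1/2) ^ j \<le> e" using j by linarith
    qed
    moreover have "opb \<mu> (op_diff D (B j)) e" by (rule opb_mono[OF D(2)]) (use j in simp)
    ultimately show "\<exists>A' B'. is_bop \<mu> A' \<and> is_bop \<mu> B' \<and> is_adj \<mu> A' B' \<and>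
        opb \<mu> (op_diff A A') e \<and> opb \<mu> (op_diff D B') e" using bK bB adj by blast
  qed
  from op_adj_ex[OF D(1) this] show b: "is_bop \<mu> (op_adj \<mu> A)" and a: "is_adj \<mu> A (op_adj \<mu> A)" by auto
  show "op_adj \<mu> A \<in> Ualg k p \<mu>"
  proof (rule Ualg_closed[OF b])
    fix e :: real assume "0 < e"
    then obtain n c where c: "kern n c" "opb \<mu> (op_diff A (Kop n c)) e" by (rule Ualg_approx[OF A])
    from adj_approx_Kop[OF bA b a c] Kop_Ualg[OF kern_kadj[OF c(1)]]
    show "\<exists>B\<in>Ualg k p \<mu>. opb \<mu> (op_diff (op_adj \<mu> A) B) e" by blast
  qed
qed

sublocale alg: op_cstar \<mu> "Ualg k p \<mu>"
  by (intro op_cstar.intro) (fact mu_prob Ualg_bop Ualg_lin Ualg_comp Ualg_id Ualg_has_adj Ualg_closed)+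

end

section \<open>The dynamics\<close>

locale gibbs_dyn = gibbs +
  fixes H :: "pt \<Rightarrow> real"
  assumes H_pos: "\<forall>x\<in>X. H x > 0" and H_cont: "continuous_on X H"
begin

definition energy :: "nat \<Rightarrow> pt \<Rightarrow> real" where
  "energy n = birkhoff (\<lambda>x. ln (H x)) n"

lemma continuous_ln_H: "continuous_on X (\<lambda>x. ln (H x))"
  using H_pos by (intro continuous_on_ln H_cont) (metis less_irrefl)

lemma continuous_energy: "continuous_on X (energy n)"
  unfolding energy_def by (rule continuous_birkhoff[OF continuous_ln_H])

text \<open>Imaginary z gives the dynamics on kernels, real z the modular factor of the KMS
  condition; complex z joins the two analytically.\<close>

definition twist :: "complex \<Rightarrow> nat \<Rightarrow> (pt \<Rightarrow> pt \<Rightarrow> complex) \<Rightarrow> pt \<Rightarrow> pt \<Rightarrow> complex" where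
  "twist z n a x y = a x y * exp (z * of_real (energy n x - energy n y))"

lemma energy_kernel_continuous:
  "continuous_on (tail_rel n) (\<lambda>u. energy n (fst u) - energy n (snd u))"
proof -
  have X: "fst ` tail_rel n \<subseteq> X" "snd ` tail_rel n \<subseteq> X" by (auto simp: tail_rel_def)
  show ?thesis
    by (rule continuous_on_diff[OF
        continuous_on_compose2[OF continuous_energy continuous_on_fst[OF continuous_on_id] X(1)]
        continuous_on_compose2[OF continuous_energy continuous_on_snd[OF continuous_on_id] X(2)]])
qed

lemma kern_twist:
  assumes a: "kern n a" shows "kern n (twist z n a)"
  unfolding kern_def twist_def
proof (intro conjI allI impI)
  show "continuous_on (tail_rel n) (\<lambda>u. a (fst u) (snd u) * exp (z * of_real (energy n (fst u) - energy n (snd u))))"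
    by (intro continuous_on_mult kern_cont[OF a] continuous_on_exp continuous_on_const continuous_on_of_real
        energy_kernel_continuous)
qed (simp add: kern_zero[OF a])

lemma twist_mono:
  assumes "n \<le> m" "kern n a" shows "twist z m a = twist z n a"
proof (intro ext)
  fix x y
  show "twist z m a x y = twist z n a x y"
  proof (cases "(x, y) \<in> tail_rel n")
    case True
    then have "y \<in> tail n x" by (simp add: tail_rel_iff)
    from birkhoff_diff_tail[OF this assms(1)] have "energy m x - energy m y = energy n x - energy n y"
      unfolding energy_def by (metis minus_diff_eq)
    then show ?thesis by (simp add: twist_def)
  next
    case False
    then show ?thesis by (simp add: twist_def kern_zero[OF assms(2)])
  qed
qed

lemma twist_bound:
  assumes a: "kern n a"
  obtains c where "0 < c" "\<And>x y. a x y \<noteq> 0 \<Longrightarrow> \<bar>energy n x - energy n y\<bar> \<le> c"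
proof -
  obtain B where B: "0 < B" "\<And>x. x \<in> X \<Longrightarrow> norm (energy n x) \<le> B" using bounded_X[OF continuous_energy] by blast
  have "\<bar>energy n x - energy n y\<bar> \<le> 2 * B" if "a x y \<noteq> 0" for x y
  proof -
    have "(x, y) \<in> tail_rel n" using that kern_zero[OF a] by blast
    then have "\<bar>energy n x\<bar> \<le> B" "\<bar>energy n y\<bar> \<le> B" using B(2) by (auto simp: tail_rel_def)
    then show ?thesis by linarith
  qed
  with B(1) show thesis by (intro that[of "2 * B"]) auto
qed

lemma exp_remainder: "cmod (exp w - 1 - w) \<le> exp (cmod w) * (cmod w)\<^sup>2"
proof -
  have "cmod (exp w - (\<Sum>k\<le>1. w ^ k / fact k)) \<le> exp \<bar>Re w\<bar> * cmod w ^ Suc 1 / fact 1"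
    by (rule Taylor_exp)
  also have "\<dots> \<le> exp (cmod w) * (cmod w)\<^sup>2"
    using abs_Re_le_cmod[of w] by (simp add: power2_eq_square mult_right_mono)
  finally show ?thesis by (simp add: atMost_Suc algebra_simps)
qed

text \<open>The derivative multiplies the kernel by \<open>\<i>\<close> times the energy difference,
  which is bounded on the support of a kernel. The Taylor remainder makes the difference quotients
  converge uniformly, and \<open>Kop_bound\<close> turns this into norm convergence.\<close>

lemma twist_entire:
  assumes a: "kern n a"
  shows "op_entire \<mu> (\<lambda>z. Kop n (twist (\<i> * z) n a))"
  unfolding op_entire_def
proof (intro allI)
  fix z
  define a' where "a' = twist (\<i> * z) n a"
  define d where "d x y = \<i> * of_real (energy n x - energy n y)" for x y
  define b where "b x y = a' x y * d x y" for x y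
  have a': "kern n a'" unfolding a'_def by (rule kern_twist[OF a])
  have kb: "kern n b"
    unfolding kern_def b_def d_def
    by (intro conjI allI impI continuous_on_mult kern_cont[OF a'] continuous_on_const continuous_on_of_real
        energy_kernel_continuous) (simp add: kern_zero[OF a'])
  obtain B where B: "0 < B" "\<And>x y. cmod (a' x y) \<le> B" using kern_bounded[OF a'] by blast
  obtain c where c: "0 < c" "\<And>x y. a' x y \<noteq> 0 \<Longrightarrow> \<bar>energy n x - energy n y\<bar> \<le> c" using twist_bound[OF a'] by blast
  obtain C where C: "0 < C" "\<forall>a B. kern n a \<longrightarrow> 0 \<le> B \<longrightarrow> (\<forall>x y. cmod (a x y) \<le> B) \<longrightarrow>
      opb \<mu> (Kop n a) (C * B) \<and> (\<forall>\<eta>\<in>L2 \<mu>. Kop n a \<eta> \<in> L2 \<mu>)" using Kop_bound[of n] by blast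
  let ?q = "\<lambda>h x y. (twist (\<i> * (z + h)) n a x y - a' x y) / h - b x y"
  have q: "?q h x y = a' x y * ((exp (h * d x y) - 1) / h - d x y)" for h x y
  proof -
    have "\<i> * (z + h) * of_real (energy n x - energy n y)
        = \<i> * z * of_real (energy n x - energy n y) + h * d x y"
      by (simp add: d_def algebra_simps)
    then have "twist (\<i> * (z + h)) n a x y = a' x y * exp (h * d x y)"
      unfolding twist_def a'_def by (simp only: exp_add mult.assoc)
    then show ?thesis by (simp add: b_def right_diff_distrib diff_divide_distrib)
  qed
  have kq: "kern n (?q h)" for h
  proof -
    have "?q h = (\<lambda>x y. (-1) * b x y + ((1/h) * twist (\<i> * (z + h)) n a x y + (- 1/h) * a' x y + 0))"
      by (simp add: fun_eq_iff diff_divide_distrib)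
    moreover have "kern n (\<lambda>x y. (1/h) * twist (\<i> * (z + h)) n a x y + ((- 1/h) * a' x y + 0))"
      by (intro kern_add_scale kern_twist a a' kern_const_zero)
    then have "kern n (\<lambda>x y. (1/h) * twist (\<i> * (z + h)) n a x y + (- 1/h) * a' x y + 0)"
      by (simp add: add.assoc)
    from kern_add_scale[OF kb this, of "-1"]
    have "kern n (\<lambda>x y. (-1) * b x y + ((1/h) * twist (\<i> * (z + h)) n a x y + (- 1/h) * a' x y + 0))" .
    ultimately show ?thesis by simp
  qed
  \<comment> \<open>Restricting to \<open>cmod h \<le> 1\<close> bounds the exponential in the
    remainder by \<open>exp c\<close>, so that the error is a fixed multiple of
    \<open>cmod h\<close>.\<close>
  have bound: "cmod (?q h x y) \<le> B * (exp c * c\<^sup>2 * cmod h)" if h: "h \<noteq> 0" "cmod h \<le> 1" for h x y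
  proof (cases "a' x y = 0")
    case True
    then show ?thesis unfolding q using B(1) c(1) by simp
  next
    case False
    have dc: "cmod (d x y) \<le> c" unfolding d_def using c(2)[OF False] by (simp add: norm_mult flip: of_real_diff)
    have hd: "cmod (h * d x y) \<le> 1 * c" unfolding norm_mult using dc h by (intro mult_mono) auto
    have "(exp (h * d x y) - 1) / h - d x y = (exp (h * d x y) - 1 - h * d x y) / h"
      using h by (simp add: field_simps)
    then have "cmod ((exp (h * d x y) - 1) / h - d x y) = cmod (exp (h * d x y) - 1 - h * d x y) / cmod h"
      by (simp add: norm_divide)
    also have "\<dots> \<le> (exp (cmod (h * d x y)) * (cmod (h * d x y))\<^sup>2) / cmod h"
      by (intro divide_right_mono exp_remainder) simp
    also have "\<dots> = exp (cmod (h * d x y)) * (cmod (d x y))\<^sup>2 * cmod h"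
      using h by (simp add: norm_mult power2_eq_square)
    also have "\<dots> \<le> exp c * c\<^sup>2 * cmod h"
      using hd dc c(1) by (intro mult_right_mono mult_mono power_mono) auto
    finally have "cmod ((exp (h * d x y) - 1) / h - d x y) \<le> exp c * c\<^sup>2 * cmod h" .
    then show ?thesis unfolding q norm_mult using B by (intro mult_mono) auto
  qed
  have le: "opnorm \<mu> (Kop n (?q h)) \<le> C * (B * (exp c * c\<^sup>2 * cmod h))" if h: "h \<noteq> 0" "cmod h \<le> 1" for h
  proof (rule opnorm_le)
    have nn: "0 \<le> B * (exp c * c\<^sup>2 * cmod h)" using B(1) by simp
    then show "0 \<le> C * (B * (exp c * c\<^sup>2 * cmod h))" using C(1) by simp
    show "opb \<mu> (Kop n (?q h)) (C * (B * (exp c * c\<^sup>2 * cmod h)))"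
      using C(2)[rule_format, OF kq nn bound[OF h]] by blast
  qed
  have op: "(\<lambda>\<eta> x. (Kop n (twist (\<i> * (z + h)) n a) \<eta> x - Kop n (twist (\<i> * z) n a) \<eta> x) / h - Kop n b \<eta> x)
      = Kop n (?q h)" for h
    by (simp add: fun_eq_iff Kop_def a'_def sum_subtractf[symmetric] sum_divide_distrib left_diff_distrib)
  have lim: "((\<lambda>h. C * (B * (exp c * c\<^sup>2 * cmod h))) \<longlongrightarrow> C * (B * (exp c * c\<^sup>2 * cmod 0))) (at (0::complex))"
    by (intro tendsto_intros)
  have "((\<lambda>h. opnorm \<mu> (Kop n (?q h))) \<longlongrightarrow> 0) (at 0)"
  proof (rule tendsto_sandwich[where f = "\<lambda>_. 0" and h = "\<lambda>h. C * (B * (exp c * c\<^sup>2 * cmod h))"])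
    show "\<forall>\<^sub>F h in at 0. 0 \<le> opnorm \<mu> (Kop n (?q h))"
      by (intro always_eventually allI opnorm_opb(2) is_bop_Kop kq)
    show "\<forall>\<^sub>F h in at 0. opnorm \<mu> (Kop n (?q h)) \<le> C * (B * (exp c * c\<^sup>2 * cmod h))"
      unfolding eventually_at by (intro exI[of _ 1]) (auto intro!: le)
  qed (use lim in auto)
  then show "\<exists>D. is_bop \<mu> D \<and>
      ((\<lambda>h. opnorm \<mu> (\<lambda>\<eta> x. (Kop n (twist (\<i> * (z + h)) n a) \<eta> x - Kop n (twist (\<i> * z) n a) \<eta> x) / h - D \<eta> x)) \<longlongrightarrow> 0) (at 0)"
    by (intro exI[of _ "Kop n b"] conjI is_bop_Kop kb) (simp only: op)
qed

lemma Hit_exp: "Hit H t n x = exp (\<i> * of_real t * of_real (energy n x))"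
  unfolding Hit_def energy_def birkhoff_def
  by (simp add: cis_conv_exp exp_sum sum_distrib_left ac_simps)

end

locale gibbs_flow = gibbs_dyn +
  fixes \<sigma> :: "real \<Rightarrow> op \<Rightarrow> op"
  assumes dyn: "is_dynamics k p \<mu> H \<sigma>"
begin

section \<open>The flow on kernel operators and analytic elements\<close>

lemma sigma_generator:
  assumes "continuous_on X f" "continuous_on X g"
  shows "op_eq \<mu> (\<sigma> t (Mop f \<circ> e_op k p n \<circ> Mop g))
       (Mop (\<lambda>x. f x * Hit H t n x) \<circ> e_op k p n \<circ> Mop (\<lambda>x. g x * cnj (Hit H t n x)))"
  using dyn assms unfolding is_dynamics_def by blast

lemma sigma_hom: "alg.star_hom (\<sigma> t)"
proof -
  have "op_eq \<mu> (\<sigma> t id) id"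
  proof -
    \<comment> \<open>Unitality is read off from the generator of level 0, where the empty product
      \<open>Hit H t 0\<close> is 1.\<close>
    have "id = Mop (\<lambda>_. 1) \<circ> e_op k p 0 \<circ> Mop (\<lambda>_. 1)" by (simp add: fun_eq_iff Mop_def e_op_def)
    moreover have "Mop (\<lambda>x. 1 * Hit H t 0 x) \<circ> e_op k p 0 \<circ> Mop (\<lambda>x. 1 * cnj (Hit H t 0 x)) = id"
      by (simp add: fun_eq_iff Mop_def e_op_def Hit_def)
    ultimately show ?thesis
      using sigma_generator[OF continuous_on_const continuous_on_const, of t 1 0 1] by simp
  qed
  then show ?thesis
    using dyn unfolding alg.star_hom_def is_dynamics_def by blast
qed

lemma sigma_Ualg: "A \<in> Ualg k p \<mu> \<Longrightarrow> \<sigma> t A \<in> Ualg k p \<mu>"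
  by (rule alg.hom_U[OF sigma_hom])

text \<open>Known for generators; a kernel is a finite sum of generator kernels, and both sides are
  additive up to \<open>op_eq\<close>.\<close>

lemma sigma_Kop:
  assumes a: "kern n a"
  shows "op_eq \<mu> (\<sigma> t (Kop n a)) (Kop n (twist (\<i> * of_real t) n a))"
proof -
  note hom = sigma_hom[of t]
  have gen: "op_eq \<mu> (\<sigma> t (Kop n (gker n f g))) (Kop n (twist (\<i> * of_real t) n (gker n f g)))"
    if fg: "continuous_on X f" "continuous_on X g" for f g
  proof -
    have Hc: "continuous_on X (Hit H t n)"
      unfolding Hit_exp by (intro continuous_intros continuous_energy)
    let ?f = "\<lambda>x. f x * Hit H t n x" and ?g = "\<lambda>x. g x * cnj (Hit H t n x)"
    have fg': "continuous_on X ?f" "continuous_on X ?g" by (intro continuous_on_mult continuous_on_cnj fg Hc)+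
    have "gker n ?f ?g = twist (\<i> * of_real t) n (gker n f g)"
    proof -
      have "Hit H t n x * cnj (Hit H t n y) = exp (\<i> * of_real t * of_real (energy n x - energy n y))" for x y
        unfolding Hit_exp exp_cnj exp_add[symmetric] by (simp add: right_diff_distrib)
      then show ?thesis by (simp add: fun_eq_iff gker_def on_rel_def twist_def ac_simps)
    qed
    then have e2: "op_eq \<mu> (Mop ?f \<circ> e_op k p n \<circ> Mop ?g) (Kop n (twist (\<i> * of_real t) n (gker n f g)))"
      using generator_bop(2)[OF fg', of n] by simp
    have e1: "op_eq \<mu> (\<sigma> t (Kop n (gker n f g))) (\<sigma> t (Mop f \<circ> e_op k p n \<circ> Mop g))"
      by (rule alg.hom_cong[OF hom Kop_Ualg[OF kern_gker[OF fg]] generator_Ualg[OF fg] op_eq_sym[OF generator_bop(2)[OF fg]]])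
    show ?thesis by (rule op_eq_trans[OF op_eq_trans[OF e1 sigma_generator[OF fg]] e2])
  qed
  obtain f g where "\<forall>w\<in>wds n. continuous_on X (f w) \<and> continuous_on X (g w)"
    and dec: "a = (\<lambda>x y. \<Sum>w\<in>wds n. gker n (f w) (g w) x y)" using kern_decompose[OF a] by blast
  then have fg: "continuous_on X (f w) \<and> continuous_on X (g w)" if "w \<in> wds n" for w using that by blast
  have "op_eq \<mu> (\<sigma> t (Kop n (\<lambda>x y. \<Sum>w\<in>W. gker n (f w) (g w) x y)))
      (Kop n (twist (\<i> * of_real t) n (\<lambda>x y. \<Sum>w\<in>W. gker n (f w) (g w) x y)))"
    if "finite W" "W \<subseteq> wds n" for W
    using that
  proof (induction W rule: finite_induct)
    case empty
    have z: "Kop n (\<lambda>x y. 0) = zero_op" "twist (\<i> * of_real t) n (\<lambda>x y. 0) = (\<lambda>x y. 0)"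
      by (simp_all add: fun_eq_iff Kop_def zero_op_def twist_def)
    have "op_eq \<mu> (\<sigma> t zero_op) zero_op"
      using alg.hom_lin[OF hom Ualg_id Ualg_id, of "-1"] by (simp add: zero_op_def op_add_def op_scale_def)
    then show ?case by (simp add: z)
  next
    case (insert w W)
    let ?b = "gker n (f w) (g w)" and ?c = "\<lambda>x y. \<Sum>w\<in>W. gker n (f w) (g w) x y"
    let ?T = "twist (\<i> * of_real t) n"
    have w: "w \<in> wds n" "W \<subseteq> wds n" using insert by auto
    have kb: "kern n ?b" using fg[OF w(1)] by (intro kern_gker) auto
    have kc: "kern n ?c" using fg w(2) by (intro kern_sum kern_gker) auto
    have s: "(\<lambda>x y. \<Sum>w\<in>insert w W. gker n (f w) (g w) x y) = (\<lambda>x y. 1 * ?b x y + ?c x y)"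
      using insert by simp
    have st: "?T (\<lambda>x y. 1 * ?b x y + ?c x y) = (\<lambda>x y. 1 * ?T ?b x y + ?T ?c x y)"
      by (simp add: fun_eq_iff twist_def distrib_right)
    have "op_eq \<mu> (\<sigma> t (op_add (op_scale 1 (Kop n ?b)) (Kop n ?c)))
        (op_add (op_scale 1 (\<sigma> t (Kop n ?b))) (\<sigma> t (Kop n ?c)))"
      by (rule alg.hom_lin[OF hom Kop_Ualg[OF kb] Kop_Ualg[OF kc]])
    moreover have "op_eq \<mu> (op_add (op_scale 1 (\<sigma> t (Kop n ?b))) (\<sigma> t (Kop n ?c)))
        (op_add (op_scale 1 (Kop n (?T ?b))) (Kop n (?T ?c)))"
      using fg[OF w(1)] insert.IH[OF w(2)] by (intro op_eq_add op_eq_scale gen) auto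
    ultimately show ?case
      unfolding s st Kop_add_scale[symmetric] by (rule op_eq_trans)
  qed
  from this[OF finite_wds subset_refl] show ?thesis unfolding dec[symmetric] .
qed

lemma sigma_contractive:
  assumes "A \<in> Ualg k p \<mu>" "opb \<mu> A s" "0 \<le> s" "s < t"
  shows "opb \<mu> (\<sigma> r A) t"
  by (rule alg.hom_contractive[OF sigma_hom assms])

text \<open>The factor 2 provides the strict gap that \<open>hom_contractive\<close> demands; any
  factor above 1 would serve.\<close>

lemma sigma_near:
  assumes A: "A \<in> Ualg k p \<mu>" and a: "kern n a" "opb \<mu> (op_diff A (Kop n a)) e" and e: "0 < e"
  shows "opb \<mu> (op_diff (\<sigma> t A) (Kop n (twist (\<i> * of_real t) n a))) (2 * e)"
proof -
  note KU = Kop_Ualg[OF a(1)]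
  have i: "op_diff A (Kop n a) = op_add (op_scale (-1) (Kop n a)) A"
    by (simp add: op_diff_def op_add_def op_scale_def)
  have D: "op_diff A (Kop n a) \<in> Ualg k p \<mu>" by (rule alg.U_diff[OF A KU])
  have 1: "opb \<mu> (\<sigma> t (op_diff A (Kop n a))) (2 * e)"
    by (rule sigma_contractive[OF D a(2)]) (use e in auto)
  have 2: "op_eq \<mu> (\<sigma> t (op_diff A (Kop n a))) (op_add (op_scale (-1) (\<sigma> t (Kop n a))) (\<sigma> t A))"
    unfolding i by (rule alg.hom_lin[OF sigma_hom KU A])
  have 3: "op_eq \<mu> (op_add (op_scale (-1) (\<sigma> t (Kop n a))) (\<sigma> t A))
      (op_add (op_scale (-1) (Kop n (twist (\<i> * of_real t) n a))) (\<sigma> t A))"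
    by (intro op_eq_add op_eq_scale op_eq_refl sigma_Kop a)
  have j: "op_add (op_scale (-1) (Kop n (twist (\<i> * of_real t) n a))) (\<sigma> t A)
      = op_diff (\<sigma> t A) (Kop n (twist (\<i> * of_real t) n a))"
    by (simp add: op_diff_def op_add_def op_scale_def)
  show ?thesis
    by (rule opb_op_eq[OF Ualg_bop[OF sigma_Ualg[OF D]]
          is_bop_diff[OF Ualg_bop[OF sigma_Ualg[OF A]] is_bop_Kop[OF kern_twist[OF a(1)]]]
          op_eq_trans[OF 2 3, unfolded j] 1])
qed

text \<open>Every kernel operator is analytic, and this is the supply of elements on which an
  unknown KMS state is tested.\<close>

lemma Kop_analytic_ext:
  assumes a: "kern n a"
  shows "analytic_ext k p \<mu> \<sigma> (Kop n a) (\<lambda>z. Kop n (twist (\<i> * z) n a))"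
  unfolding analytic_ext_def
  by (intro conjI allI Kop_Ualg kern_twist a twist_entire op_eq_sym[OF sigma_Kop])

lemma entire_functional:
  assumes F: "\<And>z. F z \<in> Ualg k p \<mu>" "op_entire \<mu> F"
    and lin: "\<And>A B c. A \<in> Ualg k p \<mu> \<Longrightarrow> B \<in> Ualg k p \<mu> \<Longrightarrow> \<Lambda> (op_add (op_scale c A) B) = c * \<Lambda> A + \<Lambda> B"
    and bd: "\<And>A e. A \<in> Ualg k p \<mu> \<Longrightarrow> opb \<mu> A e \<Longrightarrow> 0 \<le> e \<Longrightarrow> cmod (\<Lambda> A) \<le> K * e"
  shows "(\<lambda>z. \<Lambda> (F z)) holomorphic_on UNIV"
  unfolding holomorphic_on_def
proof
  fix z
  obtain D where D: "is_bop \<mu> D"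
    "((\<lambda>h. opnorm \<mu> (\<lambda>\<eta> x. (F (z + h) \<eta> x - F z \<eta> x) / h - D \<eta> x)) \<longlongrightarrow> 0) (at 0)"
    using F(2) unfolding op_entire_def by blast
  define Q where "Q h = op_scale (1 / h) (op_diff (F (z + h)) (F z))" for h
  have QU: "Q h \<in> Ualg k p \<mu>" for h unfolding Q_def by (intro alg.U_scale alg.U_diff F)
  have eq: "(\<lambda>\<eta> x. (F (z + h) \<eta> x - F z \<eta> x) / h - D \<eta> x) = op_diff (Q h) D" for h
    by (simp add: fun_eq_iff Q_def op_scale_def op_diff_def)
  have lim: "((\<lambda>h. opnorm \<mu> (op_diff (Q h) D)) \<longlongrightarrow> 0) (at 0)" using D(2) unfolding eq .
  have bo: "is_bop \<mu> (op_diff (Q h) D)" for h by (rule is_bop_diff[OF Ualg_bop[OF QU] D(1)])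
  \<comment> \<open>\<open>op_entire\<close> promises merely a bounded derivative, while the
    functional is controlled on the algebra; D lies there as a norm limit of difference
    quotients.\<close>
  have DU: "D \<in> Ualg k p \<mu>"
  proof (rule Ualg_closed[OF D(1)])
    fix e :: real assume "0 < e"
    with lim have "\<forall>\<^sub>F h in at 0. opnorm \<mu> (op_diff (Q h) D) < e" by (rule order_tendstoD(2))
    then obtain h where "opnorm \<mu> (op_diff (Q h) D) < e" using eventually_happens[of _ "at (0::complex)"] by auto
    then have "opb \<mu> (op_diff (Q h) D) e" by (rule opnorm_less[OF bo])
    then show "\<exists>B\<in>Ualg k p \<mu>. opb \<mu> (op_diff D B) e" using QU opb_diff_commute by blast
  qed
  have d: "\<Lambda> (op_diff A B) = \<Lambda> A - \<Lambda> B" if "A \<in> Ualg k p \<mu>" "B \<in> Ualg k p \<mu>" for A B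
    using lin[OF that(2,1), of "-1"] by (simp add: op_diff_def op_add_def op_scale_def)
  have zero: "\<Lambda> zero_op = 0" using d[OF Ualg_id Ualg_id] by (simp add: op_diff_def zero_op_def)
  have sc: "\<Lambda> (op_scale c A) = c * \<Lambda> A" if "A \<in> Ualg k p \<mu>" for c A
    using lin[OF that alg.U_zero, of c] zero by (simp add: zero_op_def op_add_def op_scale_def)
  have quot: "(\<Lambda> (F (z + h)) - \<Lambda> (F z)) / h = \<Lambda> (Q h)" for h
    unfolding Q_def using sc[OF alg.U_diff[OF F(1) F(1)]] d[OF F(1) F(1)] by simp
  have "((\<lambda>h. \<Lambda> (Q h) - \<Lambda> D) \<longlongrightarrow> 0) (at 0)"
  proof (rule Lim_null_comparison)
    show "\<forall>\<^sub>F h in at 0. norm (\<Lambda> (Q h) - \<Lambda> D) \<le> K * opnorm \<mu> (op_diff (Q h) D)"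
    proof (rule always_eventually, rule allI)
      fix h
      show "norm (\<Lambda> (Q h) - \<Lambda> D) \<le> K * opnorm \<mu> (op_diff (Q h) D)"
        unfolding d[OF QU DU, symmetric]
        by (rule bd[OF alg.U_diff[OF QU DU] opnorm_opb(1)[OF bo] opnorm_opb(2)[OF bo]])
    qed
    show "((\<lambda>h. K * opnorm \<mu> (op_diff (Q h) D)) \<longlongrightarrow> 0) (at 0)"
      using tendsto_mult[OF tendsto_const[of K] lim] by simp
  qed
  then have "((\<lambda>h. \<Lambda> (Q h)) \<longlongrightarrow> \<Lambda> D) (at 0)" by (simp add: LIM_zero_iff)
  then have "((\<lambda>z. \<Lambda> (F z)) has_field_derivative \<Lambda> D) (at z)"
    unfolding DERIV_def quot .
  then show "(\<lambda>z. \<Lambda> (F z)) field_differentiable at z within UNIV"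
    by (auto simp: field_differentiable_def)
qed

end

section \<open>Existence of the KMS state\<close>

locale gibbs_eigen = gibbs_flow +
  fixes \<beta> lam :: real and \<nu> :: "pt measure"
  assumes nu_prob: "prob_space \<nu>"
    and nu_sets: "sets \<nu> = sets (restrict_space borel X)"
    and nu_eigen: "\<forall>f. continuous_on X f \<longrightarrow>
      (\<integral>x. ruelle k (\<lambda>z. - \<beta> * ln (H z)) f x \<partial>\<nu>) = lam * (\<integral>x. f x \<partial>\<nu>)"
begin

section \<open>The eigenmeasure and its conformality\<close>

definition pot :: "pt \<Rightarrow> real" where "pot z = - \<beta> * ln (H z)"

lemma continuous_pot: "continuous_on X pot"
  unfolding pot_def[abs_def] by (intro continuous_on_mult continuous_on_const continuous_ln_H)

lemma birkhoff_pot: "birkhoff pot n x = - \<beta> * energy n x"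
  by (simp add: pot_def energy_def birkhoff_def sum_distrib_left sum_negf)

lemma space_nu: "space \<nu> = X"
  using sets_eq_imp_space_eq[OF nu_sets] by (simp add: space_restrict_space)

lemma nu_integrable:
  fixes f :: "pt \<Rightarrow> 'a::{banach, second_countable_topology}"
  assumes "continuous_on X f" shows "integrable \<nu> f"
proof -
  interpret prob_space \<nu> by (rule nu_prob)
  obtain B where "\<And>x. x \<in> X \<Longrightarrow> norm (f x) \<le> B" using bounded_X[OF assms] by blast
  moreover have "f \<in> borel_measurable \<nu>"
    using borel_measurable_continuous_on_restrict[OF assms] measurable_cong_sets[OF nu_sets refl] by blast
  ultimately show ?thesis by (intro integrable_const_bound[of _ B]) (auto simp: space_nu)
qed

definition pot_sum :: "nat \<Rightarrow> (pt \<Rightarrow> real) \<Rightarrow> pt \<Rightarrow> real" where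
  "pot_sum n f x = (\<Sum>y\<in>tail n x. exp (birkhoff pot n y) * f y)"

lemma ruelle_iterate: 
  "x \<in> X \<Longrightarrow> (ruelle k pot ^^ n) f ((shiftT ^^ n) x) = pot_sum n f x"
proof -
  assume x: "x \<in> X"
  have "(ruelle k pot ^^ n) f ((shiftT ^^ n) x)
    = (\<Sum>z | z \<in> X \<and> (shiftT ^^ n) z = (shiftT ^^ n) x. (\<Prod>j<n. exp (pot ((shiftT ^^ j) z))) * f z)"
    by (rule iterate_transfer) (simp_all add: ruelle_def shift_in x)
  then show ?thesis by (simp only: shift_fiber pot_sum_def birkhoff_def exp_sum[OF finite_lessThan])
qed

lemma continuous_pot_sum: "continuous_on X f \<Longrightarrow> continuous_on X (pot_sum n f)"
  unfolding pot_sum_def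
  by (intro continuous_tail_sum continuous_on_mult continuous_on_exp continuous_birkhoff continuous_pot)

lemma ruelle_pad: "x \<in> X \<Longrightarrow> (ruelle k pot ^^ n) f x = pot_sum n f (pad n x)"
  using ruelle_iterate[OF pad_in[of x n], of n f] by (simp add: shift_pad)

lemma continuous_ruelle_iterate:
  assumes "continuous_on X f" shows "continuous_on X ((ruelle k pot ^^ n) f)"
proof -
  have "continuous_on X (\<lambda>x. pot_sum n f (pad n x))"
    by (rule continuous_on_compose2[OF continuous_pot_sum[OF assms] continuous_pad]) (auto intro: pad_in)
  then show ?thesis by (rule continuous_on_eq) (simp add: ruelle_pad)
qed

lemma integral_ruelle_iterate:
  assumes f: "continuous_on X f"
  shows "(\<integral>x. (ruelle k pot ^^ n) f x \<partial>\<nu>) = lam ^ n * (\<integral>x. f x \<partial>\<nu>)"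
proof (induction n)
  case (Suc n)
  have "(\<integral>x. ruelle k pot ((ruelle k pot ^^ n) f) x \<partial>\<nu>) = lam * (\<integral>x. (ruelle k pot ^^ n) f x \<partial>\<nu>)"
    using nu_eigen continuous_ruelle_iterate[OF f] unfolding pot_def[abs_def] by blast
  then show ?case using Suc by simp
qed simp

text \<open>The image of the constant 1 under the transfer operator is bounded below by a positive
  number, and its integral is \<open>lam\<close>. Positivity allows \<open>lam ^ n\<close> to be
  cancelled.\<close>

lemma lam_pos: "0 < lam"
proof -
  interpret prob_space \<nu> by (rule nu_prob)
  have c: "continuous_on X (\<lambda>x. pot_sum 1 (\<lambda>_. 1) (pad 1 x))"
    by (rule continuous_on_compose2[OF continuous_pot_sum continuous_pad]) (auto intro: pad_in)
  have pos: "0 < pot_sum 1 (\<lambda>_. 1) (pad 1 x)" if "x \<in> X" for x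
    unfolding pot_sum_def using tail_refl[OF pad_in[OF that]] by (intro sum_pos finite_tail) auto
  obtain d where d: "0 < d" "\<And>x. x \<in> X \<Longrightarrow> d \<le> pot_sum 1 (\<lambda>_. 1) (pad 1 x)"
    using positive_X[OF c] pos by blast
  have "d = (\<integral>x. d \<partial>\<nu>)" by (simp add: prob_space)
  also have "\<dots> \<le> (\<integral>x. pot_sum 1 (\<lambda>_. 1) (pad 1 x) \<partial>\<nu>)"
    using d(2) by (intro integral_mono nu_integrable c) (auto simp: space_nu)
  also have "\<dots> = (\<integral>x. (ruelle k pot ^^ 1) (\<lambda>_. 1) x \<partial>\<nu>)"
    by (intro Bochner_Integration.integral_cong refl) (simp only: space_nu ruelle_pad)
  also have "\<dots> = lam" using integral_ruelle_iterate[of "\<lambda>_. 1" 1] by (simp add: prob_space del: funpow.simps)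
  finally show ?thesis using d(1) by simp
qed

text \<open>Equal weighted sums over tail classes mean equal n-th transfer iterates, whose integrals
  are \<open>lam ^ n\<close> times the integrals of f and g.\<close>

lemma nu_cong_real:
  assumes f: "continuous_on X f" "continuous_on X g"
    and eq: "\<And>x. x \<in> X \<Longrightarrow> pot_sum n f x = pot_sum n g x"
  shows "(\<integral>x. f x \<partial>\<nu>) = (\<integral>x. g x \<partial>\<nu>)"
proof -
  have "(\<integral>x. (ruelle k pot ^^ n) f x \<partial>\<nu>) = (\<integral>x. (ruelle k pot ^^ n) g x \<partial>\<nu>)"
    by (intro Bochner_Integration.integral_cong refl) (simp add: space_nu ruelle_pad eq pad_in)
  then show ?thesis using lam_pos by (simp add: integral_ruelle_iterate f)
qed

lemma continuous_row_sum:
  assumes F: "kern n F" shows "continuous_on X (\<lambda>x. \<Sum>y\<in>tail n x. F x y)"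
proof -
  have "continuous_on X (\<lambda>x. \<Sum>w\<in>wds n. F x (glue n w x))"
    by (intro continuous_on_sum kern_glue[OF F] wds_in)
  then show ?thesis by (rule continuous_on_eq) (simp add: sum_tail)
qed

definition transp :: "(pt \<Rightarrow> pt \<Rightarrow> complex) \<Rightarrow> pt \<Rightarrow> pt \<Rightarrow> complex" where
  "transp a x y = a y x"

lemma kern_transp:
  assumes a: "kern n a" shows "kern n (transp a)"
  unfolding kern_def transp_def
proof (intro conjI allI impI)
  show "a y x = 0" if "(x, y) \<notin> tail_rel n" for x y
    using that by (intro kern_zero[OF a]) (auto simp: tail_rel_def)
  show "continuous_on (tail_rel n) (\<lambda>z. a (snd z) (fst z))"
    by (intro kern_compose[OF a, where f = snd and g = fst] continuous_on_fst continuous_on_snd continuous_on_id)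
       (auto simp: tail_rel_def)
qed

text \<open>Conformality of \<open>\<nu>\<close> with respect to the tail relation; this is where the eigenvalue equation enters.\<close>
lemma nu_conformal:
  assumes F: "kern n F"
  shows "(\<integral>x. (\<Sum>y\<in>tail n x. F x y) \<partial>\<nu>) = (\<integral>x. (\<Sum>y\<in>tail n x. twist (of_real \<beta>) n (transp F) x y) \<partial>\<nu>)"
proof -
  let ?f = "\<lambda>x. \<Sum>y\<in>tail n x. F x y" and ?g = "\<lambda>x. \<Sum>y\<in>tail n x. twist (of_real \<beta>) n (transp F) x y"
  let ?e = "\<lambda>x. complex_of_real (exp (birkhoff pot n x))"
  have c: "continuous_on X ?f" "continuous_on X ?g"
    by (intro continuous_row_sum F kern_twist kern_transp)+
  have S: "(\<Sum>z\<in>tail n x. ?e z * ?f z) = (\<Sum>z\<in>tail n x. ?e z * ?g z)" for x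
  proof -
    have "(\<Sum>z\<in>tail n x. ?e z * ?f z) = (\<Sum>z\<in>tail n x. \<Sum>y\<in>tail n z. ?e z * F z y)"
      by (simp add: sum_distrib_left)
    also have "\<dots> = (\<Sum>y\<in>tail n x. \<Sum>z\<in>tail n y. ?e z * F z y)" by (rule sum_tail_swap) simp
    also have "\<dots> = (\<Sum>y\<in>tail n x. ?e y * ?g y)"
    proof (rule sum.cong[OF refl])
      fix y
      \<comment> \<open>The Birkhoff sum of the potential is \<open>- \<beta>\<close> times the
        energy, so replacing the Gibbs weight of z by that of y costs exactly the twist by
        \<open>\<beta>\<close>.\<close>
      have E: "?e z = ?e y * exp (of_real \<beta> * of_real (energy n y - energy n z))" for z
        unfolding exp_of_real[symmetric] exp_add[symmetric] by (simp add: birkhoff_pot algebra_simps)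
      have e: "?e z * F z y = ?e y * twist (of_real \<beta>) n (transp F) y z" for z
        by (subst E) (simp add: twist_def transp_def)
      show "(\<Sum>z\<in>tail n y. ?e z * F z y) = ?e y * ?g y" unfolding sum_distrib_left e ..
    qed
    finally show ?thesis .
  qed
  \<comment> \<open>The eigenvalue equation concerns real functions, hence real and imaginary parts
    are treated separately.\<close>
  have Re: "pot_sum n (\<lambda>x. Re (h x)) x = Re (\<Sum>z\<in>tail n x. ?e z * h z)"
    and Im: "pot_sum n (\<lambda>x. Im (h x)) x = Im (\<Sum>z\<in>tail n x. ?e z * h z)" for h x
    by (simp_all add: pot_sum_def)
  have "(\<integral>x. Re (?f x) \<partial>\<nu>) = (\<integral>x. Re (?g x) \<partial>\<nu>)"
    by (rule nu_cong_real[where n = n, OF continuous_on_Re[OF c(1)] continuous_on_Re[OF c(2)]]) (simp only: Re S)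
  then have 1: "Re (\<integral>x. ?f x \<partial>\<nu>) = Re (\<integral>x. ?g x \<partial>\<nu>)"
    unfolding integral_Re[OF nu_integrable[OF c(1)]] integral_Re[OF nu_integrable[OF c(2)]] .
  have "(\<integral>x. Im (?f x) \<partial>\<nu>) = (\<integral>x. Im (?g x) \<partial>\<nu>)"
    by (rule nu_cong_real[where n = n, OF continuous_on_Im[OF c(1)] continuous_on_Im[OF c(2)]]) (simp only: Im S)
  then have 2: "Im (\<integral>x. ?f x \<partial>\<nu>) = Im (\<integral>x. ?g x \<partial>\<nu>)"
    unfolding integral_Im[OF nu_integrable[OF c(1)]] integral_Im[OF nu_integrable[OF c(2)]] .
  show ?thesis by (rule complex_eqI[OF 1 2])
qed

definition dg :: "(pt \<Rightarrow> pt \<Rightarrow> complex) \<Rightarrow> complex" where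
  "dg a = (\<integral>x. a x x \<partial>\<nu>)"

text \<open>\<open>diag_bound\<close> holds at every point of \<open>X\<close>, so it can be
  integrated against a measure that has no relation to \<open>\<mu>\<close>.\<close>

lemma dg_bound:
  assumes a: "kern n a" and C: "opb \<mu> (Kop n a) C"
  shows "cmod (dg a) \<le> C"
proof -
  interpret prob_space \<nu> by (rule nu_prob)
  have "cmod (dg a) \<le> (\<integral>x. cmod (a x x) \<partial>\<nu>)" unfolding dg_def by (rule integral_norm_bound)
  also have "\<dots> \<le> (\<integral>x. C \<partial>\<nu>)"
    using diag_bound[OF a C]
    by (intro integral_mono nu_integrable continuous_on_norm kern_diag[OF a]) (auto simp: space_nu)
  finally show ?thesis by (simp add: prob_space)
qed

lemma dg_add_scale:
  assumes "kern n a" "kern n b" shows "dg (\<lambda>x y. c * a x y + b x y) = c * dg a + dg b"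
proof -
  have "integrable \<nu> (\<lambda>x. a x x)" "integrable \<nu> (\<lambda>x. b x x)"
    by (intro nu_integrable kern_diag[OF assms(1)], intro nu_integrable kern_diag[OF assms(2)])
  then show ?thesis unfolding dg_def by simp
qed

lemma dg_lipschitz:
  assumes A: "is_bop \<mu> A" and a: "kern n a" "opb \<mu> (op_diff A (Kop n a)) d"
    and b: "kern m b" "opb \<mu> (op_diff A (Kop m b)) e"
  shows "cmod (dg a - dg b) \<le> d + e"
proof -
  obtain l where l: "kern l a" "kern l b" "Kop l a = Kop n a" "Kop l b = Kop m b"
    using common_level[OF a(1) b(1)] .
  have "opb \<mu> (op_diff (Kop n a) (Kop m b)) (d + e)"
    by (rule opb_triangle[OF is_bop_Kop[OF a(1)] A is_bop_Kop[OF b(1)] opb_diff_commute[OF a(2)] b(2)])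
  then have o: "opb \<mu> (Kop l (\<lambda>x y. (-1) * b x y + a x y)) (d + e)"
    unfolding l(3,4)[symmetric] Kop_diff by (simp add: algebra_simps)
  from dg_bound[OF kern_add_scale[OF l(2,1)] o] show ?thesis
    by (simp only: dg_add_scale[OF l(2,1)]) simp
qed

text \<open>The value on the dense subalgebra is integration of the diagonal; in general \<open>psi A\<close> is the
  unique limit along approximating kernels.\<close>
definition psi :: "op \<Rightarrow> complex" where
  "psi A = (SOME c. \<forall>n a e. kern n a \<longrightarrow> opb \<mu> (op_diff A (Kop n a)) e \<longrightarrow> cmod (c - dg a) \<le> e)"

text \<open>Justifies the choice in \<open>psi\<close>: along kernels at distance
  \<open>(1/2) ^ j\<close> the diagonal integrals are Cauchy by \<open>dg_lipschitz\<close>, and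
  their limit satisfies the estimate for all approximating kernels at once.\<close>

lemma psi_near:
  assumes A: "A \<in> Ualg k p \<mu>" and a: "kern n a" "opb \<mu> (op_diff A (Kop n a)) e"
  shows "cmod (psi A - dg a) \<le> e"
proof -
  note bA = Ualg_bop[OF A]
  have "\<forall>j. \<exists>na. kern (fst na) (snd na) \<and> opb \<mu> (op_diff A (Kop (fst na) (snd na))) ((1/2) ^ j)"
  proof
    fix j :: nat
    obtain n a where "kern n a" "opb \<mu> (op_diff A (Kop n a)) ((1/2) ^ j)" by (rule Ualg_approx[OF A, of "(1/2)^j"]) auto
    then show "\<exists>na. kern (fst na) (snd na) \<and> opb \<mu> (op_diff A (Kop (fst na) (snd na))) ((1/2) ^ j)"
      by (intro exI[of _ "(n, a)"]) simp
  qed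
  from choice[OF this] obtain na where na: "\<And>j. kern (fst (na j)) (snd (na j))"
    "\<And>j. opb \<mu> (op_diff A (Kop (fst (na j)) (snd (na j)))) ((1/2) ^ j)" by blast
  define c where "c j = dg (snd (na j))" for j
  have "Cauchy c"
  proof (rule metric_CauchyI)
    fix e :: real assume e: "0 < e"
    obtain N :: nat where N: "2 * (1/2::real) ^ N < e" by (rule geometric_less[OF e, of "1/2" 2]) auto
    have "dist (c i) (c j) < e" if "N \<le> i" "N \<le> j" for i j
    proof -
      have "(1/2::real) ^ i \<le> (1/2) ^ N" "(1/2::real) ^ j \<le> (1/2) ^ N" using that by (auto intro: power_decreasing)
      moreover have "dist (c i) (c j) \<le> (1/2) ^ i + (1/2) ^ j"
        unfolding c_def dist_norm by (rule dg_lipschitz[OF bA na na])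
      ultimately show ?thesis using N by linarith
    qed
    then show "\<exists>N. \<forall>i\<ge>N. \<forall>j\<ge>N. dist (c i) (c j) < e" by blast
  qed
  then obtain l where l: "c \<longlonglongrightarrow> l" using Cauchy_convergent_iff convergent_def by blast
  have "cmod (l - dg b) \<le> d" if b: "kern m b" "opb \<mu> (op_diff A (Kop m b)) d" for m b d
  proof (rule LIMSEQ_le)
    show "(\<lambda>j. cmod (c j - dg b)) \<longlonglongrightarrow> cmod (l - dg b)" by (intro tendsto_intros l)
    have "(\<lambda>j. (1/2) ^ j + d) \<longlonglongrightarrow> 0 + d" by (intro tendsto_intros LIMSEQ_realpow_zero) auto
    then show "(\<lambda>j. (1/2) ^ j + d) \<longlonglongrightarrow> d" by simp
    show "\<exists>N. \<forall>j\<ge>N. cmod (c j - dg b) \<le> (1/2) ^ j + d"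
      unfolding c_def using dg_lipschitz[OF bA na b] by blast
  qed
  then have "\<exists>c. \<forall>n a e. kern n a \<longrightarrow> opb \<mu> (op_diff A (Kop n a)) e \<longrightarrow> cmod (c - dg a) \<le> e" by blast
  from someI_ex[OF this, folded psi_def] a show ?thesis by blast
qed

lemma psi_eqI:
  assumes A: "A \<in> Ualg k p \<mu>"
    and ap: "\<And>e. 0 < e \<Longrightarrow> \<exists>n a. kern n a \<and> opb \<mu> (op_diff A (Kop n a)) (K * e) \<and> cmod (c - dg a) \<le> K * e"
    and K: "0 \<le> K"
  shows "psi A = c"
proof -
  have "cmod (psi A - c) \<le> 0 + e" if e: "0 < e" for e
  proof -
    have "\<exists>e'. 0 < e' \<and> e' * (2 * K) \<le> e"
      by (intro exI[of _ "e / (2 * K + 1)"] conjI shrink_pos) (use K e in auto)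
    then obtain e' where e': "0 < e'" "e' * (2 * K) \<le> e" by blast
    obtain n a where a: "kern n a" "opb \<mu> (op_diff A (Kop n a)) (K * e')" "cmod (c - dg a) \<le> K * e'"
      using ap[OF e'(1)] by blast
    have "cmod (psi A - c) \<le> cmod (psi A - dg a) + cmod (c - dg a)"
      using norm_triangle_ineq4[of "psi A - dg a" "c - dg a"] by simp
    also have "\<dots> \<le> K * e' + K * e'" by (rule add_mono[OF psi_near[OF A a(1,2)] a(3)])
    also have "\<dots> \<le> e" using e'(2) by (simp add: algebra_simps)
    finally show ?thesis by simp
  qed
  then have "cmod (psi A - c) \<le> 0" by (rule field_le_epsilon)
  then show ?thesis by simp
qed

lemma psi_Kop: "kern n a \<Longrightarrow> psi (Kop n a) = dg a"
proof -
  assume a: "kern n a"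
  have "opb \<mu> (op_diff (Kop n a) (Kop n a)) 0" by (simp add: opb_def op_diff_def l2norm_def)
  from psi_near[OF Kop_Ualg[OF a] a this] show ?thesis by simp
qed

lemma psi_bound:
  assumes A: "A \<in> Ualg k p \<mu>" "opb \<mu> A C"
  shows "cmod (psi A) \<le> C"
proof (rule field_le_epsilon)
  fix e :: real assume e: "0 < e"
  obtain n a where a: "kern n a" "opb \<mu> (op_diff A (Kop n a)) (e/2)" using Ualg_approx[OF A(1), of "e/2"] e by auto
  have "Kop n a = op_diff A (op_diff A (Kop n a))" by (simp add: op_diff_def)
  moreover have "opb \<mu> (op_diff A (op_diff A (Kop n a))) (C + e/2)"
    by (intro opb_diff is_bop_diff Ualg_bop[OF A(1)] is_bop_Kop a A)
  ultimately have "cmod (dg a) \<le> C + e/2" using dg_bound[OF a(1)] by simp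
  then show "cmod (psi A) \<le> C + e"
    using psi_near[OF A(1) a] norm_triangle_ineq2[of "psi A" "dg a"] by linarith
qed

lemma psi_linear:
  assumes A: "A \<in> Ualg k p \<mu>" and B: "B \<in> Ualg k p \<mu>"
  shows "psi (op_add (op_scale c A) B) = c * psi A + psi B"
proof (rule psi_eqI[OF Ualg_lin[OF A B], where K = "cmod c + 1"])
  fix e :: real assume e: "0 < e"
  note bo = Ualg_bop[OF A] Ualg_bop[OF B]
  obtain n a where a: "kern n a" "opb \<mu> (op_diff A (Kop n a)) e" using Ualg_approx[OF A e] .
  obtain m b where b: "kern m b" "opb \<mu> (op_diff B (Kop m b)) e" using Ualg_approx[OF B e] .
  obtain l where l: "kern l a" "kern l b" "Kop l a = Kop n a" "Kop l b = Kop m b"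
    using common_level[OF a(1) b(1)] .
  let ?d = "\<lambda>x y. c * a x y + b x y"
  have "op_diff (op_add (op_scale c A) B) (Kop l ?d) = op_add (op_scale c (op_diff A (Kop l a))) (op_diff B (Kop l b))"
    unfolding Kop_add_scale[symmetric] by (simp add: fun_eq_iff op_diff_def op_add_def op_scale_def algebra_simps)
  moreover have "opb \<mu> (op_add (op_scale c (op_diff A (Kop l a))) (op_diff B (Kop l b))) (cmod c * e + e)"
    using a(2) b(2) l by (intro opb_add opb_scale is_bop_scale is_bop_diff is_bop_Kop bo) auto
  ultimately have o: "opb \<mu> (op_diff (op_add (op_scale c A) B) (Kop l ?d)) ((cmod c + 1) * e)"
    by (simp add: algebra_simps)
  have "cmod (c * psi A + psi B - dg ?d) = cmod (c * (psi A - dg a) + (psi B - dg b))"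
    unfolding dg_add_scale[OF l(1,2)] by (simp add: algebra_simps)
  also have "\<dots> \<le> cmod c * cmod (psi A - dg a) + cmod (psi B - dg b)"
    using norm_triangle_ineq[of "c * (psi A - dg a)"] by (simp add: norm_mult)
  also have "\<dots> \<le> cmod c * e + e"
    by (intro add_mono mult_left_mono psi_near[OF A a] psi_near[OF B b]) simp
  finally have "cmod (c * psi A + psi B - dg ?d) \<le> (cmod c + 1) * e" by (simp add: algebra_simps)
  with o kern_add_scale[OF l(1,2)]
  show "\<exists>n d. kern n d \<and> opb \<mu> (op_diff (op_add (op_scale c A) B) (Kop n d)) ((cmod c + 1) * e) \<and>
      cmod (c * psi A + psi B - dg d) \<le> (cmod c + 1) * e" by blast
qed simp

lemma psi_diff:
  "A \<in> Ualg k p \<mu> \<Longrightarrow> B \<in> Ualg k p \<mu> \<Longrightarrow> psi (op_diff A B) = psi A - psi B"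
  using psi_linear[of B A "-1"] by (simp add: op_diff_def op_add_def op_scale_def)

lemma psi_cong:
  assumes "A \<in> Ualg k p \<mu>" "B \<in> Ualg k p \<mu>" "op_eq \<mu> A B" shows "psi A = psi B"
  using psi_bound[OF alg.U_diff[OF assms(1,2)] opb_op_eq_zero[OF Ualg_bop[OF assms(1)] Ualg_bop[OF assms(2)] assms(3)]]
  by (simp add: psi_diff assms)

lemma psi_one: "psi id = 1"
proof -
  interpret prob_space \<nu> by (rule nu_prob)
  have id: "id = Mop (\<lambda>_. 1) \<circ> e_op k p 0 \<circ> Mop (\<lambda>_. 1)" by (simp add: fun_eq_iff Mop_def e_op_def)
  have g: "kern 0 (gker 0 (\<lambda>_. 1) (\<lambda>_. 1))" by (intro kern_gker continuous_on_const)
  have "op_eq \<mu> id (Kop 0 (gker 0 (\<lambda>_. 1) (\<lambda>_. 1)))"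
    by (subst id) (intro generator_bop continuous_on_const)
  then have "psi id = dg (gker 0 (\<lambda>_. 1) (\<lambda>_. 1))"
    using psi_cong[OF Ualg_id Kop_Ualg[OF g]] psi_Kop[OF g] by simp
  also have "\<dots> = (\<integral>x. 1 \<partial>\<nu>)"
    unfolding dg_def by (intro Bochner_Integration.integral_cong refl)
      (simp add: gker_def on_rel_def weight_def tail_rel_iff tail_refl space_nu)
  finally show ?thesis by (simp add: prob_space)
qed

text \<open>On the diagonal the convolution of the adjoint kernel with the kernel is a sum of
  squares with positive quotients of weights as coefficients.\<close>

lemma dg_kadj_nonneg:
  assumes a: "kern n a"
  shows "Im (dg (kmul n (kadj n a) a)) = 0 \<and> 0 \<le> Re (dg (kmul n (kadj n a) a))"
proof -
  let ?s = "\<lambda>x. \<Sum>y\<in>tail n x. (cmod (a y x))\<^sup>2 * (weight n y / weight n x)"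
  have "kmul n (kadj n a) a x x = of_real (?s x)" if x: "x \<in> X" for x
    unfolding kmul_def of_real_sum
    by (rule sum.cong[OF refl])
       (simp add: kadj_def on_rel_def tail_rel_iff x complex_norm_square ac_simps del: of_real_power)
  then have "dg (kmul n (kadj n a) a) = (\<integral>x. of_real (?s x) \<partial>\<nu>)"
    unfolding dg_def by (intro Bochner_Integration.integral_cong refl) (simp add: space_nu)
  moreover have "(\<integral>x. complex_of_real (?s x) \<partial>\<nu>) = of_real (\<integral>x. ?s x \<partial>\<nu>)"
    by (rule integral_complex_of_real)
  ultimately have e: "dg (kmul n (kadj n a) a) = of_real (\<integral>x. ?s x \<partial>\<nu>)" by simp
  have "0 \<le> ?s x" if x: "x \<in> X" for x
    using weight_pos x tail_in by (intro sum_nonneg mult_nonneg_nonneg divide_nonneg_nonneg) (auto intro: less_imp_le)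
  then have "0 \<le> (\<integral>x. ?s x \<partial>\<nu>)" by (intro integral_nonneg_AE AE_I2) (simp add: space_nu)
  with e show ?thesis by simp
qed

lemma psi_pos:
  assumes A: "A \<in> Ualg k p \<mu>"
  shows "Im (psi (op_adj \<mu> A \<circ> A)) = 0 \<and> 0 \<le> Re (psi (op_adj \<mu> A \<circ> A))"
proof -
  let ?B = "op_adj \<mu> A"
  note bA = Ualg_bop[OF A]
  note B = Ualg_has_adj[OF A]
  obtain C where C: "0 \<le> C" "opb \<mu> A C" using bop_opb[OF bA] .
  have CB: "opb \<mu> ?B C" by (rule adj_opb[OF bA B(1,2) C(2)])
  have BA: "?B \<circ> A \<in> Ualg k p \<mu>" by (rule Ualg_comp[OF B(3) A])
  have near: "\<exists>r::real. 0 \<le> r \<and> cmod (psi (?B \<circ> A) - of_real r) \<le> e" if e: "0 < e" for e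
  proof -
    \<comment> \<open>The product error \<open>C * e1 + e1 * (C + e1)\<close> is at most
      \<open>(2 * C + 1) * e1\<close> as soon as \<open>e1\<close> is at most 1.\<close>
    define K where "K = 2 * C + 1"
    define e1 where "e1 = min 1 (e / (K + 1))"
    have K: "0 \<le> K" using C by (simp add: K_def)
    have e1: "0 < e1" "e1 \<le> 1" using shrink_pos(1)[OF K e] by (auto simp: e1_def)
    have "e1 * K \<le> e / (K + 1) * K" by (intro mult_right_mono K) (simp add: e1_def)
    then have e1K: "e1 * K \<le> e" using shrink_pos(2)[OF K e] by linarith
    obtain n a where a: "kern n a" "opb \<mu> (op_diff A (Kop n a)) e1" using Ualg_approx[OF A e1(1)] .
    note b' = adj_approx_Kop[OF bA B(1,2) a]
    have oa: "opb \<mu> (Kop n a) (C + e1)"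
    proof -
      have "Kop n a = op_diff A (op_diff A (Kop n a))" by (simp add: op_diff_def)
      moreover have "opb \<mu> (op_diff A (op_diff A (Kop n a))) (C + e1)"
        by (intro opb_diff is_bop_diff bA is_bop_Kop a C)
      ultimately show ?thesis by simp
    qed
    have "opb \<mu> (op_diff (?B \<circ> A) (Kop n (kadj n a) \<circ> Kop n a)) (C * e1 + e1 * (C + e1))"
      using e1 by (intro opb_comp_diff B bA is_bop_Kop kern_kadj a CB oa C b') auto
    then have o: "opb \<mu> (op_diff (?B \<circ> A) (Kop n (kmul n (kadj n a) a))) (C * e1 + e1 * (C + e1))"
      unfolding Kop_comp .
    have "C * e1 + e1 * (C + e1) \<le> e"
    proof -
      have "e1 * e1 \<le> e1 * 1" using e1 by (intro mult_left_mono) auto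
      then show ?thesis using e1K by (simp add: K_def algebra_simps)
    qed
    with psi_near[OF BA kern_kmul[OF kern_kadj[OF a(1)] a(1)] o]
    have "cmod (psi (?B \<circ> A) - dg (kmul n (kadj n a) a)) \<le> e" by linarith
    moreover have "dg (kmul n (kadj n a) a) = of_real (Re (dg (kmul n (kadj n a) a)))"
      using dg_kadj_nonneg[OF a(1)] by (simp add: complex_eq_iff)
    ultimately show ?thesis using dg_kadj_nonneg[OF a(1)]
      by (intro exI[of _ "Re (dg (kmul n (kadj n a) a))"]) auto
  qed
  have "\<bar>Im (psi (?B \<circ> A))\<bar> \<le> 0 + e \<and> 0 \<le> Re (psi (?B \<circ> A)) + e" if e: "0 < e" for e
  proof -
    obtain r :: real where r: "0 \<le> r" "cmod (psi (?B \<circ> A) - of_real r) \<le> e" using near[OF e] by blast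
    have "\<bar>Im (psi (?B \<circ> A) - of_real r)\<bar> \<le> e" "\<bar>Re (psi (?B \<circ> A) - of_real r)\<bar> \<le> e"
      using r(2) abs_Im_le_cmod abs_Re_le_cmod order_trans by blast+
    then show ?thesis using r(1) by (simp add: abs_le_iff)
  qed
  then have i: "\<bar>Im (psi (?B \<circ> A))\<bar> \<le> 0" and r: "0 \<le> Re (psi (?B \<circ> A))"
    by (blast intro: field_le_epsilon)+
  then show ?thesis by simp
qed

lemma is_state_iff: "is_state k p \<mu> \<psi> \<longleftrightarrow> alg.state_on \<psi>"
  unfolding is_state_def alg.state_on_def ..

lemma psi_state: "alg.state_on psi"
  unfolding alg.state_on_def using psi_cong psi_linear psi_pos psi_one by blast

text \<open>A twist does not change the diagonal of a kernel; general elements follow by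
  approximation, the flow being norm continuous.\<close>

lemma psi_sigma:
  assumes A: "A \<in> Ualg k p \<mu>" shows "psi (\<sigma> t A) = psi A"
proof (rule psi_eqI[OF sigma_Ualg[OF A], where K = 2])
  fix e :: real assume e: "0 < e"
  obtain n a where a: "kern n a" "opb \<mu> (op_diff A (Kop n a)) e" using Ualg_approx[OF A e] .
  have "dg (twist (\<i> * of_real t) n a) = dg a" by (simp add: dg_def twist_def)
  moreover have "cmod (psi A - dg a) \<le> 2 * e" using psi_near[OF A a] e by linarith
  ultimately show "\<exists>n a. kern n a \<and> opb \<mu> (op_diff (\<sigma> t A) (Kop n a)) (2 * e) \<and> cmod (psi A - dg a) \<le> 2 * e"
    using sigma_near[OF A a e] kern_twist[OF a(1)] by metis
qed simp

text \<open>Conformality applied to the kernel \<open>a x y * b y x\<close>, whose row sums are the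
  diagonal of the convolution. This is the KMS identity at the level of kernels, with the twist by
  \<open>\<beta>\<close> on the second factor.\<close>

lemma dg_swap:
  assumes a: "kern n a" and b: "kern n b"
  shows "dg (kmul n a b) = dg (kmul n (twist (of_real \<beta>) n b) a)"
proof -
  let ?F = "\<lambda>x y. a x y * transp b x y"
  have F: "kern n ?F"
    unfolding kern_def
    by (intro conjI allI impI continuous_on_mult kern_cont[OF a] kern_cont[OF kern_transp[OF b]])
       (simp add: kern_zero[OF a])
  have "dg (kmul n a b) = (\<integral>x. (\<Sum>y\<in>tail n x. ?F x y) \<partial>\<nu>)" by (simp add: dg_def kmul_def transp_def)
  also have "\<dots> = (\<integral>x. (\<Sum>y\<in>tail n x. twist (of_real \<beta>) n (transp ?F) x y) \<partial>\<nu>)" by (rule nu_conformal[OF F])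
  also have "\<dots> = dg (kmul n (twist (of_real \<beta>) n b) a)"
    by (simp add: dg_def kmul_def transp_def twist_def ac_simps)
  finally show ?thesis .
qed

section \<open>From kernels to the full KMS condition\<close>

lemma psi_functional:
  assumes B: "B \<in> Ualg k p \<mu>"
  obtains K where "0 \<le> K"
    "\<And>A e. A \<in> Ualg k p \<mu> \<Longrightarrow> opb \<mu> A e \<Longrightarrow> 0 \<le> e \<Longrightarrow> cmod (psi (B \<circ> A)) \<le> K * e"
    "\<And>A e. A \<in> Ualg k p \<mu> \<Longrightarrow> opb \<mu> A e \<Longrightarrow> 0 \<le> e \<Longrightarrow> cmod (psi (A \<circ> B)) \<le> K * e"
proof -
  obtain K where K: "0 \<le> K" "opb \<mu> B K" using bop_opb[OF Ualg_bop[OF B]] .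
  show thesis
  proof (rule that[OF K(1)])
    fix A and e :: real assume A: "A \<in> Ualg k p \<mu>" "opb \<mu> A e" "0 \<le> e"
    show "cmod (psi (B \<circ> A)) \<le> K * e"
      by (intro psi_bound Ualg_comp B A opb_comp Ualg_bop[OF A(1)] K)
    have "cmod (psi (A \<circ> B)) \<le> e * K"
      by (intro psi_bound Ualg_comp B A opb_comp Ualg_bop[OF B] K)
    then show "cmod (psi (A \<circ> B)) \<le> K * e" by (simp add: mult.commute)
  qed
qed

lemma psi_comp_linear_right:
  assumes B: "B \<in> Ualg k p \<mu>" and A: "A \<in> Ualg k p \<mu>" "C \<in> Ualg k p \<mu>"
  shows "psi (B \<circ> op_add (op_scale c A) C) = c * psi (B \<circ> A) + psi (B \<circ> C)"
proof -
  have "psi (B \<circ> op_add (op_scale c A) C) = psi (op_add (op_scale c (B \<circ> A)) (B \<circ> C))"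
    by (rule psi_cong[OF Ualg_comp[OF B Ualg_lin[OF A]] Ualg_lin[OF Ualg_comp[OF B A(1)] Ualg_comp[OF B A(2)]]
          op_eq_comp_add_right[OF Ualg_bop[OF B] Ualg_bop[OF A(1)] Ualg_bop[OF A(2)]]])
  then show ?thesis using psi_linear[OF Ualg_comp[OF B A(1)] Ualg_comp[OF B A(2)]] by simp
qed

lemma psi_comp_linear_left:
  assumes B: "B \<in> Ualg k p \<mu>" and A: "A \<in> Ualg k p \<mu>" "C \<in> Ualg k p \<mu>"
  shows "psi (op_add (op_scale c A) C \<circ> B) = c * psi (A \<circ> B) + psi (C \<circ> B)"
  unfolding comp_add_left by (rule psi_linear[OF Ualg_comp[OF A(1) B] Ualg_comp[OF A(2) B]])

lemma approx_zero:
  fixes x :: complex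
  assumes "\<And>e. 0 < e \<Longrightarrow> cmod x \<le> K * e" "0 \<le> K" shows "x = 0"
proof -
  have "cmod x \<le> 0 + e" if e: "0 < e" for e
    using assms(1)[OF shrink_pos(1)[OF assms(2) e]] shrink_pos(2)[OF assms(2) e] by (simp add: ac_simps)
  then have "cmod x \<le> 0" by (rule field_le_epsilon)
  then show ?thesis by simp
qed

text \<open>The kernel is the factor that gets twisted, since the twist by \<open>\<beta>\<close> is
  an explicit formula only there. The other factor enters without a twist and may be
  approximated.\<close>

lemma psi_swap_Kop:
  assumes A: "A \<in> Ualg k p \<mu>" and b: "kern n b"
  shows "psi (A \<circ> Kop n b) = psi (Kop n (twist (of_real \<beta>) n b) \<circ> A)"
proof -
  let ?b = "twist (of_real \<beta>) n b"
  note bU = Kop_Ualg[OF b] and tU = Kop_Ualg[OF kern_twist[OF b, of "of_real \<beta>"]]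
  obtain K1 where K1: "0 \<le> K1" "\<And>A e. A \<in> Ualg k p \<mu> \<Longrightarrow> opb \<mu> A e \<Longrightarrow> 0 \<le> e \<Longrightarrow> cmod (psi (A \<circ> Kop n b)) \<le> K1 * e"
    using psi_functional[OF bU] by metis
  obtain K2 where K2: "0 \<le> K2" "\<And>A e. A \<in> Ualg k p \<mu> \<Longrightarrow> opb \<mu> A e \<Longrightarrow> 0 \<le> e \<Longrightarrow> cmod (psi (Kop n ?b \<circ> A)) \<le> K2 * e"
    using psi_functional[OF tU] by metis
  have "psi (A \<circ> Kop n b) - psi (Kop n ?b \<circ> A) = 0"
  proof (rule approx_zero[where K = "K1 + K2"])
    fix e :: real assume e: "0 < e"
    obtain m a where a: "kern m a" "opb \<mu> (op_diff A (Kop m a)) e" using Ualg_approx[OF A e] .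
    \<comment> \<open>The common level has to be at least n, so that the twist of b can be computed
      there.\<close>
    obtain l where l: "kern l a" "kern l b" "Kop l a = Kop m a" "Kop l b = Kop n b" "n \<le> l"
    proof (rule that[of "max m n"])
      show "kern (max m n) a" "kern (max m n) b" using kern_mono[OF _ a(1)] kern_mono[OF _ b] by auto
      show "Kop (max m n) a = Kop m a" by (rule Kop_mono[OF _ a(1)]) simp
      show "Kop (max m n) b = Kop n b" by (rule Kop_mono[OF _ b]) simp
    qed simp
    have tl: "Kop n ?b = Kop l (twist (of_real \<beta>) l b)"
      unfolding twist_mono[OF l(5) b] by (rule Kop_mono[OF l(5) kern_twist[OF b], symmetric])
    note aU = Kop_Ualg[OF a(1)]
    have D: "op_diff A (Kop m a) \<in> Ualg k p \<mu>" by (rule alg.U_diff[OF A aU])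
    have i: "A = op_add (op_scale 1 (op_diff A (Kop m a))) (Kop m a)" by (simp add: op_add_def op_scale_def op_diff_def)
    have "psi (Kop m a \<circ> Kop n b) = psi (Kop n ?b \<circ> Kop m a)"
      unfolding tl l(3,4)[symmetric] Kop_comp
      unfolding psi_Kop[OF kern_kmul[OF l(1,2)]] psi_Kop[OF kern_kmul[OF kern_twist[OF l(2)] l(1)]]
      by (rule dg_swap[OF l(1,2)])
    moreover have "psi (A \<circ> Kop n b) = 1 * psi (op_diff A (Kop m a) \<circ> Kop n b) + psi (Kop m a \<circ> Kop n b)"
      using psi_comp_linear_left[OF bU D aU, of 1] unfolding i[symmetric] .
    moreover have "psi (Kop n ?b \<circ> A) = 1 * psi (Kop n ?b \<circ> op_diff A (Kop m a)) + psi (Kop n ?b \<circ> Kop m a)"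
      using psi_comp_linear_right[OF tU D aU, of 1] unfolding i[symmetric] .
    ultimately have eq: "psi (A \<circ> Kop n b) - psi (Kop n ?b \<circ> A)
        = psi (op_diff A (Kop m a) \<circ> Kop n b) - psi (Kop n ?b \<circ> op_diff A (Kop m a))" by simp
    have "cmod (psi (A \<circ> Kop n b) - psi (Kop n ?b \<circ> A)) \<le> cmod (psi (op_diff A (Kop m a) \<circ> Kop n b)) + cmod (psi (Kop n ?b \<circ> op_diff A (Kop m a)))"
      unfolding eq by (rule norm_triangle_ineq4)
    also have "\<dots> \<le> K1 * e + K2 * e" 
      by (rule add_mono[OF K1(2)[OF D a(2) less_imp_le[OF e]] K2(2)[OF D a(2) less_imp_le[OF e]]])
    finally show "cmod (psi (A \<circ> Kop n b) - psi (Kop n ?b \<circ> A)) \<le> (K1 + K2) * e" by (simp add: distrib_right)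
  qed (use K1 K2 in simp)
  then show ?thesis by simp
qed

lemma entire_eq_on_reals:
  fixes f g :: "complex \<Rightarrow> complex"
  assumes "f holomorphic_on UNIV" "g holomorphic_on UNIV" "\<And>t::real. f (of_real t) = g (of_real t)"
  shows "f z = g z"
proof -
  have "f z - g z = 0"
  proof (rule analytic_continuation[where f = "\<lambda>z. f z - g z" and S = UNIV and U = "range complex_of_real" and \<xi> = 0])
    show "(\<lambda>z. f z - g z) holomorphic_on UNIV" by (intro holomorphic_intros assms)
    show "(0::complex) islimpt range complex_of_real"
      unfolding islimpt_approachable
    proof (intro allI impI)
      fix e :: real assume "0 < e"
      then have "complex_of_real (e / 2) \<noteq> 0 \<and> dist (complex_of_real (e / 2)) 0 < e"
        by (simp add: dist_norm norm_divide)
      then show "\<exists>x'\<in>range complex_of_real. x' \<noteq> 0 \<and> dist x' 0 < e" by blast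
    qed
  qed (use assms(3) in auto)
  then show ?thesis by simp
qed

text \<open>Both sides of the KMS identity are values of entire functions that agree on the real line by
  invariance of \<open>psi\<close>, so no strip estimates are needed.\<close>
lemma psi_KMS_Kop:
  assumes ext: "analytic_ext k p \<mu> \<sigma> A F" and b: "kern n b"
  shows "psi (A \<circ> Kop n b) = psi (Kop n b \<circ> F (\<i> * of_real \<beta>))"
proof -
  have A: "A \<in> Ualg k p \<mu>" and FU: "\<And>z. F z \<in> Ualg k p \<mu>" and Fe: "op_entire \<mu> F"
    and Ft: "\<And>t. op_eq \<mu> (F (of_real t)) (\<sigma> t A)" using ext by (auto simp: analytic_ext_def)
  let ?G = "\<lambda>z. Kop n (twist (\<i> * z) n b)"
  note bU = Kop_Ualg[OF b]
  have GU: "?G z \<in> Ualg k p \<mu>" for z by (intro Kop_Ualg kern_twist b)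
  obtain K1 where K1: "\<And>B e. B \<in> Ualg k p \<mu> \<Longrightarrow> opb \<mu> B e \<Longrightarrow> 0 \<le> e \<Longrightarrow> cmod (psi (Kop n b \<circ> B)) \<le> K1 * e"
    using psi_functional[OF bU] by metis
  obtain K2 where K2: "\<And>B e. B \<in> Ualg k p \<mu> \<Longrightarrow> opb \<mu> B e \<Longrightarrow> 0 \<le> e \<Longrightarrow> cmod (psi (B \<circ> A)) \<le> K2 * e"
    using psi_functional[OF A] by metis
  have w: "(\<lambda>z. psi (Kop n b \<circ> F z)) holomorphic_on UNIV"
    by (rule entire_functional[where \<Lambda> = "\<lambda>B. psi (Kop n b \<circ> B)", OF FU Fe psi_comp_linear_right[OF bU] K1])
  have u: "(\<lambda>z. psi (?G z \<circ> A)) holomorphic_on UNIV"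
    by (rule entire_functional[where \<Lambda> = "\<lambda>B. psi (B \<circ> A)", OF GU twist_entire[OF b] psi_comp_linear_left[OF A] K2])
  have v: "(\<lambda>z. psi (?G (- z) \<circ> A)) holomorphic_on UNIV"
    using holomorphic_on_compose[OF holomorphic_on_minus[OF holomorphic_on_ident] holomorphic_on_subset[OF u subset_UNIV]]
    by (simp add: o_def)
  have "psi (?G (- of_real t) \<circ> A) = psi (Kop n b \<circ> F (of_real t))" for t :: real
  proof -
    \<comment> \<open>Invariance under the flow moves it from one factor to the other: b twisted
      backwards in time against A equals b against A moved forwards.\<close>
    have "psi (?G (- of_real t) \<circ> A) = psi (\<sigma> t (?G (- of_real t) \<circ> A))"
      by (rule psi_sigma[symmetric, OF Ualg_comp[OF GU A]])
    also have "\<dots> = psi (Kop n b \<circ> F (of_real t))"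
    proof (rule psi_cong[OF sigma_Ualg[OF Ualg_comp[OF GU A]] Ualg_comp[OF bU FU]])
      have "twist (\<i> * of_real t) n (twist (\<i> * - of_real t) n b) = b"
        by (simp add: fun_eq_iff twist_def mult.assoc exp_add[symmetric])
      then have "op_eq \<mu> (\<sigma> t (?G (- of_real t))) (Kop n b)"
        using sigma_Kop[OF kern_twist[OF b], of t "\<i> * - of_real t"] by simp
      then have "op_eq \<mu> (\<sigma> t (?G (- of_real t)) \<circ> \<sigma> t A) (Kop n b \<circ> F (of_real t))"
        by (intro op_eq_comp Ualg_bop sigma_Ualg GU A FU op_eq_sym[OF Ft])
      then show "op_eq \<mu> (\<sigma> t (?G (- of_real t) \<circ> A)) (Kop n b \<circ> F (of_real t))"
        using op_eq_trans[OF alg.hom_mult[OF sigma_hom GU A]] by blast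
    qed
    finally show ?thesis .
  qed
  from entire_eq_on_reals[OF v w this]
  have "psi (?G (- (\<i> * of_real \<beta>)) \<circ> A) = psi (Kop n b \<circ> F (\<i> * of_real \<beta>))" .
  \<comment> \<open>At the point \<open>\<i> * \<beta>\<close> the continued twist of b is the real
    twist by \<open>\<beta>\<close>, which is the case covered by
    \<open>psi_swap_Kop\<close>.\<close>
  moreover have "\<i> * - (\<i> * of_real \<beta>) = complex_of_real \<beta>" by simp
  ultimately show ?thesis using psi_swap_Kop[OF A b] by simp
qed

text \<open>What remains after \<open>psi_KMS_Kop\<close> is a general b, reached by density because
  both sides depend on b boundedly.\<close>

lemma psi_is_KMS: "is_KMS k p \<mu> \<sigma> \<beta> psi"
  unfolding is_KMS_def is_state_iff
proof (intro conjI allI impI psi_state)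
  fix A B F assume B: "B \<in> Ualg k p \<mu>" and ext: "analytic_ext k p \<mu> \<sigma> A F"
  let ?C = "F (\<i> * of_real \<beta>)"
  have A: "A \<in> Ualg k p \<mu>" and C: "?C \<in> Ualg k p \<mu>" using ext by (auto simp: analytic_ext_def)
  obtain K1 where K1: "0 \<le> K1" "\<And>B e. B \<in> Ualg k p \<mu> \<Longrightarrow> opb \<mu> B e \<Longrightarrow> 0 \<le> e \<Longrightarrow> cmod (psi (A \<circ> B)) \<le> K1 * e"
    using psi_functional[OF A] by metis
  obtain K2 where K2: "0 \<le> K2" "\<And>B e. B \<in> Ualg k p \<mu> \<Longrightarrow> opb \<mu> B e \<Longrightarrow> 0 \<le> e \<Longrightarrow> cmod (psi (B \<circ> ?C)) \<le> K2 * e"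
    using psi_functional[OF C] by metis
  have "psi (A \<circ> B) - psi (B \<circ> ?C) = 0"
  proof (rule approx_zero[where K = "K1 + K2"])
    fix e :: real assume e: "0 < e"
    obtain n b where b: "kern n b" "opb \<mu> (op_diff B (Kop n b)) e" using Ualg_approx[OF B e] .
    note bU = Kop_Ualg[OF b(1)]
    have D: "op_diff B (Kop n b) \<in> Ualg k p \<mu>" by (rule alg.U_diff[OF B bU])
    have i: "B = op_add (op_scale 1 (op_diff B (Kop n b))) (Kop n b)" by (simp add: op_add_def op_scale_def op_diff_def)
    have "psi (A \<circ> B) = 1 * psi (A \<circ> op_diff B (Kop n b)) + psi (A \<circ> Kop n b)"
      using psi_comp_linear_right[OF A D bU, of 1] unfolding i[symmetric] .
    moreover have "psi (B \<circ> ?C) = 1 * psi (op_diff B (Kop n b) \<circ> ?C) + psi (Kop n b \<circ> ?C)"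
      using psi_comp_linear_left[OF C D bU, of 1] unfolding i[symmetric] .
    ultimately have eq: "psi (A \<circ> B) - psi (B \<circ> ?C) = psi (A \<circ> op_diff B (Kop n b)) - psi (op_diff B (Kop n b) \<circ> ?C)"
      using psi_KMS_Kop[OF ext b(1)] by simp
    have "cmod (psi (A \<circ> B) - psi (B \<circ> ?C)) \<le> cmod (psi (A \<circ> op_diff B (Kop n b))) + cmod (psi (op_diff B (Kop n b) \<circ> ?C))"
      unfolding eq by (rule norm_triangle_ineq4)
    also have "\<dots> \<le> K1 * e + K2 * e" 
      by (rule add_mono[OF K1(2)[OF D b(2) less_imp_le[OF e]] K2(2)[OF D b(2) less_imp_le[OF e]]])
    finally show "cmod (psi (A \<circ> B) - psi (B \<circ> ?C)) \<le> (K1 + K2) * e" by (simp add: distrib_right)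
  qed (use K1 K2 in simp)
  then show "psi (A \<circ> B) = psi (B \<circ> ?C)" by simp
qed

end

section \<open>Uniqueness of the KMS state\<close>

text \<open>\<open>H\<close> is bounded away from 0 by compactness, and the logarithm is Lipschitz
  on such a range.\<close>

lemma (in full_shift) holder_ln:
  assumes H: "holder k H" "\<forall>x\<in>X. 0 < H x"
  shows "\<exists>C r. 0 \<le> C \<and> 0 < r \<and> r < 1 \<and>
    (\<forall>x\<in>X. \<forall>y\<in>X. \<forall>m. (\<forall>i<m. x i = y i) \<longrightarrow> \<bar>c * ln (H x) - c * ln (H y)\<bar> \<le> C * r ^ m)"
proof -
  obtain C r where C: "0 \<le> C" "0 < r" "r < 1"
    "\<And>x y m. x \<in> X \<Longrightarrow> y \<in> X \<Longrightarrow> (\<forall>i<m. x i = y i) \<Longrightarrow> \<bar>H x - H y\<bar> \<le> C * r ^ m"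
    using holder_bound[OF H(1)] by blast
  obtain h where h: "0 < h" "\<And>x. x \<in> X \<Longrightarrow> h \<le> H x"
    using positive_X[OF holder_continuous[OF H(1)] H(2)] by blast
  have one: "ln (H x) - ln (H y) \<le> \<bar>H x - H y\<bar> / h" if "x \<in> X" "y \<in> X" for x y
  proof -
    have "ln (H x) - ln (H y) \<le> (H x - H y) / H y" using H(2) that by (intro ln_diff_le) auto
    also have "\<dots> \<le> \<bar>H x - H y\<bar> / H y" using H(2) that by (intro divide_right_mono) (auto intro: less_imp_le)
    also have "\<dots> \<le> \<bar>H x - H y\<bar> / h" using h that by (intro divide_left_mono mult_pos_pos) (auto intro: less_le_trans)
    finally show ?thesis .
  qed
  have "\<bar>c * ln (H x) - c * ln (H y)\<bar> \<le> (\<bar>c\<bar> * C / h) * r ^ m"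
    if "x \<in> X" "y \<in> X" "\<forall>i<m. x i = y i" for x y m
  proof -
    have "\<bar>ln (H x) - ln (H y)\<bar> \<le> \<bar>H x - H y\<bar> / h"
      using one[OF that(1,2)] one[OF that(2,1)] by (simp add: abs_le_iff abs_minus_commute)
    also have "\<dots> \<le> C * r ^ m / h" using C(4)[OF that] h(1) by (intro divide_right_mono) auto
    finally have "\<bar>c\<bar> * \<bar>ln (H x) - ln (H y)\<bar> \<le> \<bar>c\<bar> * (C * r ^ m / h)" by (intro mult_left_mono) auto
    then show ?thesis by (simp add: abs_mult[symmetric] right_diff_distrib)
  qed
  then show ?thesis using C h(1) by (intro exI[of _ "\<bar>c\<bar> * C / h"] exI[of _ r]) auto
qed

context gibbs_eigen
begin

text \<open>Multiplication by f as a kernel. The diagonal is the relation of level 0, so this kernel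
  is admissible at every level.\<close>

definition dker :: "vec \<Rightarrow> pt \<Rightarrow> pt \<Rightarrow> complex" where
  "dker f x y = (if x \<in> X \<and> y = x then f x else 0)"

lemma kern_dker:
  assumes f: "continuous_on X f" shows "kern n (dker f)"
proof -
  have r: "(x, y) \<in> tail_rel 0 \<longleftrightarrow> x \<in> X \<and> y = x" for x y by (auto simp: tail_rel_def)
  have "continuous_on (tail_rel 0) (\<lambda>z. f (fst z))"
    by (rule continuous_on_compose2[OF f continuous_on_fst[OF continuous_on_id]]) (auto simp: tail_rel_def)
  from kern_on_rel[of 0 "\<lambda>x y. f x", OF this]
  have "kern 0 (on_rel 0 (\<lambda>x y. f x))" .
  moreover have "on_rel 0 (\<lambda>x y. f x) = dker f" by (simp add: fun_eq_iff on_rel_def dker_def r)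
  ultimately show ?thesis using kern_mono[of 0 n "dker f"] by simp
qed

lemma Kop_dker: "x \<in> X \<Longrightarrow> Kop n (dker f) \<eta> x = f x * \<eta> x"
proof -
  assume x: "x \<in> X"
  have "Kop n (dker f) \<eta> x = (\<Sum>y\<in>tail n x. if y = x then f x * \<eta> x else 0)"
    unfolding Kop_def by (intro sum.cong refl) (simp add: dker_def x)
  then show ?thesis using tail_refl[OF x] finite_tail by simp
qed

lemma Kop_dker_level: "continuous_on X f \<Longrightarrow> Kop n (dker f) = Kop 0 (dker f)"
  by (rule Kop_mono[OF _ kern_dker]) auto

lemma kmul_dker_left:
  assumes a: "kern n a" shows "kmul n (dker f) a x z = f x * a x z"
proof (cases "x \<in> X")
  case True
  have "kmul n (dker f) a x z = (\<Sum>y\<in>tail n x. if y = x then f x * a x z else 0)"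
    unfolding kmul_def by (intro sum.cong refl) (simp add: dker_def True)
  then show ?thesis using tail_refl[OF True] finite_tail by simp
next
  case False
  then have "a x z = 0" by (intro kern_zero[OF a]) (simp add: tail_rel_iff)
  then show ?thesis using False by (simp add: kmul_def dker_def)
qed

lemma kmul_dker_right:
  assumes a: "kern n a" shows "kmul n a (dker f) x z = a x z * f z"
proof (cases "x \<in> X \<and> z \<in> tail n x")
  case True
  have "kmul n a (dker f) x z = (\<Sum>y\<in>tail n x. if y = z then a x z * f z else 0)"
    unfolding kmul_def using tail_in by (intro sum.cong refl) (auto simp: dker_def)
  then show ?thesis using True finite_tail by simp
next
  case False
  then have 0: "a x z = 0" by (intro kern_zero[OF a]) (simp add: tail_rel_iff)
  have "a x y * dker f y z = 0" for y using 0 by (auto simp: dker_def)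
  then have "kmul n a (dker f) x z = 0" unfolding kmul_def by (intro sum.neutral ballI)
  then show ?thesis using 0 by simp
qed

text \<open>The energy difference vanishes on the diagonal. Multiplication operators are fixed by
  the dynamics, hence move through a KMS state without a factor.\<close>

lemma twist_dker: "twist z n (dker f) = dker f"
proof (intro ext)
  fix x y show "twist z n (dker f) x y = dker f x y"
    by (cases "y = x") (simp_all add: twist_def dker_def)
qed

context
  fixes \<phi> :: "op \<Rightarrow> complex"
  assumes KMS: "is_KMS k p \<mu> \<sigma> \<beta> \<phi>"
begin

lemma phi_state: "alg.state_on \<phi>"
  using KMS unfolding is_KMS_def is_state_iff by blast

text \<open>The KMS condition for the analytic element \<open>Kop n a\<close>. Here the first factor
  is twisted by \<open>- \<beta>\<close>, whereas \<open>dg_swap\<close> twists the second by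
  \<open>\<beta>\<close>.\<close>

lemma phi_kmul:
  assumes a: "kern n a" and b: "kern n b"
  shows "\<phi> (Kop n (kmul n a b)) = \<phi> (Kop n (kmul n b (twist (- of_real \<beta>) n a)))"
proof -
  have "\<phi> (Kop n a \<circ> Kop n b) = \<phi> (Kop n b \<circ> Kop n (twist (\<i> * (\<i> * of_real \<beta>)) n a))"
    using KMS Kop_Ualg[OF b] Kop_analytic_ext[OF a] unfolding is_KMS_def by blast
  moreover have "\<i> * (\<i> * complex_of_real \<beta>) = - of_real \<beta>" by simp
  ultimately show ?thesis unfolding Kop_comp by simp
qed

lemma phi_add_scale:
  assumes a: "kern n a" and b: "kern n b"
  shows "\<phi> (Kop n (\<lambda>x y. c * a x y + b x y)) = c * \<phi> (Kop n a) + \<phi> (Kop n b)"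
  unfolding Kop_add_scale[symmetric] by (rule alg.state_lin[OF phi_state Kop_Ualg[OF a] Kop_Ualg[OF b]])

lemma phi_sum:
  assumes "finite W" "\<And>w. w \<in> W \<Longrightarrow> kern n (a w)"
  shows "\<phi> (Kop n (\<lambda>x y. \<Sum>w\<in>W. a w x y)) = (\<Sum>w\<in>W. \<phi> (Kop n (a w)))"
  using assms
proof (induction W rule: finite_induct)
  case empty
  have "\<phi> (Kop n (\<lambda>x y. (-1) * 0 + 0)) = (-1) * \<phi> (Kop n (\<lambda>x y. 0)) + \<phi> (Kop n (\<lambda>x y. 0))"
    by (rule phi_add_scale[OF kern_const_zero kern_const_zero])
  then show ?case by simp
next
  case (insert w W)
  have "(\<lambda>x y. \<Sum>w\<in>insert w W. a w x y) = (\<lambda>x y. 1 * a w x y + (\<Sum>w\<in>W. a w x y))"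
    using insert by simp
  moreover have "\<phi> (Kop n (\<lambda>x y. 1 * a w x y + (\<Sum>w\<in>W. a w x y))) = 1 * \<phi> (Kop n (a w)) + \<phi> (Kop n (\<lambda>x y. \<Sum>w\<in>W. a w x y))"
    using insert.prems by (intro phi_add_scale kern_sum) auto
  ultimately show ?case using insert by simp
qed

text \<open>Cutting with a cylinder partition and moving the indicators around by the KMS condition removes
  the off-diagonal part.\<close>
lemma phi_diag:
  assumes a: "kern n a"
  shows "\<phi> (Kop n a) = \<phi> (Kop 0 (dker (\<lambda>x. a x x)))"
proof -
  define cyl :: "pt \<Rightarrow> vec" where "cyl w = (\<lambda>x. indicator {y. \<forall>i<n. y i = w i} x)" for w
  have kd: "kern n (dker (cyl w))" for w
    unfolding cyl_def by (rule kern_dker[OF cylinder_indicator_continuous])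
  define c where "c w = kmul n (dker (cyl w)) a" for w
  define e where "e w = kmul n (c w) (dker (cyl w))" for w
  have kc: "kern n (c w)" and ke: "kern n (e w)" for w
    unfolding e_def c_def by (intro kern_kmul kd a)+
  have c: "c w x z = cyl w x * a x z" for w x z unfolding c_def by (rule kmul_dker_left[OF a])
  have e: "e w x z = cyl w x * a x z * cyl w z" for w x z
    unfolding e_def kmul_dker_right[OF kc] c ..
  have sq: "cyl w x * cyl w x = cyl w x" for w x by (auto simp: cyl_def indicator_def)
  \<comment> \<open>The indicator is idempotent and has no twist, so one copy travels from the left
    end of the product to the right end: a kernel cut in its rows may also be cut in its
    columns.\<close>
  have move: "\<phi> (Kop n (c w)) = \<phi> (Kop n (e w))" for w
  proof -
    have "kmul n (dker (cyl w)) (c w) = c w"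
      by (simp add: fun_eq_iff kmul_dker_left[OF kc] c mult.assoc[symmetric] sq)
    then show ?thesis using phi_kmul[OF kd kc, of w w] unfolding twist_dker e_def by simp
  qed
  have chi: "cyl w x = (if w = glue n x (\<lambda>_. 1) then 1 else 0)" if "w \<in> wds n" for w x
  proof -
    have "(\<forall>i<n. x i = w i) \<longleftrightarrow> w = glue n x (\<lambda>_. 1)"
    proof
      assume *: "\<forall>i<n. x i = w i"
      show "w = glue n x (\<lambda>_. 1)"
      proof
        fix i show "w i = glue n x (\<lambda>_. 1) i"
          using * that by (cases "i < n") (auto simp: glue_def wds_def tail_def)
      qed
    qed (simp add: glue_def)
    then show ?thesis by (simp add: cyl_def indicator_def)
  qed
  have vw: "glue n x (\<lambda>_. 1) \<in> wds n" if "x \<in> X" for x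
    using X_k[OF that] that by (auto simp: wds_def tail_def glue_def shift_space_def)
  have pick: "(\<Sum>w\<in>wds n. cyl w x * g w) = g (glue n x (\<lambda>_. 1))" if x: "x \<in> X" for x and g :: "pt \<Rightarrow> complex"
  proof -
    have "(\<Sum>w\<in>wds n. cyl w x * g w) = (\<Sum>w\<in>wds n. if w = glue n x (\<lambda>_. 1) then g w else 0)"
      by (rule sum.cong[OF refl]) (simp add: chi)
    then show ?thesis using vw[OF x] finite_wds by simp
  qed
  have s1: "(\<lambda>x z. \<Sum>w\<in>wds n. c w x z) = a"
  proof (intro ext)
    fix x z
    show "(\<Sum>w\<in>wds n. c w x z) = a x z"
    proof (cases "x \<in> X")
      case True
      then show ?thesis using pick[OF True, of "\<lambda>_. a x z"] by (simp add: c)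
    next
      case False
      then have "a x z = 0" by (intro kern_zero[OF a]) (simp add: tail_rel_iff)
      then show ?thesis by (simp add: c)
    qed
  qed
  \<comment> \<open>Related points with the same first n letters coincide, so cutting rows and
    columns to the same cylinder leaves only the diagonal.\<close>
  have s2: "(\<lambda>x z. \<Sum>w\<in>wds n. e w x z) = dker (\<lambda>x. a x x)"
  proof (intro ext)
    fix x z
    show "(\<Sum>w\<in>wds n. e w x z) = dker (\<lambda>x. a x x) x z"
    proof (cases "(x, z) \<in> tail_rel n")
      case True
      then have x: "x \<in> X" and z: "\<And>i. n \<le> i \<Longrightarrow> z i = x i" by (auto simp: tail_rel_def)
      have "(\<Sum>w\<in>wds n. e w x z) = a x z * cyl (glue n x (\<lambda>_. 1)) z"
        using pick[OF x, of "\<lambda>w. a x z * cyl w z"] by (simp add: e mult.assoc)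
      moreover have "(\<forall>i<n. z i = glue n x (\<lambda>_. 1) i) \<longleftrightarrow> z = x"
      proof
        assume *: "\<forall>i<n. z i = glue n x (\<lambda>_. 1) i"
        show "z = x"
        proof
          fix i show "z i = x i" using * z[of i] by (cases "i < n") (auto simp: glue_def)
        qed
      qed (simp add: glue_def)
      ultimately show ?thesis using x by (simp add: cyl_def indicator_def dker_def)
    next
      case False
      then have 0: "a x z = 0" by (rule kern_zero[OF a])
      then have "dker (\<lambda>x. a x x) x z = 0" by (auto simp: dker_def)
      then show ?thesis using 0 by (simp add: e)
    qed
  qed
  have "\<phi> (Kop n (\<lambda>x z. \<Sum>w\<in>wds n. c w x z)) = \<phi> (Kop n (\<lambda>x z. \<Sum>w\<in>wds n. e w x z))"
    unfolding phi_sum[OF finite_wds kc] phi_sum[OF finite_wds ke] move ..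
  then have "\<phi> (Kop n a) = \<phi> (Kop n (dker (\<lambda>x. a x x)))" unfolding s1 s2 .
  then show ?thesis using Kop_dker_level[OF kern_diag[OF a], of n] by (rule trans[OF _ arg_cong])
qed

section \<open>Restriction of a KMS state to continuous functions\<close>

definition phi_fun :: "vec \<Rightarrow> complex" where "phi_fun f = \<phi> (Kop 0 (dker f))"

lemma phi_fun_linear:
  assumes "continuous_on X f" "continuous_on X g"
  shows "phi_fun (\<lambda>x. c * f x + g x) = c * phi_fun f + phi_fun g"
proof -
  have "dker (\<lambda>x. c * f x + g x) = (\<lambda>x y. c * dker f x y + dker g x y)" by (simp add: fun_eq_iff dker_def)
  then show ?thesis unfolding phi_fun_def using phi_add_scale[OF kern_dker[OF assms(1)] kern_dker[OF assms(2)]] by simp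
qed

lemma phi_fun_cong: "(\<And>x. x \<in> X \<Longrightarrow> f x = g x) \<Longrightarrow> phi_fun f = phi_fun g"
proof -
  assume "\<And>x. x \<in> X \<Longrightarrow> f x = g x"
  then have "dker f = dker g" by (simp add: fun_eq_iff dker_def)
  then show ?thesis by (simp add: phi_fun_def)
qed

lemma phi_fun_one: "phi_fun (\<lambda>_. 1) = 1"
proof -
  have k: "kern 0 (dker (\<lambda>_. 1))" by (intro kern_dker continuous_on_const)
  have "op_eq \<mu> (Kop 0 (dker (\<lambda>_. 1))) id"
    unfolding op_eq_def by (intro ballI AE_I2) (simp add: Kop_dker space_mu)
  then show ?thesis
    unfolding phi_fun_def
    using alg.state_cong[OF phi_state Kop_Ualg[OF k] Ualg_id] alg.state_one[OF phi_state] by simp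
qed

lemma phi_fun_bound:
  assumes f: "continuous_on X f" and C: "0 \<le> C" "\<And>x. x \<in> X \<Longrightarrow> cmod (f x) \<le> C"
  shows "cmod (phi_fun f) \<le> 2 * C"
  unfolding phi_fun_def
proof (rule alg.state_bound[OF phi_state Kop_Ualg[OF kern_dker[OF f]] _ C(1)])
  show "opb \<mu> (Kop 0 (dker f)) C"
    unfolding opb_def
  proof
    fix \<eta> assume L: "\<eta> \<in> L2 \<mu>"
    have "l2norm \<mu> (Kop 0 (dker f) \<eta>) \<le> l2norm \<mu> (\<lambda>x. of_real C * \<eta> x)"
      using C by (intro l2norm_mono bop_L2[OF is_bop_Kop[OF kern_dker[OF f]] L] L2_scale L)
        (simp add: space_mu Kop_dker norm_mult mult_right_mono)
    then show "l2norm \<mu> (Kop 0 (dker f) \<eta>) \<le> C * l2norm \<mu> \<eta>" unfolding l2norm_scale using C by simp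
  qed
qed

text \<open>The exchange rule applied to F and the kernel that is 1 on the relation: the diagonal of
  one product collects the rows of F, that of the other the twisted columns. This is
  \<open>nu_conformal\<close> for an arbitrary KMS state.\<close>

lemma phi_conformal:
  assumes F: "kern n F"
  shows "phi_fun (\<lambda>x. \<Sum>y\<in>tail n x. F x y) = phi_fun (\<lambda>x. \<Sum>y\<in>tail n x. twist (of_real \<beta>) n (transp F) x y)"
proof -
  let ?one = "on_rel n (\<lambda>x y. 1)"
  have o: "kern n ?one" by (rule kern_on_rel[OF continuous_on_const])
  have one: "?one x y = 1" if "x \<in> X" "y \<in> tail n x" for x y using that by (simp add: on_rel_def tail_rel_iff)
  have one': "?one y x = 1" if "x \<in> X" "y \<in> tail n x" for x y
    using tail_sym[OF that] tail_in[OF that(2)] by (simp add: on_rel_def tail_rel_iff)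
  let ?G = "twist (- of_real \<beta>) n F"
  have kG: "kern n ?G" by (rule kern_twist[OF F])
  have "phi_fun (\<lambda>x. \<Sum>y\<in>tail n x. F x y) = phi_fun (\<lambda>x. kmul n F ?one x x)"
    by (rule phi_fun_cong) (simp add: kmul_def one')
  also have "\<dots> = \<phi> (Kop n (kmul n F ?one))" unfolding phi_fun_def by (rule phi_diag[OF kern_kmul[OF F o], symmetric])
  also have "\<dots> = \<phi> (Kop n (kmul n ?one ?G))" by (rule phi_kmul[OF F o])
  also have "\<dots> = phi_fun (\<lambda>x. kmul n ?one ?G x x)" unfolding phi_fun_def by (rule phi_diag[OF kern_kmul[OF o kG]])
  also have "\<dots> = phi_fun (\<lambda>x. \<Sum>y\<in>tail n x. twist (of_real \<beta>) n (transp F) x y)"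
    by (rule phi_fun_cong) (simp add: kmul_def one twist_def transp_def algebra_simps)
  finally show ?thesis .
qed

end

text \<open>Chosen so that its rows sum to \<open>G\<close> while its twisted columns sum to
  \<open>tail_avg pot n G\<close>; conformality then becomes invariance under the averages.\<close>

definition avg_kernel :: "nat \<Rightarrow> (pt \<Rightarrow> real) \<Rightarrow> pt \<Rightarrow> pt \<Rightarrow> complex" where
  "avg_kernel n G = on_rel n (\<lambda>x y. of_real (G x * exp (birkhoff pot n y) / partition_fn pot n x))"

lemma kern_avg:
  assumes G: "continuous_on X G" shows "kern n (avg_kernel n G)"
  unfolding avg_kernel_def
proof (rule kern_on_rel, intro continuous_on_of_real continuous_on_divide continuous_on_mult continuous_on_exp)
  have X: "fst ` tail_rel n \<subseteq> X" "snd ` tail_rel n \<subseteq> X" by (auto simp: tail_rel_def)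
  show "continuous_on (tail_rel n) (\<lambda>z. G (fst z))"
    by (rule continuous_on_compose2[OF G continuous_on_fst[OF continuous_on_id] X(1)])
  show "continuous_on (tail_rel n) (\<lambda>z. birkhoff pot n (snd z))"
    by (rule continuous_on_compose2[OF continuous_birkhoff[OF continuous_pot] continuous_on_snd[OF continuous_on_id] X(2)])
  show "continuous_on (tail_rel n) (\<lambda>z. partition_fn pot n (fst z))"
    by (rule continuous_on_compose2[OF continuous_partition_fn[OF continuous_pot] continuous_on_fst[OF continuous_on_id] X(1)])
  show "\<forall>z\<in>tail_rel n. partition_fn pot n (fst z) \<noteq> 0"
  proof
    fix z assume "z \<in> tail_rel n"
    then have "fst z \<in> X" by (auto simp: tail_rel_def)
    then show "partition_fn pot n (fst z) \<noteq> 0" using partition_fn_pos[of "fst z" pot n] by simp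
  qed
qed

lemma avg_row:
  assumes x: "x \<in> X" shows "(\<Sum>y\<in>tail n x. avg_kernel n G x y) = of_real (G x)"
proof -
  have "(\<Sum>y\<in>tail n x. avg_kernel n G x y) = (\<Sum>y\<in>tail n x. of_real (G x * exp (birkhoff pot n y) / partition_fn pot n x))"
    by (rule sum.cong[OF refl]) (simp add: avg_kernel_def on_rel_def tail_rel_iff x)
  also have "\<dots> = of_real (\<Sum>y\<in>tail n x. G x * exp (birkhoff pot n y) / partition_fn pot n x)"
    by (rule of_real_sum[symmetric])
  also have "(\<Sum>y\<in>tail n x. G x * exp (birkhoff pot n y) / partition_fn pot n x)
      = G x * partition_fn pot n x / partition_fn pot n x"
    unfolding partition_fn_def[of pot n x] by (simp only: sum_distrib_left sum_divide_distrib)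
  also have "\<dots> = G x" using partition_fn_pos[OF x, of pot n] by simp
  finally show ?thesis .
qed

lemma avg_col:
  assumes x: "x \<in> X"
  shows "(\<Sum>y\<in>tail n x. twist (of_real \<beta>) n (transp (avg_kernel n G)) x y) = of_real (tail_avg pot n G x)"
proof -
  have "twist (of_real \<beta>) n (transp (avg_kernel n G)) x y
      = of_real (exp (birkhoff pot n y) * G y / partition_fn pot n x)" if y: "y \<in> tail n x" for y
  proof -
    have r: "(y, x) \<in> tail_rel n" using tail_in[OF y] tail_sym[OF x y] by (simp add: tail_rel_iff)
    have "complex_of_real \<beta> * of_real (energy n x - energy n y) = of_real (birkhoff pot n y - birkhoff pot n x)"
      by (simp add: birkhoff_pot algebra_simps)
    then have "twist (of_real \<beta>) n (transp (avg_kernel n G)) x y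
        = of_real (G y * exp (birkhoff pot n x) / partition_fn pot n y * exp (birkhoff pot n y - birkhoff pot n x))"
      unfolding twist_def by (simp only: transp_def avg_kernel_def on_rel_def r if_True exp_of_real of_real_mult)
    also have "G y * exp (birkhoff pot n x) / partition_fn pot n y * exp (birkhoff pot n y - birkhoff pot n x)
        = exp (birkhoff pot n y) * G y / partition_fn pot n x"
      unfolding partition_fn_tail[OF y] exp_diff by (simp add: field_simps)
    finally show ?thesis .
  qed
  then have "(\<Sum>y\<in>tail n x. twist (of_real \<beta>) n (transp (avg_kernel n G)) x y)
      = (\<Sum>y\<in>tail n x. of_real (exp (birkhoff pot n y) * G y / partition_fn pot n x))"
    by (rule sum.cong[OF refl])
  also have "\<dots> = of_real (tail_avg pot n G x)"
    unfolding tail_avg_def sum_divide_distrib by (rule of_real_sum[symmetric])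
  finally show ?thesis .
qed

lemma nu_avg:
  assumes G: "continuous_on X G"
  shows "(\<integral>x. tail_avg pot n G x \<partial>\<nu>) = (\<integral>x. G x \<partial>\<nu>)"
proof -
  have "(\<integral>x. complex_of_real (G x) \<partial>\<nu>) = (\<integral>x. (\<Sum>y\<in>tail n x. avg_kernel n G x y) \<partial>\<nu>)"
    by (intro Bochner_Integration.integral_cong refl) (simp add: space_nu avg_row)
  also have "\<dots> = (\<integral>x. (\<Sum>y\<in>tail n x. twist (of_real \<beta>) n (transp (avg_kernel n G)) x y) \<partial>\<nu>)"
    by (rule nu_conformal[OF kern_avg[OF G]])
  also have "\<dots> = (\<integral>x. complex_of_real (tail_avg pot n G x) \<partial>\<nu>)"
    by (intro Bochner_Integration.integral_cong refl) (simp add: space_nu avg_col)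
  finally show ?thesis unfolding integral_complex_of_real of_real_eq_iff by simp
qed

lemma phi_avg:
  assumes KMS: "is_KMS k p \<mu> \<sigma> \<beta> \<phi>" and G: "continuous_on X G"
  shows "phi_fun \<phi> (\<lambda>x. of_real (tail_avg pot n G x)) = phi_fun \<phi> (\<lambda>x. of_real (G x))"
proof -
  have "phi_fun \<phi> (\<lambda>x. of_real (G x)) = phi_fun \<phi> (\<lambda>x. \<Sum>y\<in>tail n x. avg_kernel n G x y)"
    by (rule phi_fun_cong[OF KMS]) (simp add: avg_row)
  also have "\<dots> = phi_fun \<phi> (\<lambda>x. \<Sum>y\<in>tail n x. twist (of_real \<beta>) n (transp (avg_kernel n G)) x y)"
    by (rule phi_conformal[OF KMS kern_avg[OF G]])
  also have "\<dots> = phi_fun \<phi> (\<lambda>x. of_real (tail_avg pot n G x))"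
    by (rule phi_fun_cong[OF KMS]) (simp add: avg_col)
  finally show ?thesis by simp
qed

text \<open>Both functionals are invariant under the averages, which become constant.\<close>
lemma phi_fun_real:
  assumes KMS: "is_KMS k p \<mu> \<sigma> \<beta> \<phi>" and hol: "holder k H" and G: "continuous_on X G"
  shows "phi_fun \<phi> (\<lambda>x. of_real (G x)) = of_real (\<integral>x. G x \<partial>\<nu>)"
proof -
  interpret N: prob_space \<nu> by (rule nu_prob)
  obtain x0 where x0: "x0 \<in> X" using N.not_empty space_nu by auto
  obtain C r where C: "0 \<le> C" "0 < r" "r < 1"
    "\<forall>x\<in>X. \<forall>y\<in>X. \<forall>m. (\<forall>i<m. x i = y i) \<longrightarrow> \<bar>- \<beta> * ln (H x) - - \<beta> * ln (H y)\<bar> \<le> C * r ^ m"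
    using holder_ln[OF hol H_pos, of "- \<beta>"] by blast
  have pb: "\<bar>pot x - pot y\<bar> \<le> C * r ^ m" if "x \<in> X" "y \<in> X" "\<forall>i<m. x i = y i" for x y m
    unfolding pot_def using C(4) that by blast
  \<comment> \<open>The constant 3 below: twice e from \<open>phi_fun_bound\<close>, for the
    distance of the average from its value at \<open>x0\<close>, and once e for the same distance
    under the integral.\<close>
  have "phi_fun \<phi> (\<lambda>x. of_real (G x)) - of_real (\<integral>x. G x \<partial>\<nu>) = 0"
  proof (rule approx_zero[where K = 3])
    fix e :: real assume e: "0 < e"
    obtain n where n: "\<forall>x\<in>X. \<forall>y\<in>X. tail_avg pot n G x - tail_avg pot n G y \<le> e"
      using tail_avg_osc[OF continuous_pot C(1-3) pb G e] by blast
    define E where "E = tail_avg pot n G"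
    define c where "c = E x0"
    have E: "continuous_on X E" unfolding E_def by (rule continuous_tail_avg[OF continuous_pot G])
    have near: "\<bar>E x - c\<bar> \<le> e" if "x \<in> X" for x
      using bspec[OF bspec[OF n that] x0] bspec[OF bspec[OF n x0] that] by (simp add: E_def c_def abs_le_iff)
    have EC: "continuous_on X (\<lambda>x. complex_of_real (E x))" by (intro continuous_on_of_real E)
    have "phi_fun \<phi> (\<lambda>x. - of_real c * 1 + of_real (E x)) = - of_real c * phi_fun \<phi> (\<lambda>_. 1) + phi_fun \<phi> (\<lambda>x. of_real (E x))"
      by (rule phi_fun_linear[OF KMS continuous_on_const EC])
    then have "phi_fun \<phi> (\<lambda>x. of_real (E x)) - of_real c = phi_fun \<phi> (\<lambda>x. - of_real c * 1 + of_real (E x))"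
      by (simp add: phi_fun_one[OF KMS])
    moreover have "cmod (phi_fun \<phi> (\<lambda>x. - of_real c * 1 + of_real (E x))) \<le> 2 * e"
    proof (rule phi_fun_bound[OF KMS])
      show "continuous_on X (\<lambda>x. - complex_of_real c * 1 + of_real (E x))"
        by (intro continuous_on_add continuous_on_const EC)
      fix x assume "x \<in> X"
      have "- complex_of_real c * 1 + of_real (E x) = of_real (E x - c)" by simp
      then show "cmod (- of_real c * 1 + of_real (E x)) \<le> e" using near[OF \<open>x \<in> X\<close>] by (simp only: norm_of_real)
    qed (use e in simp)
    ultimately have 1: "cmod (phi_fun \<phi> (\<lambda>x. of_real (E x)) - of_real c) \<le> 2 * e" by simp
    have "\<bar>\<integral>x. E x - c \<partial>\<nu>\<bar> \<le> (\<integral>x. \<bar>E x - c\<bar> \<partial>\<nu>)" by (rule integral_abs_bound)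
    also have "\<dots> \<le> (\<integral>x. e \<partial>\<nu>)"
      using near by (intro integral_mono nu_integrable continuous_on_rabs continuous_on_diff E continuous_on_const)
        (auto simp: space_nu)
    finally have 2: "\<bar>(\<integral>x. E x \<partial>\<nu>) - c\<bar> \<le> e" using nu_integrable[OF E] by (simp add: N.prob_space)
    have "cmod (phi_fun \<phi> (\<lambda>x. of_real (E x)) - of_real (\<integral>x. E x \<partial>\<nu>))
        \<le> cmod (phi_fun \<phi> (\<lambda>x. of_real (E x)) - of_real c) + cmod (of_real ((\<integral>x. E x \<partial>\<nu>) - c))"
      using norm_triangle_ineq4[of "phi_fun \<phi> (\<lambda>x. of_real (E x)) - of_real c" "of_real ((\<integral>x. E x \<partial>\<nu>) - c)"] by simp
    also have "\<dots> \<le> 2 * e + e" using 1 2 by (intro add_mono) (simp_all only: norm_of_real)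
    finally show "cmod (phi_fun \<phi> (\<lambda>x. of_real (G x)) - of_real (\<integral>x. G x \<partial>\<nu>)) \<le> 3 * e"
      unfolding E_def phi_avg[OF KMS G] nu_avg[OF G] by simp
  qed simp
  then show ?thesis by simp
qed

section \<open>Identification of an arbitrary KMS state\<close>

lemma phi_Kop:
  assumes KMS: "is_KMS k p \<mu> \<sigma> \<beta> \<phi>" and hol: "holder k H" and a: "kern n a"
  shows "\<phi> (Kop n a) = dg a"
proof -
  let ?R = "\<lambda>x. Re (a x x)" and ?I = "\<lambda>x. Im (a x x)"
  note d = kern_diag[OF a]
  have c: "continuous_on X ?R" "continuous_on X ?I" by (intro continuous_on_Re continuous_on_Im d)+
  have "\<phi> (Kop n a) = phi_fun \<phi> (\<lambda>x. a x x)"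
    unfolding phi_fun_def[OF KMS] by (rule phi_diag[OF KMS a])
  also have "\<dots> = phi_fun \<phi> (\<lambda>x. \<i> * of_real (?I x) + of_real (?R x))"
    by (rule phi_fun_cong[OF KMS]) (simp add: complex_eq_iff)
  also have "\<dots> = \<i> * phi_fun \<phi> (\<lambda>x. of_real (?I x)) + phi_fun \<phi> (\<lambda>x. of_real (?R x))"
    by (intro phi_fun_linear[OF KMS] continuous_on_of_real c)
  also have "\<dots> = \<i> * of_real (\<integral>x. ?I x \<partial>\<nu>) + of_real (\<integral>x. ?R x \<partial>\<nu>)"
    unfolding phi_fun_real[OF KMS hol c(1)] phi_fun_real[OF KMS hol c(2)] ..
  also have "\<dots> = dg a"
    unfolding dg_def integral_Re[OF nu_integrable[OF d]] integral_Im[OF nu_integrable[OF d]]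
    by (rule complex_eqI) simp_all
  finally show ?thesis .
qed

lemma KMS_unique:
  assumes KMS: "is_KMS k p \<mu> \<sigma> \<beta> \<phi>" and hol: "holder k H" and A: "A \<in> Ualg k p \<mu>"
  shows "\<phi> A = psi A"
proof -
  note st = phi_state[OF KMS]
  \<comment> \<open>The constant 3 below: twice e from \<open>state_bound\<close> for the given
    state and once e from \<open>psi_near\<close>.\<close>
  have "\<phi> A - psi A = 0"
  proof (rule approx_zero[where K = 3])
    fix e :: real assume e: "0 < e"
    obtain n a where a: "kern n a" "opb \<mu> (op_diff A (Kop n a)) e" using Ualg_approx[OF A e] .
    note aU = Kop_Ualg[OF a(1)]
    have "\<phi> (op_diff A (Kop n a)) = \<phi> A - dg a"
      using alg.state_lin[OF st aU A, of "-1"] phi_Kop[OF KMS hol a(1)] by (simp add: op_diff_alt op_add_def op_scale_def)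
    then have "cmod (\<phi> A - dg a) \<le> 2 * e"
      using alg.state_bound[OF st alg.U_diff[OF A aU] a(2) less_imp_le[OF e]] by simp
    moreover have "cmod (psi A - dg a) \<le> e" by (rule psi_near[OF A a])
    ultimately show "cmod (\<phi> A - psi A) \<le> 3 * e"
      using norm_triangle_ineq4[of "\<phi> A - dg a" "psi A - dg a"] by simp
  qed simp
  then show ?thesis by simp
qed

lemma KMS_generator:
  assumes KMS: "is_KMS k p \<mu> \<sigma> \<beta> \<phi>" and hol: "holder k H"
    and f: "continuous_on X f" and g: "continuous_on X g"
  shows "\<phi> (Mop f \<circ> e_op k p n \<circ> Mop g) = (\<integral>x. f x * g x / complex_of_real (lambda_n p n x) \<partial>\<nu>)"
proof -
  have "\<phi> (Mop f \<circ> e_op k p n \<circ> Mop g) = \<phi> (Kop n (gker n f g))"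
    by (rule alg.state_cong[OF phi_state[OF KMS] generator_Ualg[OF f g] Kop_Ualg[OF kern_gker[OF f g]] generator_bop(2)[OF f g]])
  also have "\<dots> = dg (gker n f g)" by (rule phi_Kop[OF KMS hol kern_gker[OF f g]])
  also have "\<dots> = (\<integral>x. f x * g x / complex_of_real (lambda_n p n x) \<partial>\<nu>)"
    unfolding dg_def
    by (intro Bochner_Integration.integral_cong refl)
       (simp add: space_nu gker_def on_rel_def tail_rel_iff tail_refl lambda_n_weight)
  finally show ?thesis .
qed

end

theorem theorem2p2:
  fixes k :: nat and p H :: "pt \<Rightarrow> real" and \<mu> :: "pt measure"
    and \<sigma> :: "real \<Rightarrow> op \<Rightarrow> op" and \<beta> :: real
    and \<nu> :: "pt measure"
  assumes p_pos: "\<forall>x\<in>shift_space k. p x > 0"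
    and p_holder: "holder k p"
    and p_norm: "\<forall>x\<in>shift_space k. (\<Sum>z\<in>preim k x. p z) = 1"
    and mu_prob: "prob_space \<mu>"
    and mu_sets: "sets \<mu> = sets (restrict_space borel (shift_space k))"
    and mu_inv: "\<forall>f::pt \<Rightarrow> complex. continuous_on (shift_space k) f \<longrightarrow>
                   (\<integral>x. Lp k p f x \<partial>\<mu>) = (\<integral>x. f x \<partial>\<mu>)"
    and H_pos: "\<forall>x\<in>shift_space k. H x > 0"
    and H_holder: "holder k H"
    and sigma: "is_dynamics k p \<mu> H \<sigma>"
    and nu_prob: "prob_space \<nu>"
    and nu_sets: "sets \<nu> = sets (restrict_space borel (shift_space k))"
    and nu_eigen: "\<forall>f. continuous_on (shift_space k) f \<longrightarrow>
          (\<integral>x. ruelle k (\<lambda>z. - \<beta> * ln (H z)) f x \<partial>\<nu>)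
            = largest_eigenvalue k (\<lambda>z. - \<beta> * ln (H z)) * (\<integral>x. f x \<partial>\<nu>)"
  shows "(\<exists>\<psi>. is_KMS k p \<mu> \<sigma> \<beta> \<psi>) \<and>
         (\<forall>\<psi>1 \<psi>2. is_KMS k p \<mu> \<sigma> \<beta> \<psi>1 \<longrightarrow> is_KMS k p \<mu> \<sigma> \<beta> \<psi>2 \<longrightarrow>
                    (\<forall>A\<in>Ualg k p \<mu>. \<psi>1 A = \<psi>2 A)) \<and>
         (\<forall>\<psi>. is_KMS k p \<mu> \<sigma> \<beta> \<psi> \<longrightarrow>
            (\<forall>f g n. continuous_on (shift_space k) f \<longrightarrow> continuous_on (shift_space k) g \<longrightarrow>
               \<psi> (Mop f \<circ> e_op k p n \<circ> Mop g)
                 = (\<integral>x. f x * g x / complex_of_real (lambda_n p n x) \<partial>\<nu>)))"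
proof -
  have "gibbs k p \<mu>"
    by (rule gibbs.intro[OF p_pos full_shift.holder_continuous[OF p_holder] p_norm mu_prob mu_sets mu_inv])
  then have "gibbs_dyn k p \<mu> H"
    by (intro gibbs_dyn.intro gibbs_dyn_axioms.intro H_pos full_shift.holder_continuous[OF H_holder])
  then have "gibbs_flow k p \<mu> H \<sigma>" by (intro gibbs_flow.intro gibbs_flow_axioms.intro sigma)
  then interpret gibbs_eigen k p \<mu> H \<sigma> \<beta> "largest_eigenvalue k (\<lambda>z. - \<beta> * ln (H z))" \<nu>
    by (intro gibbs_eigen.intro gibbs_eigen_axioms.intro nu_prob nu_sets nu_eigen)
  define agree where "agree \<psi>1 \<psi>2 \<longleftrightarrow> (\<forall>A\<in>Ualg k p \<mu>. \<psi>1 A = \<psi>2 A)" for \<psi>1 \<psi>2 :: "op \<Rightarrow> complex"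
  define formula where "formula \<psi> \<longleftrightarrow>
    (\<forall>f g n. continuous_on (shift_space k) f \<longrightarrow> continuous_on (shift_space k) g \<longrightarrow>
      \<psi> (Mop f \<circ> e_op k p n \<circ> Mop g) = (\<integral>x. f x * g x / complex_of_real (lambda_n p n x) \<partial>\<nu>))"
    for \<psi> :: "op \<Rightarrow> complex"
  have agree: "agree \<psi>1 \<psi>2" if KMS: "is_KMS k p \<mu> \<sigma> \<beta> \<psi>1" "is_KMS k p \<mu> \<sigma> \<beta> \<psi>2" for \<psi>1 \<psi>2
    unfolding agree_def
  proof
    fix A assume A: "A \<in> Ualg k p \<mu>"
    show "\<psi>1 A = \<psi>2 A"
      by (rule trans[OF KMS_unique[OF KMS(1) H_holder A] KMS_unique[OF KMS(2) H_holder A, symmetric]])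
  qed
  have formula: "formula \<psi>" if KMS: "is_KMS k p \<mu> \<sigma> \<beta> \<psi>" for \<psi>
    unfolding formula_def
  proof (intro allI impI)
    fix f g :: vec and n :: nat
    assume f: "continuous_on (shift_space k) f" and g: "continuous_on (shift_space k) g"
    show "\<psi> (Mop f \<circ> e_op k p n \<circ> Mop g) = (\<integral>x. f x * g x / complex_of_real (lambda_n p n x) \<partial>\<nu>)"
      by (rule KMS_generator[OF KMS H_holder f g])
  qed
  have "(\<exists>\<psi>. is_KMS k p \<mu> \<sigma> \<beta> \<psi>) \<and>
      (\<forall>\<psi>1 \<psi>2. is_KMS k p \<mu> \<sigma> \<beta> \<psi>1 \<longrightarrow> is_KMS k p \<mu> \<sigma> \<beta> \<psi>2 \<longrightarrow> agree \<psi>1 \<psi>2) \<and>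
      (\<forall>\<psi>. is_KMS k p \<mu> \<sigma> \<beta> \<psi> \<longrightarrow> formula \<psi>)"
    using psi_is_KMS agree formula by blast
  then show ?thesis unfolding agree_def formula_def .
qed

end
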